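(* Let $R\in\mathrm{SO}(3,\mathbb{Q})$. Then the three cubic lattices in $\mathbb{R}^3$ share the same index formula, i.e. $\Sigma_{\rm bcc}(R)=\Sigma_{\rm p}(R)=\Sigma_{\rm fcc}(R)$. In particular, the (elementary) coincidence spectrum for all three lattices is the set of odd positive integers $\{1,3,5,\ldots\}$, and for each of the three lattices the Dirichlet series generating function $\sum_{m\ge1}f(m)m^{-s}$ for the number $f(m)$ of coincidence site lattices of index $m$ is $$\Phi_{\rm cub}(s)=\frac{1-2^{1-s}}{1+2^{-s}}\cdot\frac{\zeta(s)\,\zeta(s-1)}{\zeta(2s)}=\frac{1}{1+2^{-s}}\cdot\frac{\zeta_{\mathbb{J}}(s/2)}{\zeta(2s)}=\frac{\zeta_{\mathbb{J}}(s/2)}{\zeta_{\mathbb{J}.\mathbb{J}}(s/2)},$$ where $\zeta$ is Riemann's zeta function.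
   Context: The three cubic lattices are the primitive cubic lattice $\Gamma_{\rm p}=\mathbb{Z}^3$, the body centred cubic lattice $\Gamma_{\rm bcc}=\mathbb{Z}^3\cup(v+\mathbb{Z}^3)$ with $v=\frac12(1,1,1)^t$, and the face centred cubic lattice $\Gamma_{\rm fcc}=\{(\ell,m,n)^t\in\mathbb{Z}^3\mid \ell+m+n \text{ even}\}$. For each such lattice $\Gamma$, the group of rotations $R\in\mathrm{SO}(3,\mathbb{R})$ for which $\Gamma\cap R\Gamma$ has finite index in both $\Gamma$ and $R\Gamma$ is $\mathrm{SO}(3,\mathbb{Q})$. For $R\in\mathrm{SO}(3,\mathbb{Q})$ and $\ast\in\{{\rm p},{\rm bcc},{\rm fcc}\}$, $\Sigma_\ast(R)=[\Gamma_\ast:(\Gamma_\ast\cap R\Gamma_\ast)]$. The (elementary) coincidence spectrum is the set of values $\{\Sigma_\ast(R)\mid R\in\mathrm{SO}(3,\mathbb{Q})\}$. A coincidence site lattice of $\Gamma_\ast$ is a sublattice of the form $\Gamma_\ast\cap R\Gamma_\ast$ with $R\in\mathrm{SO}(3,\mathbb{Q})$, its index is the group index in $\Gamma_\ast$, and $f(m)$ counts distinct ones of index $m$. $\mathbb{J}=\langle 1,\mathrm{i},\mathrm{j},\frac12(1+\mathrm{i}+\mathrm{j}+\mathrm{k})\rangle_{\mathbb{Z}}$ is the Hurwitz ring of integer quaternions in $\mathbb{H}(\mathbb{Q})$ (Hamilton's quaternions with rational coefficients). $\zeta_{\mathbb{J}}(s)=\sum_{\mathfrak{A}}[\mathbb{J}:\mathfrak{A}]^{-s}$,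 summed over all nonzero right ideals $\mathfrak{A}\subseteq\mathbb{J}$, and $\zeta_{\mathbb{J}.\mathbb{J}}(s)$ is the analogous sum over all nonzero two-sided ideals. *)

theory Defs
  imports "HOL-Analysis.Analysis" "HOL-Algebra.Ideal"
begin

text \<open>An infinite index is rendered as \<open>0\<close>.\<close>

definition group_index :: "('a, 'b) monoid_scheme \<Rightarrow> 'a set \<Rightarrow> nat" where
  "group_index G H = card (rcosets\<^bsub>G\<^esub> H)"

definition add_group_on :: "'a::ab_group_add set \<Rightarrow> 'a monoid" where
  "add_group_on S = \<lparr>carrier = S, monoid.mult = (+), one = 0\<rparr>"

definition lat_p :: "(real ^ 3) set" where
  "lat_p = {x. \<forall>i. x $ i \<in> \<int>}"

definition lat_bcc :: "(real ^ 3) set" where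
  "lat_bcc = lat_p \<union> (+) ((1/2) *\<^sub>R vector [1, 1, 1]) ` lat_p"

definition lat_fcc :: "(real ^ 3) set" where
  "lat_fcc = {vector [of_int l, of_int m, of_int n] | l m n :: int. even (l + m + n)}"

definition SO3Q :: "(real ^ 3 ^ 3) set" where
  "SO3Q = {R. rotation_matrix R \<and> (\<forall>i j. R $ i $ j \<in> \<rat>)}"

definition csl :: "(real ^ 3) set \<Rightarrow> real ^ 3 ^ 3 \<Rightarrow> (real ^ 3) set" where
  "csl \<Gamma> R = \<Gamma> \<inter> (*v) R ` \<Gamma>"

definition coincidence_index :: "(real ^ 3) set \<Rightarrow> real ^ 3 ^ 3 \<Rightarrow> nat" where
  "coincidence_index \<Gamma> R = group_index (add_group_on \<Gamma>) (csl \<Gamma> R)"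

definition coincidence_spectrum :: "(real ^ 3) set \<Rightarrow> nat set" where
  "coincidence_spectrum \<Gamma> = coincidence_index \<Gamma> ` SO3Q"

definition csls_of_index :: "(real ^ 3) set \<Rightarrow> nat \<Rightarrow> (real ^ 3) set set" where
  "csls_of_index \<Gamma> m = {L \<in> csl \<Gamma> ` SO3Q. group_index (add_group_on \<Gamma>) L = m}"

definition csl_count :: "(real ^ 3) set \<Rightarrow> nat \<Rightarrow> nat" where
  "csl_count \<Gamma> m = card (csls_of_index \<Gamma> m)"

datatype quat = Quat (quat_re: rat) (quat_i: rat) (quat_j: rat) (quat_k: rat)

instantiation quat :: ring_1
begin

definition "0 = Quat 0 0 0 0"
definition "1 = Quat 1 0 0 0"
definition "x + y = Quat (quat_re x + quat_re y) (quat_i x + quat_i y)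
                         (quat_j x + quat_j y) (quat_k x + quat_k y)"
definition "- x = Quat (- quat_re x) (- quat_i x) (- quat_j x) (- quat_k x)"
definition "x - y = Quat (quat_re x - quat_re y) (quat_i x - quat_i y)
                         (quat_j x - quat_j y) (quat_k x - quat_k y)"
definition "x * y = Quat
  (quat_re x * quat_re y - quat_i x * quat_i y - quat_j x * quat_j y - quat_k x * quat_k y)
  (quat_re x * quat_i y + quat_i x * quat_re y + quat_j x * quat_k y - quat_k x * quat_j y)
  (quat_re x * quat_j y - quat_i x * quat_k y + quat_j x * quat_re y + quat_k x * quat_i y)
  (quat_re x * quat_k y + quat_i x * quat_j y - quat_j x * quat_i y + quat_k x * quat_re y)"

lemmas quat_op_defs = zero_quat_def one_quat_def plus_quat_def uminus_quat_def minus_quat_def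
  times_quat_def

instance
  by standard (simp_all add: quat_op_defs algebra_simps)

end

lemma of_int_quat: "of_int n = Quat (of_int n) 0 0 0"
proof -
  have nat: "of_nat m = Quat (of_nat m) 0 0 0" for m
    by (induction m) (simp_all add: quat_op_defs)
  show ?thesis
    by (cases n rule: int_diff_cases) (simp add: nat quat_op_defs)
qed

definition hurwitz :: "quat set" where
  "hurwitz = {of_int a + of_int b * Quat 0 1 0 0 + of_int c * Quat 0 0 1 0
               + of_int d * Quat (1/2) (1/2) (1/2) (1/2) | a b c d. True}"

definition hurwitz_ring :: "quat ring" where
  "hurwitz_ring = \<lparr>carrier = hurwitz, monoid.mult = (*), one = 1, zero = 0, add = (+)\<rparr>"

lemma mem_hurwitz_iff:
  "x \<in> hurwitz \<longleftrightarrow> (\<exists>a b c d :: int. x = Quat (of_int a + of_int d / 2) (of_int b + of_int d / 2)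
                                        (of_int c + of_int d / 2) (of_int d / 2))"
  unfolding hurwitz_def by (simp add: of_int_quat quat_op_defs)

lemma hurwitz_0: "0 \<in> hurwitz" and hurwitz_1: "1 \<in> hurwitz"
proof -
  show "0 \<in> hurwitz"
    unfolding mem_hurwitz_iff by (intro exI[of _ 0]) (simp add: quat_op_defs)
  show "1 \<in> hurwitz"
    unfolding mem_hurwitz_iff
    by (rule exI[of _ 1], (rule exI[of _ 0])+) (simp add: quat_op_defs)
qed

lemma hurwitz_add: "x + y \<in> hurwitz" if "x \<in> hurwitz" "y \<in> hurwitz"
proof -
  from that obtain a b c d e f g h :: int where
    "x = Quat (of_int a + of_int d / 2) (of_int b + of_int d / 2)
              (of_int c + of_int d / 2) (of_int d / 2)"
    "y = Quat (of_int e + of_int h / 2) (of_int f + of_int h / 2)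
              (of_int g + of_int h / 2) (of_int h / 2)"
    unfolding mem_hurwitz_iff by blast
  then show ?thesis
    unfolding mem_hurwitz_iff
    by (intro exI[of _ "a + e"] exI[of _ "b + f"] exI[of _ "c + g"] exI[of _ "d + h"])
       (simp add: quat_op_defs field_simps)
qed

lemma hurwitz_uminus: "- x \<in> hurwitz" if "x \<in> hurwitz"
proof -
  from that obtain a b c d :: int where
    "x = Quat (of_int a + of_int d / 2) (of_int b + of_int d / 2)
              (of_int c + of_int d / 2) (of_int d / 2)"
    unfolding mem_hurwitz_iff by blast
  then show ?thesis
    unfolding mem_hurwitz_iff
    by (intro exI[of _ "- a"] exI[of _ "- b"] exI[of _ "- c"] exI[of _ "- d"])
       (simp add: quat_op_defs)
qed

lemma hurwitz_mult: "x * y \<in> hurwitz" if "x \<in> hurwitz" "y \<in> hurwitz"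
proof -
  from that obtain a b c d e f g h :: int where
    "x = Quat (of_int a + of_int d / 2) (of_int b + of_int d / 2)
              (of_int c + of_int d / 2) (of_int d / 2)"
    "y = Quat (of_int e + of_int h / 2) (of_int f + of_int h / 2)
              (of_int g + of_int h / 2) (of_int h / 2)"
    unfolding mem_hurwitz_iff by blast
  then show ?thesis
    unfolding mem_hurwitz_iff
    by (intro exI[of _ "a*e - b*f - c*g - b*h - d*g - d*h - b*g + c*f"]
              exI[of _ "a*f + b*e + d*f + c*h - d*g - b*g + c*f"]
              exI[of _ "a*g + c*e - b*h + c*h + d*f - b*g + c*f"]
              exI[of _ "a*h + b*h - c*h + d*g - d*f + d*e + d*h + 2*b*g - 2*c*f"])
       (simp add: quat_op_defs field_simps)
qed

lemma ring_hurwitz: "ring hurwitz_ring"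
proof (rule ringI)
  show "abelian_group hurwitz_ring"
  proof (rule abelian_groupI)
    show "\<exists>y\<in>carrier hurwitz_ring. y \<oplus>\<^bsub>hurwitz_ring\<^esub> x = \<zero>\<^bsub>hurwitz_ring\<^esub>"
      if "x \<in> carrier hurwitz_ring" for x
      using that hurwitz_uminus by (intro bexI[of _ "- x"]) (simp_all add: hurwitz_ring_def)
  qed (simp_all add: hurwitz_ring_def hurwitz_0 hurwitz_add algebra_simps)
  show "Group.monoid hurwitz_ring"
    by (rule monoidI) (simp_all add: hurwitz_ring_def hurwitz_1 hurwitz_mult algebra_simps)
qed (simp_all add: hurwitz_ring_def algebra_simps)

definition right_ideal :: "'a set \<Rightarrow> ('a, 'b) ring_scheme \<Rightarrow> bool" where
  "right_ideal I R \<longleftrightarrow> additive_subgroup I R \<and> (\<forall>a\<in>I. \<forall>x\<in>carrier R. a \<otimes>\<^bsub>R\<^esub> x \<in> I)"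

definition ideal_index :: "quat set \<Rightarrow> nat" where
  "ideal_index I = group_index (add_monoid hurwitz_ring) I"

definition nonzero_right_ideals :: "quat set set" where
  "nonzero_right_ideals = {I. right_ideal I hurwitz_ring \<and> I \<noteq> {0}}"

definition nonzero_ideals :: "quat set set" where
  "nonzero_ideals = {I. ideal I hurwitz_ring \<and> I \<noteq> {0}}"

text \<open>
  These sums converge absolutely for \<open>Re s > 1\<close>; the value of an infinite sum that does not
  converge is \<open>0\<close> by convention.
\<close>

definition zeta_J :: "complex \<Rightarrow> complex" where
  "zeta_J s = (\<Sum>\<^sub>\<infinity>I\<in>nonzero_right_ideals. of_nat (ideal_index I) powr (- s))"

definition zeta_JJ :: "complex \<Rightarrow> complex" where
  "zeta_JJ s = (\<Sum>\<^sub>\<infinity>I\<in>nonzero_ideals. of_nat (ideal_index I) powr (- s))"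

text \<open>
  The Riemann zeta function, by its Dirichlet series. This is the correct value only in the half-plane
  \<open>Re s > 1\<close>; no analytic continuation is involved.
\<close>

definition zeta :: "complex \<Rightarrow> complex" where
  "zeta s = (\<Sum>\<^sub>\<infinity>n\<in>{1::nat..}. of_nat n powr (- s))"

end

theory Submission imports Defs begin

text \<open>
Let \<open>J\<close> be the Hurwitz order. A nonzero quaternion \<open>q\<close> acts on the pure quaternions by the
rotation \<open>x \<mapsto> q x q\<inverse>\<close>, and every rational rotation is of this form
(\<open>acts_as_exists\<close>). The primitive cubic lattice consists of the pure elements of \<open>J\<close>, the body
centred one of the imaginary parts of elements of \<open>J\<close>, and the face centred one of the pure
elements of even norm. Conjugation by units of \<open>J\<close>, by rational numbers and by \<open>1 + i\<close> maps each of
the three onto itself, so \<open>q\<close> can be divided on the right by such factors until it is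
\<^emph>\<open>reduced\<close>: it lies in \<open>J\<close>, its norm \<open>m\<close> is odd, and no integer greater than \<open>1\<close> divides it
(\<open>ex_reduced_same_qcsl\<close>).

For a reduced \<open>q\<close> the elements \<open>x\<close> of \<open>J\<close> with \<open>q\<inverse> x q \<in> J\<close> form the Eichler order
\<open>\<int> + q J\<close> (\<open>reduced_idealizer\<close>). The index of \<open>q J\<close> in \<open>J\<close> is \<open>m\<^sup>2\<close> (\<open>idx_rspan\<close>), and in
\<open>\<int> + q J\<close> it is \<open>m\<close>, hence the Eichler order has index \<open>m\<close> in \<open>J\<close>. As \<open>m\<close> is odd, neither the
restriction to pure quaternions, nor the passage between the three lattices, which differ by powers
of \<open>2\<close>, changes the index (\<open>idx_qcsl_pure_p\<close>, \<open>idx_qcsl_sublattice\<close>). Conversely, the coincidence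
site lattice determines the Eichler order and thereby \<open>q J\<close> (\<open>rspan_subset_if_eichler_eq\<close>). So, for
each of the lattices, \<open>f m\<close> is the number of right ideals \<open>q J\<close> with \<open>q\<close> reduced of norm \<open>m\<close>
(\<open>csls_of_index_bij\<close>).

Every nonzero right ideal is \<open>p T\<close> for exactly one reduced right ideal \<open>p J\<close> and one two-sided ideal
\<open>T\<close>, and the two-sided ideals are \<open>n J\<close> and \<open>n (1 + i) J\<close> with \<open>n \<ge> 1\<close> (\<open>bij_betw_right_ideals\<close>,
\<open>bij_betw_ideals\<close>). With \<open>\<Phi> s = (\<Sum>m. f m m\<^sup>-\<^sup>s)\<close> this reads \<open>zeta_J (s/2) = \<Phi> s * zeta_JJ (s/2)\<close>, where
\<open>zeta_JJ (s/2) = (1 + 2\<^sup>-\<^sup>s) * zeta (2 s)\<close>. It remains to count the right ideals of odd norm \<open>n\<close>. Modulo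
\<open>n\<close> the order becomes the ring of \<open>2 \<times> 2\<close> matrices over \<open>\<int>/n\<close>, in which a right ideal is given by
the module that the columns of its elements range over. So one has to count the sublattices
of index \<open>n\<close> in \<open>\<int>\<^sup>2\<close>, and Hermite normal forms do that (\<open>ideals_of_odd_norm_bij\<close>). Splitting the
right ideals of odd norm into reduced ones and odd integers gives
\<open>\<Phi> s * (1 - 4\<^sup>-\<^sup>s) * zeta (2 s) = (1 - 2\<^sup>1\<^sup>-\<^sup>s) * zeta (s - 1) * (1 - 2\<^sup>-\<^sup>s) * zeta s\<close>, which is the asserted
formula. A sublattice with cyclic quotient yields a reduced quaternion of any given odd norm
(\<open>ex_reduced_of_odd_norm\<close>), so the spectrum consists of all odd numbers.
\<close>

section \<open>The index of a subgroup of an abelian group\<close>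

definition add_subgroup :: "'a::ab_group_add set \<Rightarrow> bool" where
  "add_subgroup H \<longleftrightarrow> 0 \<in> H \<and> (\<forall>x\<in>H. \<forall>y\<in>H. x - y \<in> H)"

lemma add_subgroupI:
  assumes "0 \<in> H" "\<And>x y. x \<in> H \<Longrightarrow> y \<in> H \<Longrightarrow> x - y \<in> H"
  shows "add_subgroup H"
  using assms by (auto simp: add_subgroup_def)

lemma add_subgroup_zero: "add_subgroup H \<Longrightarrow> 0 \<in> H"
  and add_subgroup_diff: "add_subgroup H \<Longrightarrow> x \<in> H \<Longrightarrow> y \<in> H \<Longrightarrow> x - y \<in> H"
  by (auto simp: add_subgroup_def)

lemma add_subgroup_uminus: "add_subgroup H \<Longrightarrow> x \<in> H \<Longrightarrow> - x \<in> H"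
  by (metis add_subgroup_def diff_0)

lemma add_subgroup_add: "add_subgroup H \<Longrightarrow> x \<in> H \<Longrightarrow> y \<in> H \<Longrightarrow> x + y \<in> H"
  by (metis add_subgroup_diff add_subgroup_uminus diff_minus_eq_add)

text \<open>The value is \<open>0\<close> if the quotient is infinite. For a subgroup \<open>K\<close> that is not contained in \<open>S\<close>
this is the index of \<open>S \<inter> K\<close>.\<close>

definition idx :: "'a::ab_group_add set \<Rightarrow> 'a set \<Rightarrow> nat" where
  "idx S K = card ((\<lambda>x. (+) x ` K) ` S)"

lemma translate_eq_iff:
  assumes "add_subgroup K"
  shows "(+) x ` K = (+) y ` K \<longleftrightarrow> x - y \<in> K"
proof
  assume "(+) x ` K = (+) y ` K"
  then have "x + 0 \<in> (+) y ` K"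
    using add_subgroup_zero[OF assms] by blast
  then obtain k where "k \<in> K" "x = y + k" by auto
  then show "x - y \<in> K" by simp
next
  have sub: "(+) x ` K \<subseteq> (+) y ` K" if "x - y \<in> K" for x y
  proof
    fix z assume "z \<in> (+) x ` K"
    then obtain k where "k \<in> K" "z = y + ((x - y) + k)" by (auto simp: algebra_simps)
    then show "z \<in> (+) y ` K"
      using add_subgroup_add[OF assms that] by blast
  qed
  assume "x - y \<in> K"
  then show "(+) x ` K = (+) y ` K"
    using sub[of x y] sub[of y x] add_subgroup_uminus[OF assms, of "x - y"] by auto
qed

lemma card_image_eq_if_same_kernel:
  assumes "\<And>x y. x \<in> S \<Longrightarrow> y \<in> S \<Longrightarrow> f x = f y \<longleftrightarrow> g x = g y"
  shows "card (f ` S) = card (g ` S)"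
proof (rule bij_betw_same_card)
  show "bij_betw (\<lambda>c. g (inv_into S f c)) (f ` S) (g ` S)"
    unfolding bij_betw_def
  proof
    show "inj_on (\<lambda>c. g (inv_into S f c)) (f ` S)"
      by (rule inj_onI) (metis assms f_inv_into_f inv_into_into)
    have "g (inv_into S f (f x)) = g x" if "x \<in> S" for x
      by (metis assms f_inv_into_f image_eqI inv_into_into that)
    then show "(\<lambda>c. g (inv_into S f c)) ` f ` S = g ` S"
      by (auto simp: image_image)
  qed
qed

text \<open>The first isomorphism theorem for an arbitrary map whose fibres are the cosets. Tuples of residues
and of quotients with remainder are such maps, and all explicit indices below come from them.\<close>

lemma idx_eq_card_image:
  assumes "add_subgroup K" "\<And>x y. x \<in> S \<Longrightarrow> y \<in> S \<Longrightarrow> f x = f y \<longleftrightarrow> x - y \<in> K"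
  shows "idx S K = card (f ` S)"
  unfolding idx_def
  by (rule card_image_eq_if_same_kernel) (simp add: assms translate_eq_iff)

lemma idx_tower:
  assumes S: "add_subgroup S" and H: "add_subgroup H" and K: "add_subgroup K"
    and "K \<subseteq> H" "H \<subseteq> S"
  shows "idx S K = idx S H * idx H K"
proof -
  \<comment> \<open>With a representative \<open>r x\<close> of the coset of \<open>x\<close> modulo \<open>H\<close>, the pair of \<open>x + H\<close> and
      \<open>(x - r x) + K\<close> determines \<open>x + K\<close>, and all pairs occur.\<close>
  define r where "r x = (SOME y. y \<in> S \<and> y - x \<in> H)" for x
  have r: "r x \<in> S \<and> r x - x \<in> H" if "x \<in> S" for x
    unfolding r_def by (rule someI[of _ x]) (simp add: that add_subgroup_zero[OF H])
  have r_eq: "r x = r y" if "x - y \<in> H" for x y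
  proof -
    have "z - x \<in> H \<longleftrightarrow> z - y \<in> H" for z
      using add_subgroup_add[OF H, of "z - x" "x - y"] add_subgroup_diff[OF H, of "z - y" "x - y"] that
      by auto
    then show ?thesis unfolding r_def by simp
  qed
  define f where "f x = ((+) x ` H, (+) (x - r x) ` K)" for x
  have "idx S K = card (f ` S)"
  proof (rule idx_eq_card_image[OF K])
    fix x y
    have "x - r x - (y - r y) = x - y" if "x - y \<in> H" using r_eq[OF that] by simp
    then show "f x = f y \<longleftrightarrow> x - y \<in> K"
      using \<open>K \<subseteq> H\<close> by (auto simp: f_def translate_eq_iff[OF H] translate_eq_iff[OF K])
  qed
  also have "f ` S = ((\<lambda>x. (+) x ` H) ` S) \<times> ((\<lambda>x. (+) x ` K) ` H)"
  proof
    have "x - r x \<in> H" if "x \<in> S" for x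
      using add_subgroup_uminus[OF H, of "r x - x"] r[OF that] by simp
    then show "f ` S \<subseteq> ((\<lambda>x. (+) x ` H) ` S) \<times> ((\<lambda>x. (+) x ` K) ` H)"
      by (auto simp: f_def)
    show "((\<lambda>x. (+) x ` H) ` S) \<times> ((\<lambda>x. (+) x ` K) ` H) \<subseteq> f ` S"
    proof safe
      fix s h assume s: "s \<in> S" and h: "h \<in> H"
      define x where "x = r s + h"
      have "x - s \<in> H"
        using add_subgroup_add[OF H, of "r s - s" h] r[OF s] h by (simp add: x_def algebra_simps)
      then have "r x = r s" "(+) x ` H = (+) s ` H"
        using r_eq[of x s] by (auto simp: translate_eq_iff[OF H])
      moreover have "x - r s = h" by (simp add: x_def)
      moreover have "x \<in> S"
        using add_subgroup_add[OF S] r[OF s] h \<open>H \<subseteq> S\<close> by (auto simp: x_def)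
      ultimately show "((+) s ` H, (+) h ` K) \<in> f ` S"
        unfolding f_def by (intro image_eqI[of _ _ x]) auto
    qed
  qed
  finally show ?thesis
    by (simp add: idx_def card_cartesian_product)
qed

text \<open>The second isomorphism theorem, in the form \<open>S / K \<cong> S' / (S' \<inter> K)\<close> for \<open>S = S' + K\<close>.\<close>

lemma idx_second_iso:
  assumes S': "add_subgroup S'" "S' \<subseteq> S" and K: "add_subgroup K"
    and gen: "\<And>x. x \<in> S \<Longrightarrow> \<exists>s\<in>S'. x - s \<in> K"
  shows "idx S' (S' \<inter> K) = idx S K"
proof -
  have "add_subgroup (S' \<inter> K)"
    using S'(1) K by (auto simp: add_subgroup_def)
  then have "idx S' (S' \<inter> K) = card ((\<lambda>x. (+) x ` K) ` S')"
    by (rule idx_eq_card_image) (use add_subgroup_diff[OF S'(1)] translate_eq_iff[OF K] in auto)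
  also have "(\<lambda>x. (+) x ` K) ` S' = (\<lambda>x. (+) x ` K) ` S"
    using gen S'(2) translate_eq_iff[OF K] by (fastforce simp: image_iff)
  finally show ?thesis by (simp add: idx_def)
qed

lemma add_subgroup_image:
  assumes "add_subgroup K" "\<And>x y. x \<in> K \<Longrightarrow> y \<in> K \<Longrightarrow> f (x - y) = f x - f y"
  shows "add_subgroup (f ` K)"
proof (rule add_subgroupI)
  have "f (0 - 0) = f 0 - f 0"
    using assms add_subgroup_zero by blast
  then show "0 \<in> f ` K"
    using add_subgroup_zero[OF assms(1)] by (metis diff_self image_eqI)
next
  fix x y assume "x \<in> f ` K" "y \<in> f ` K"
  then show "x - y \<in> f ` K"
    using assms add_subgroup_diff[OF assms(1)] by (metis (no_types, lifting) imageE image_eqI)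
qed

lemma idx_image:
  assumes S: "add_subgroup S" and K: "add_subgroup K" "K \<subseteq> S"
    and f: "\<And>x y. x \<in> S \<Longrightarrow> y \<in> S \<Longrightarrow> f (x - y) = f x - f y" "inj_on f S"
  shows "idx (f ` S) (f ` K) = idx S K"
proof -
  have "add_subgroup (f ` K)"
    by (rule add_subgroup_image) (use K f in auto)
  then have "idx S K = card ((\<lambda>x. (+) (f x) ` f ` K) ` S)"
  proof (intro idx_eq_card_image[OF K(1)])
    fix x y assume "add_subgroup (f ` K)" "x \<in> S" "y \<in> S"
    then have "(+) (f x) ` f ` K = (+) (f y) ` f ` K \<longleftrightarrow> f (x - y) \<in> f ` K"
      by (simp add: translate_eq_iff f)
    also have "\<dots> \<longleftrightarrow> x - y \<in> K"
      using f(2) K(2) add_subgroup_diff[OF S \<open>x \<in> S\<close> \<open>y \<in> S\<close>] by (auto simp: inj_on_def)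
    finally show "((+) (f x) ` f ` K = (+) (f y) ` f ` K) = (x - y \<in> K)" .
  qed
  then show ?thesis by (simp add: idx_def image_image)
qed

lemma group_index_eq_idx:
  assumes "\<And>x y. x \<otimes>\<^bsub>G\<^esub> y = x + y"
  shows "group_index G K = idx (carrier G) K"
proof -
  have "rcosets\<^bsub>G\<^esub> K = (\<lambda>x. (+) x ` K) ` carrier G"
    by (auto simp: RCOSETS_def r_coset_def assms add.commute)
  then show ?thesis by (simp add: group_index_def idx_def)
qed

lemma group_index_add_group_on: "group_index (add_group_on S) K = idx S K"
  by (subst group_index_eq_idx) (simp_all add: add_group_on_def)

lemma ideal_index_eq_idx: "ideal_index I = idx hurwitz I"
  unfolding ideal_index_def
  by (subst group_index_eq_idx) (simp_all add: hurwitz_ring_def)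

section \<open>Rational quaternions and the Hurwitz order\<close>

definition qcnj :: "quat \<Rightarrow> quat" where
  "qcnj x = Quat (quat_re x) (- quat_i x) (- quat_j x) (- quat_k x)"

definition qnorm :: "quat \<Rightarrow> rat" where
  "qnorm x = (quat_re x)\<^sup>2 + (quat_i x)\<^sup>2 + (quat_j x)\<^sup>2 + (quat_k x)\<^sup>2"

definition qscal :: "rat \<Rightarrow> quat" where
  "qscal r = Quat r 0 0 0"

lemmas quat_comp_defs = quat_op_defs qcnj_def qnorm_def qscal_def of_int_quat

lemma quat_sel_simps [simp]:
  "quat_re (x + y) = quat_re x + quat_re y" "quat_i (x + y) = quat_i x + quat_i y"
  "quat_j (x + y) = quat_j x + quat_j y" "quat_k (x + y) = quat_k x + quat_k y"
  "quat_re (x - y) = quat_re x - quat_re y" "quat_i (x - y) = quat_i x - quat_i y"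
  "quat_j (x - y) = quat_j x - quat_j y" "quat_k (x - y) = quat_k x - quat_k y"
  "quat_re (- x) = - quat_re x" "quat_i (- x) = - quat_i x"
  "quat_j (- x) = - quat_j x" "quat_k (- x) = - quat_k x"
  "quat_re 0 = 0" "quat_i 0 = 0" "quat_j 0 = 0" "quat_k 0 = 0"
  "quat_re 1 = 1" "quat_i 1 = 0" "quat_j 1 = 0" "quat_k 1 = 0"
  "quat_re (qscal r) = r" "quat_i (qscal r) = 0" "quat_j (qscal r) = 0" "quat_k (qscal r) = 0"
  "quat_re (qcnj x) = quat_re x" "quat_i (qcnj x) = - quat_i x"
  "quat_j (qcnj x) = - quat_j x" "quat_k (qcnj x) = - quat_k x"
  by (simp_all add: quat_comp_defs)

lemma quat_sel_of_int [simp]: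
  "quat_re (of_int n) = of_int n" "quat_i (of_int n) = 0" "quat_j (of_int n) = 0"
  "quat_k (of_int n) = 0"
  by (simp_all add: of_int_quat)

lemma quat_sel_numeral [simp]:
  "quat_re (numeral w) = numeral w" "quat_i (numeral w) = 0" "quat_j (numeral w) = 0"
  "quat_k (numeral w) = 0"
  using quat_sel_of_int[of "numeral w"] by simp_all

lemma qscal_of_int: "qscal (of_int n) = of_int n"
  by (simp add: qscal_def of_int_quat)

lemma qscal_simps:
  "qscal r * qscal s = qscal (r * s)" "qscal r + qscal s = qscal (r + s)" "qscal 0 = 0"
  "qscal 1 = 1" "qscal r - qscal s = qscal (r - s)"
  by (simp_all add: quat_comp_defs)

lemma qscal_commute: "qscal r * x = x * qscal r"
  by (simp add: quat_comp_defs)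

lemma qscal_left_commute: "y * (qscal r * x) = qscal r * (y * x)"
  by (metis mult.assoc qscal_commute)

lemma of_int_quat_commute: "(of_int n :: quat) * x = x * of_int n"
  by (metis qscal_commute qscal_of_int)

lemma of_int_quat_left_commute: "y * ((of_int n :: quat) * x) = of_int n * (y * x)"
  by (metis mult.assoc of_int_quat_commute)

lemma qcnj_mult: "qcnj (x * y) = qcnj y * qcnj x"
  by (simp add: quat_comp_defs algebra_simps)

lemma qcnj_simps [simp]:
  "qcnj (qcnj x) = x" "qcnj (x + y) = qcnj x + qcnj y" "qcnj (x - y) = qcnj x - qcnj y"
  "qcnj (qscal r) = qscal r" "qcnj (of_int n) = of_int n" "qcnj 0 = 0" "qcnj 1 = 1"
  by (simp_all add: quat_comp_defs)

lemma mult_qcnj: "x * qcnj x = qscal (qnorm x)"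
  and qcnj_mult_self: "qcnj x * x = qscal (qnorm x)"
  by (simp_all add: quat_comp_defs algebra_simps power2_eq_square)

lemma qnorm_mult: "qnorm (x * y) = qnorm x * qnorm y"
  by (simp add: quat_comp_defs algebra_simps power2_eq_square)

lemma qnorm_simps [simp]:
  "qnorm (qcnj x) = qnorm x" "qnorm (- x) = qnorm x" "qnorm (qscal r) = r\<^sup>2"
  "qnorm (of_int n) = (of_int n)\<^sup>2" "qnorm 0 = 0" "qnorm 1 = 1"
  by (simp_all add: quat_comp_defs)

lemma qnorm_nonneg: "0 \<le> qnorm x"
  by (simp add: qnorm_def)

lemma qnorm_eq_0_iff [simp]: "qnorm x = 0 \<longleftrightarrow> x = 0"
proof -
  have "quat_re x = 0 \<and> quat_i x = 0 \<and> quat_j x = 0 \<and> quat_k x = 0" if "qnorm x = 0"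
    using that unfolding qnorm_def by (simp add: add_nonneg_eq_0_iff)
  then show ?thesis by (auto intro!: quat.expand)
qed

lemma qnorm_pos_iff: "0 < qnorm x \<longleftrightarrow> x \<noteq> 0"
  by (metis qnorm_eq_0_iff qnorm_nonneg order_less_le)

instantiation quat :: division_ring
begin

definition "inverse x = qscal (1 / qnorm x) * qcnj x"
definition "(x :: quat) div y = x * inverse y"

instance
proof
  fix a b :: quat
  assume "a \<noteq> 0"
  then have *: "qscal (1 / qnorm a) * qscal (qnorm a) = 1" by (simp add: qscal_simps)
  show "inverse a * a = 1"
    using * by (simp only: inverse_quat_def mult.assoc qcnj_mult_self)
  show "a * inverse a = 1"
    using * by (simp only: inverse_quat_def qscal_left_commute mult_qcnj)
next
  fix a b :: quat
  show "a div b = a * inverse b" by (rule divide_quat_def)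
  show "inverse (0 :: quat) = 0" by (simp add: inverse_quat_def)
qed

end

instance quat :: ring_char_0
proof
  show "inj (of_nat :: nat \<Rightarrow> quat)"
    by (rule injI) (metis of_int_of_nat_eq of_nat_eq_iff quat_sel_of_int(1))
qed

lemma quat_trace: "x + qcnj x = qscal (2 * quat_re x)"
  by (simp add: quat_comp_defs)

text \<open>This is the Cayley-Hamilton identity for \<open>qcnj x * y\<close>. Modulo the norm of \<open>x\<close> it says that
\<open>qcnj x * y * qcnj x\<close> is a scalar multiple of \<open>qcnj x\<close>, as for a matrix of rank one.\<close>

lemma qcnj_sandwich: "qcnj x * y * qcnj x = qscal (2 * quat_re (qcnj x * y)) * qcnj x - qscal (qnorm x) * qcnj y"
proof -
  have "qscal (2 * quat_re (qcnj x * y)) * qcnj x = qcnj x * y * qcnj x + qcnj y * (x * qcnj x)"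
    by (simp add: quat_trace[symmetric] qcnj_mult algebra_simps)
  then show ?thesis by (simp add: mult_qcnj qscal_commute)
qed

subsection \<open>Coordinates\<close>

lemma hurwitz_iff_half_ints:
  "x \<in> hurwitz \<longleftrightarrow> (\<exists>A B C D :: int. x = Quat (of_int A / 2) (of_int B / 2) (of_int C / 2) (of_int D / 2)
      \<and> even (A - D) \<and> even (B - D) \<and> even (C - D))"
proof
  assume "x \<in> hurwitz"
  then obtain a b c d :: int where "x = Quat (of_int a + of_int d / 2) (of_int b + of_int d / 2)
                                        (of_int c + of_int d / 2) (of_int d / 2)"
    unfolding mem_hurwitz_iff by blast
  then show "\<exists>A B C D :: int. x = Quat (of_int A / 2) (of_int B / 2) (of_int C / 2) (of_int D / 2)
      \<and> even (A - D) \<and> even (B - D) \<and> even (C - D)"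
    by (intro exI[of _ "2*a+d"] exI[of _ "2*b+d"] exI[of _ "2*c+d"] exI[of _ d])
       (simp add: field_simps)
next
  assume "\<exists>A B C D :: int. x = Quat (of_int A / 2) (of_int B / 2) (of_int C / 2) (of_int D / 2)
      \<and> even (A - D) \<and> even (B - D) \<and> even (C - D)"
  then obtain A B C D :: int where x: "x = Quat (of_int A / 2) (of_int B / 2) (of_int C / 2) (of_int D / 2)"
      and "even (A - D)" "even (B - D)" "even (C - D)" by blast
  then obtain a b c where "A - D = 2 * a" "B - D = 2 * b" "C - D = 2 * c" by (meson evenE)
  then have "A = 2 * a + D" "B = 2 * b + D" "C = 2 * c + D" by auto
  then show "x \<in> hurwitz"
    unfolding mem_hurwitz_iff x
    by (intro exI[of _ a] exI[of _ b] exI[of _ c] exI[of _ D]) (simp add: field_simps)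
qed

lemma int_quat_in_hurwitz: "Quat (of_int a) (of_int b) (of_int c) (of_int d) \<in> hurwitz"
  unfolding mem_hurwitz_iff
  by (rule exI[of _ "a - d"], rule exI[of _ "b - d"], rule exI[of _ "c - d"], rule exI[of _ "2 * d"]) simp

lemma hurwitz_diff: "x - y \<in> hurwitz" if "x \<in> hurwitz" "y \<in> hurwitz"
  using hurwitz_add[OF that(1) hurwitz_uminus[OF that(2)]] by simp

lemma add_subgroup_hurwitz: "add_subgroup hurwitz"
  by (simp add: add_subgroup_def hurwitz_0 hurwitz_diff)

lemma hurwitz_of_int: "of_int n \<in> hurwitz"
  using int_quat_in_hurwitz[of n 0 0 0] by (simp add: of_int_quat)

lemma hurwitz_qcnj: "x \<in> hurwitz \<Longrightarrow> qcnj x \<in> hurwitz"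
  unfolding hurwitz_iff_half_ints
proof (elim exE conjE)
  fix A B C D :: int
  assume "x = Quat (of_int A / 2) (of_int B / 2) (of_int C / 2) (of_int D / 2)"
    "even (A - D)" "even (B - D)" "even (C - D)"
  then show "\<exists>A B C D :: int. qcnj x = Quat (of_int A / 2) (of_int B / 2) (of_int C / 2) (of_int D / 2)
      \<and> even (A - D) \<and> even (B - D) \<and> even (C - D)"
    by (intro exI[of _ A] exI[of _ "-B"] exI[of _ "-C"] exI[of _ "-D"]) (simp add: qcnj_def)
qed

lemma hurwitz_two_times:
  assumes "x \<in> hurwitz"
  shows "\<exists>A B C D :: int. 2 * x = Quat (of_int A) (of_int B) (of_int C) (of_int D)"
proof -
  have "2 * x = Quat (2 * quat_re x) (2 * quat_i x) (2 * quat_j x) (2 * quat_k x)"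
    by (simp add: times_quat_def)
  then show ?thesis using assms unfolding hurwitz_iff_half_ints by fastforce
qed

lemma hurwitz_trace: "x \<in> hurwitz \<Longrightarrow> \<exists>t :: int. 2 * quat_re x = of_int t"
  unfolding hurwitz_iff_half_ints by fastforce

lemma hurwitz_qnorm_int:
  assumes "x \<in> hurwitz" shows "\<exists>n :: nat. qnorm x = of_nat n"
proof -
  obtain a b c d :: int where x: "x = Quat (of_int a + of_int d / 2) (of_int b + of_int d / 2)
                                        (of_int c + of_int d / 2) (of_int d / 2)"
    using assms unfolding mem_hurwitz_iff by blast
  have "qnorm x = of_int (a\<^sup>2 + b\<^sup>2 + c\<^sup>2 + a*d + b*d + c*d + d\<^sup>2)"
    by (simp add: x qnorm_def power2_eq_square field_simps)
  then show ?thesis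
    by (metis of_int_0_le_iff of_int_of_nat_eq qnorm_nonneg zero_le_imp_eq_int)
qed

definition hnorm :: "quat \<Rightarrow> nat" where
  "hnorm x = nat \<lfloor>qnorm x\<rfloor>"

lemma of_nat_hnorm: "x \<in> hurwitz \<Longrightarrow> of_nat (hnorm x) = qnorm x"
  using hurwitz_qnorm_int unfolding hnorm_def by fastforce

lemma hnorm_mult: "x \<in> hurwitz \<Longrightarrow> y \<in> hurwitz \<Longrightarrow> hnorm (x * y) = hnorm x * hnorm y"
  by (metis hurwitz_mult of_nat_eq_iff of_nat_hnorm of_nat_mult qnorm_mult)

lemma hnorm_eq_0_iff: "x \<in> hurwitz \<Longrightarrow> hnorm x = 0 \<longleftrightarrow> x = 0"
  by (metis of_nat_0_eq_iff of_nat_hnorm qnorm_eq_0_iff)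

lemma hnorm_qcnj [simp]: "hnorm (qcnj x) = hnorm x"
  by (simp add: hnorm_def)

lemma hnorm_of_int: "hnorm (of_int n) = nat (n\<^sup>2)"
  by (simp add: hnorm_def flip: of_int_power)

lemma hnorm_self:
  assumes "x \<in> hurwitz"
  shows "x * qcnj x = of_int (int (hnorm x))" "qcnj x * x = of_int (int (hnorm x))"
proof -
  have "qscal (qnorm x) = of_int (int (hnorm x))"
    using of_nat_hnorm[OF assms] qscal_of_int[of "int (hnorm x)"] by simp
  then show "x * qcnj x = of_int (int (hnorm x))" "qcnj x * x = of_int (int (hnorm x))"
    by (simp_all only: mult_qcnj qcnj_mult_self)
qed

definition hunit :: "quat \<Rightarrow> bool" where
  "hunit u \<longleftrightarrow> u \<in> hurwitz \<and> (\<exists>v\<in>hurwitz. u * v = 1 \<and> v * u = 1)"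

lemma hunit_if_hnorm_1: "u \<in> hurwitz \<Longrightarrow> hnorm u = 1 \<Longrightarrow> hunit u"
  unfolding hunit_def using hnorm_self[of u] hurwitz_qcnj by (intro conjI bexI[of _ "qcnj u"]) auto

subsection \<open>Division with remainder\<close>

text \<open>Rounding the coordinates leaves a remainder of norm at most \<open>1\<close>, with equality only if every
coordinate of \<open>x\<close> is half an odd integer; but then \<open>x\<close> itself lies in the order.\<close>

lemma hurwitz_approx: "\<exists>c\<in>hurwitz. qnorm (x - c) < 1"
proof -
  define f where "f = (\<lambda>r::rat. r - of_int (round r))"
  have f: "(f r)\<^sup>2 \<le> 1/4" "(f r)\<^sup>2 = 1/4 \<Longrightarrow> \<exists>n::int. r = of_int n + 1/2" for r
  proof -
    have "\<bar>f r\<bar> \<le> 1/2"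
      using of_int_round_abs_le[of r] by (simp add: f_def abs_minus_commute)
    then show "(f r)\<^sup>2 \<le> 1/4"
      using abs_le_square_iff[of "f r" "1/2"] by (simp add: power2_eq_square)
    assume "(f r)\<^sup>2 = 1/4"
    then have "(f r)\<^sup>2 = (1/2)\<^sup>2" by (simp add: power2_eq_square)
    then have "f r = 1/2 \<or> f r = - (1/2)" by (simp only: power2_eq_iff)
    then show "\<exists>n::int. r = of_int n + 1/2"
    proof
      assume "f r = 1/2" then show ?thesis by (intro exI[of _ "round r"]) (simp add: f_def)
    next
      assume "f r = - (1/2)" then show ?thesis by (intro exI[of _ "round r - 1"]) (simp add: f_def)
    qed
  qed
  define c where "c = Quat (of_int (round (quat_re x))) (of_int (round (quat_i x)))
      (of_int (round (quat_j x))) (of_int (round (quat_k x)))"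
  have c: "c \<in> hurwitz" by (simp add: c_def int_quat_in_hurwitz)
  have n: "qnorm (x - c) = (f (quat_re x))\<^sup>2 + (f (quat_i x))\<^sup>2 + (f (quat_j x))\<^sup>2 + (f (quat_k x))\<^sup>2"
    by (simp add: qnorm_def c_def f_def)
  show ?thesis
  proof (cases "qnorm (x - c) < 1")
    case True then show ?thesis using c by blast
  next
    case False
    then have "(f (quat_re x))\<^sup>2 = 1/4" "(f (quat_i x))\<^sup>2 = 1/4" "(f (quat_j x))\<^sup>2 = 1/4" "(f (quat_k x))\<^sup>2 = 1/4"
      using n f(1)[of "quat_re x"] f(1)[of "quat_i x"] f(1)[of "quat_j x"] f(1)[of "quat_k x"] by auto
    then obtain k l m n :: int where "quat_re x = of_int k + 1/2" "quat_i x = of_int l + 1/2"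
      "quat_j x = of_int m + 1/2" "quat_k x = of_int n + 1/2"
      using f(2) by metis
    then have "x = Quat (of_int (2*k+1) / 2) (of_int (2*l+1) / 2) (of_int (2*m+1) / 2) (of_int (2*n+1) / 2)"
      by (intro quat.expand) (simp add: field_simps)
    then have "x \<in> hurwitz"
      unfolding hurwitz_iff_half_ints
      by (intro exI[of _ "2*k+1"] exI[of _ "2*l+1"] exI[of _ "2*m+1"] exI[of _ "2*n+1"]) simp
    then show ?thesis by (intro bexI[of _ x]) auto
  qed
qed

definition rspan :: "quat \<Rightarrow> quat set" where
  "rspan q = (*) q ` hurwitz"

lemma mem_rspan_iff: "x \<in> rspan q \<longleftrightarrow> (\<exists>z\<in>hurwitz. x = q * z)"
  by (auto simp: rspan_def)

lemma add_subgroup_rspan: "add_subgroup (rspan q)"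
  unfolding rspan_def by (rule add_subgroup_image[OF add_subgroup_hurwitz]) (simp add: right_diff_distrib)

lemma rspan_mult_right: "x \<in> rspan q \<Longrightarrow> z \<in> hurwitz \<Longrightarrow> x * z \<in> rspan q"
  unfolding rspan_def by (auto simp: mult.assoc intro!: imageI hurwitz_mult)

lemma rspan_self: "q \<in> rspan q"
  unfolding rspan_def using hurwitz_1 by force

lemma rspan_subset_hurwitz: "q \<in> hurwitz \<Longrightarrow> rspan q \<subseteq> hurwitz"
  unfolding rspan_def using hurwitz_mult by auto

lemma hnorm_in_rspan: "q \<in> hurwitz \<Longrightarrow> of_int (int (hnorm q)) \<in> rspan q"
  unfolding mem_rspan_iff using hnorm_self(1) hurwitz_qcnj by metis

lemma right_ideal_hurwitz_iff:
  "right_ideal I hurwitz_ring \<longleftrightarrow>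
     I \<subseteq> hurwitz \<and> add_subgroup I \<and> (\<forall>x\<in>I. \<forall>z\<in>hurwitz. x * z \<in> I)"
proof -
  have inv: "inv\<^bsub>add_monoid hurwitz_ring\<^esub> x = - x" if "x \<in> hurwitz" for x
  proof -
    interpret ring hurwitz_ring by (rule ring_hurwitz)
    show ?thesis
      using minus_equality[of "- x" x] that hurwitz_uminus
      by (simp add: a_inv_def hurwitz_ring_def)
  qed
  have "additive_subgroup I hurwitz_ring \<longleftrightarrow> I \<subseteq> hurwitz \<and> add_subgroup I"
  proof
    assume "additive_subgroup I hurwitz_ring"
    then have sub: "subgroup I (add_monoid hurwitz_ring)" by (simp add: additive_subgroup_def)
    have I: "I \<subseteq> hurwitz" using subgroup.subset[OF sub] by (simp add: hurwitz_ring_def)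
    moreover have "add_subgroup I"
    proof (rule add_subgroupI)
      show "0 \<in> I" using subgroup.one_closed[OF sub] by (simp add: hurwitz_ring_def)
      fix x y assume "x \<in> I" "y \<in> I"
      then have "- y \<in> I" using subgroup.m_inv_closed[OF sub, of y] inv I by auto
      then show "x - y \<in> I"
        using subgroup.m_closed[OF sub \<open>x \<in> I\<close>, of "- y"] by (simp add: hurwitz_ring_def)
    qed
    ultimately show "I \<subseteq> hurwitz \<and> add_subgroup I" by blast
  next
    assume *: "I \<subseteq> hurwitz \<and> add_subgroup I"
    have "subgroup I (add_monoid hurwitz_ring)"
    proof (rule subgroup.intro)
      show "I \<subseteq> carrier (add_monoid hurwitz_ring)"
        using * by (simp add: hurwitz_ring_def)
      show "x \<otimes>\<^bsub>add_monoid hurwitz_ring\<^esub> y \<in> I" if "x \<in> I" "y \<in> I" for x y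
        using * that add_subgroup_add[of I x y] by (simp add: hurwitz_ring_def)
      show "\<one>\<^bsub>add_monoid hurwitz_ring\<^esub> \<in> I"
        using * add_subgroup_zero[of I] by (simp add: hurwitz_ring_def)
      show "inv\<^bsub>add_monoid hurwitz_ring\<^esub> x \<in> I" if "x \<in> I" for x
        using * that inv[of x] add_subgroup_uminus by (metis subsetD)
    qed
    then show "additive_subgroup I hurwitz_ring" by (simp add: additive_subgroup_def)
  qed
  then show ?thesis
    unfolding right_ideal_def by (auto simp: hurwitz_ring_def)
qed

lemma right_ideal_principal:
  assumes "right_ideal I hurwitz_ring" "I \<noteq> {0}"
  obtains q where "q \<in> hurwitz" "q \<noteq> 0" "I = rspan q"
proof -
  from assms(1) have I: "I \<subseteq> hurwitz" "add_subgroup I" "\<And>x z. x \<in> I \<Longrightarrow> z \<in> hurwitz \<Longrightarrow> x * z \<in> I"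
    by (auto simp: right_ideal_hurwitz_iff)
  obtain x0 where "x0 \<in> I \<and> x0 \<noteq> 0"
    using assms(2) add_subgroup_zero[OF I(2)] by blast
  then obtain q where q: "q \<in> I \<and> q \<noteq> 0" and min: "\<And>y. y \<in> I \<and> y \<noteq> 0 \<Longrightarrow> hnorm q \<le> hnorm y"
    using exists_least_lemma[of "\<lambda>_. False"] ex_has_least_nat[of "\<lambda>x. x \<in> I \<and> x \<noteq> 0" x0 hnorm] by blast
  have qH: "q \<in> hurwitz" using q I by blast
  have "I = rspan q"
  proof
    show "rspan q \<subseteq> I" unfolding rspan_def using I(3) q by blast
    show "I \<subseteq> rspan q"
    proof
      fix x assume x: "x \<in> I"
      obtain c where c: "c \<in> hurwitz" "qnorm (inverse q * x - c) < 1" using hurwitz_approx by blast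
      define y where "y = x - q * c"
      have yI: "y \<in> I" unfolding y_def using add_subgroup_diff[OF I(2)] x I(3) q c by blast
      have "y = q * (inverse q * x - c)"
        using q by (simp add: y_def right_diff_distrib mult.assoc[symmetric])
      then have "qnorm y < qnorm q"
        using c(2) q by (simp add: qnorm_mult qnorm_pos_iff)
      then have "hnorm y < hnorm q"
        using of_nat_hnorm yI q I by (metis of_nat_less_iff subsetD)
      then have "y = 0" using min[of y] yI by (meson leD)
      then show "x \<in> rspan q" using c(1) by (auto simp: y_def mem_rspan_iff)
    qed
  qed
  then show thesis using that qH q by blast
qed

lemma right_ideal_rspan: "q \<in> hurwitz \<Longrightarrow> right_ideal (rspan q) hurwitz_ring"
  unfolding right_ideal_hurwitz_iff
  using rspan_subset_hurwitz add_subgroup_rspan rspan_mult_right by blast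

lemma nonzero_right_ideals_eq: "nonzero_right_ideals = rspan ` (hurwitz - {0})"
proof
  show "nonzero_right_ideals \<subseteq> rspan ` (hurwitz - {0})"
  proof
    fix I assume "I \<in> nonzero_right_ideals"
    then obtain q where "q \<in> hurwitz" "q \<noteq> 0" "I = rspan q"
      unfolding nonzero_right_ideals_def using right_ideal_principal by blast
    then show "I \<in> rspan ` (hurwitz - {0})" by blast
  qed
  show "rspan ` (hurwitz - {0}) \<subseteq> nonzero_right_ideals"
  proof
    fix I assume "I \<in> rspan ` (hurwitz - {0})"
    then obtain q where q: "q \<in> hurwitz" "q \<noteq> 0" "I = rspan q" by blast
    then have "I \<noteq> {0}" using rspan_self[of q] by auto
    then show "I \<in> nonzero_right_ideals"
      unfolding nonzero_right_ideals_def using q right_ideal_rspan by blast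
  qed
qed

section \<open>The index of a principal right ideal\<close>

lemma rspan_mult: "rspan (p * q) = (*) p ` rspan q"
  by (simp add: rspan_def image_image mult.assoc)

lemma rspan_mult_subset: "z \<in> hurwitz \<Longrightarrow> rspan (q * z) \<subseteq> rspan q"
  unfolding rspan_mult unfolding rspan_def using hurwitz_mult by auto

lemma idx_rspan_mult:
  assumes "p \<in> hurwitz" "p \<noteq> 0" "q \<in> hurwitz"
  shows "idx hurwitz (rspan (p * q)) = idx hurwitz (rspan p) * idx hurwitz (rspan q)"
proof -
  have "idx hurwitz (rspan (p * q)) = idx hurwitz (rspan p) * idx (rspan p) (rspan (p * q))"
    using assms by (intro idx_tower add_subgroup_hurwitz add_subgroup_rspan rspan_subset_hurwitz rspan_mult_subset)
  also have "idx (rspan p) (rspan (p * q)) = idx ((*) p ` hurwitz) ((*) p ` rspan q)"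
    by (simp add: rspan_mult) (simp add: rspan_def)
  also have "\<dots> = idx hurwitz (rspan q)"
    using assms by (intro idx_image add_subgroup_hurwitz add_subgroup_rspan rspan_subset_hurwitz)
      (auto simp: right_diff_distrib inj_on_def)
  finally show ?thesis .
qed

lemma idx_rspan_of_int:
  assumes n: "(n :: int) > 0"
  shows "idx hurwitz (rspan (of_int n)) = nat n ^ 4"
proof -
  define hq :: "int \<Rightarrow> int \<Rightarrow> int \<Rightarrow> int \<Rightarrow> quat" where
    "hq a b c d = Quat (of_int a + of_int d / 2) (of_int b + of_int d / 2)
                       (of_int c + of_int d / 2) (of_int d / 2)" for a b c d
  define f where "f x = (\<lfloor>quat_re x - quat_k x\<rfloor> mod n, \<lfloor>quat_i x - quat_k x\<rfloor> mod n,
      \<lfloor>quat_j x - quat_k x\<rfloor> mod n, \<lfloor>2 * quat_k x\<rfloor> mod n)" for x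
  have hur: "hurwitz = {hq a b c d | a b c d. True}"
    unfolding hq_def using mem_hurwitz_iff by auto
  have f: "f (hq a b c d) = (a mod n, b mod n, c mod n, d mod n)" for a b c d
    by (simp add: f_def hq_def)
  have diff: "hq a b c d - hq a' b' c' d' = hq (a - a') (b - b') (c - c') (d - d')" for a b c d a' b' c' d'
    by (simp add: hq_def quat_op_defs field_simps)
  have mult: "of_int n * hq a b c d = hq (n * a) (n * b) (n * c) (n * d)" for a b c d
    by (simp add: hq_def of_int_quat quat_op_defs algebra_simps)
  have inj: "hq a b c d = hq a' b' c' d' \<longleftrightarrow> a = a' \<and> b = b' \<and> c = c' \<and> d = d'" for a b c d a' b' c' d'
    by (auto simp: hq_def)
  have mem: "hq a b c d \<in> rspan (of_int n) \<longleftrightarrow> n dvd a \<and> n dvd b \<and> n dvd c \<and> n dvd d" for a b c d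
  proof
    assume "hq a b c d \<in> rspan (of_int n)"
    then show "n dvd a \<and> n dvd b \<and> n dvd c \<and> n dvd d"
      unfolding mem_rspan_iff hur by (auto simp: mult inj)
  next
    assume "n dvd a \<and> n dvd b \<and> n dvd c \<and> n dvd d"
    then obtain a' b' c' d' where "a = n * a'" "b = n * b'" "c = n * c'" "d = n * d'" by (meson dvdE)
    then have "hq a b c d = of_int n * hq a' b' c' d'" by (simp add: mult)
    then show "hq a b c d \<in> rspan (of_int n)" unfolding mem_rspan_iff hur by blast
  qed
  have "idx hurwitz (rspan (of_int n)) = card (f ` hurwitz)"
  proof (rule idx_eq_card_image[OF add_subgroup_rspan])
    fix x y assume "x \<in> hurwitz" "y \<in> hurwitz"
    then obtain a b c d a' b' c' d' where "x = hq a b c d" "y = hq a' b' c' d'"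
      unfolding hur by blast
    then show "f x = f y \<longleftrightarrow> x - y \<in> rspan (of_int n)"
      by (simp add: f diff mem mod_eq_dvd_iff)
  qed
  also have "f ` hurwitz = {0..<n} \<times> {0..<n} \<times> {0..<n} \<times> {0..<n}" (is "_ = ?B")
  proof
    show "f ` hurwitz \<subseteq> ?B" unfolding hur using n by (auto simp: f)
    show "?B \<subseteq> f ` hurwitz"
    proof
      fix t assume "t \<in> ?B"
      then obtain a b c d where "t = (a, b, c, d)" "0 \<le> a" "a < n" "0 \<le> b" "b < n" "0 \<le> c" "c < n" "0 \<le> d" "d < n"
        by auto
      then have "t = f (hq a b c d)" by (simp add: f)
      then show "t \<in> f ` hurwitz" unfolding hur by blast
    qed
  qed
  finally show ?thesis
    by (simp add: card_cartesian_product power4_eq_xxxx)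
qed

text \<open>A pure quaternion that is orthogonal to the imaginary part of \<open>q\<close> anticommutes with it.\<close>

lemma ex_anticommuting:
  assumes "q \<in> hurwitz"
  shows "\<exists>s\<in>hurwitz. s \<noteq> 0 \<and> s * q = qcnj q * s"
proof (cases "quat_i q = 0 \<and> quat_j q = 0")
  case True
  then show ?thesis
    using int_quat_in_hurwitz[of 0 1 0 0]
    by (intro bexI[of _ "Quat 0 1 0 0"]) (auto simp: quat_comp_defs)
next
  case False
  obtain A B C D :: int where "2 * q = Quat (of_int A) (of_int B) (of_int C) (of_int D)"
    using hurwitz_two_times[OF assms] by blast
  then have "2 * quat_i q = of_int B" "2 * quat_j q = of_int C"
    by (auto simp: times_quat_def)
  then have "Quat 0 (- (2 * quat_j q)) (2 * quat_i q) 0 \<in> hurwitz"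
    using int_quat_in_hurwitz[of 0 "-C" B 0] by simp
  then show ?thesis
    using False by (intro bexI[of _ "Quat 0 (- (2 * quat_j q)) (2 * quat_i q) 0"])
      (auto simp: quat_comp_defs)
qed

text \<open>The index of \<open>rspan q\<close> is multiplicative in \<open>q\<close>. By \<open>ex_anticommuting\<close> a quaternion and its
conjugate are conjugate in the multiplicative group, so they have the same index; the product of the
two indices is the index of \<open>rspan (of_int (hnorm q))\<close>, the fourth power of the norm.\<close>

lemma idx_rspan:
  assumes "q \<in> hurwitz" "q \<noteq> 0"
  shows "idx hurwitz (rspan q) = (hnorm q)\<^sup>2"
proof -
  have cnj_ne: "qcnj p \<noteq> 0" if "p \<noteq> 0" for p using that by (metis qcnj_simps(1) qcnj_simps(6))
  have prod: "idx hurwitz (rspan p) * idx hurwitz (rspan (qcnj p)) = hnorm p ^ 4"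
    if "p \<in> hurwitz" "p \<noteq> 0" for p
  proof -
    have "hnorm p > 0" using that hnorm_eq_0_iff by blast
    then show ?thesis
      using idx_rspan_mult[OF that hurwitz_qcnj[OF that(1)]] idx_rspan_of_int[of "int (hnorm p)"]
        hnorm_self(1)[OF that(1)] by simp
  qed
  obtain s where s: "s \<in> hurwitz" "s \<noteq> 0" "s * q = qcnj q * s"
    using ex_anticommuting[OF assms(1)] by blast
  have "idx hurwitz (rspan s) * idx hurwitz (rspan q) = idx hurwitz (rspan (qcnj q)) * idx hurwitz (rspan s)"
    using idx_rspan_mult[OF s(1,2) assms(1)] idx_rspan_mult[OF hurwitz_qcnj[OF assms(1)] cnj_ne[OF assms(2)] s(1)] s(3)
    by metis
  moreover have "idx hurwitz (rspan s) \<noteq> 0"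
    using prod[OF s(1,2)] hnorm_eq_0_iff[OF s(1)] s(2) by (metis mult_0 power_not_zero)
  ultimately have "idx hurwitz (rspan q) = idx hurwitz (rspan (qcnj q))" by simp
  then have "(idx hurwitz (rspan q))\<^sup>2 = ((hnorm q)\<^sup>2)\<^sup>2"
    using prod[OF assms] by (simp add: power2_eq_square power4_eq_xxxx)
  then show ?thesis by (simp only: power2_eq_iff_nonneg[OF le0 le0])
qed

lemma hnorm_eq_if_rspan_eq:
  assumes "p \<in> hurwitz" "p \<noteq> 0" "q \<in> hurwitz" "q \<noteq> 0" "rspan p = rspan q"
  shows "hnorm p = hnorm q"
  using idx_rspan[OF assms(1,2)] idx_rspan[OF assms(3,4)] assms(5) by simp

lemma rspan_eq_iff_hunit:
  assumes "p \<in> hurwitz" "p \<noteq> 0"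
  shows "rspan p = rspan q \<longleftrightarrow> (\<exists>u. hunit u \<and> q = p * u)"
proof
  assume eq: "rspan p = rspan q"
  obtain u where u: "u \<in> hurwitz" "q = p * u" using rspan_self[of q] eq mem_rspan_iff by blast
  obtain v where v: "v \<in> hurwitz" "p = q * v" using rspan_self[of p] eq mem_rspan_iff by blast
  have "p * (u * v) = p * 1" using u(2) v(2) by (metis mult.assoc mult_1_right)
  then have uv: "u * v = 1" using assms(2) by simp
  then have "v * u = 1" by (metis inverse_unique left_inverse mult_zero_left zero_neq_one)
  then show "\<exists>u. hunit u \<and> q = p * u" using u v uv by (auto simp: hunit_def)
next
  assume "\<exists>u. hunit u \<and> q = p * u"
  then obtain u v where u: "u \<in> hurwitz" "v \<in> hurwitz" "u * v = 1" "q = p * u" by (auto simp: hunit_def)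
  then have "p = q * v" by (simp add: mult.assoc)
  then show "rspan p = rspan q"
    using rspan_mult_subset[OF u(1), of p] rspan_mult_subset[OF u(2), of q] u(4) by simp
qed

section \<open>Reduced quaternions\<close>

text \<open>A rational rotation fixes a quaternion only up to a rational factor, and symmetries of the lattices
contribute units and \<open>1 + i\<close>. The reduced quaternions remain when all of these are divided out.\<close>

definition reduced :: "quat \<Rightarrow> bool" where
  "reduced q \<longleftrightarrow> q \<in> hurwitz \<and> odd (hnorm q) \<and>
     (\<forall>c::int. \<forall>x\<in>hurwitz. q = of_int c * x \<longrightarrow> \<bar>c\<bar> = 1)"

lemma reduced_hurwitz: "reduced q \<Longrightarrow> q \<in> hurwitz"
  and reduced_odd: "reduced q \<Longrightarrow> odd (hnorm q)"
  and reduced_primitive: "reduced q \<Longrightarrow> x \<in> hurwitz \<Longrightarrow> q = of_int c * x \<Longrightarrow> \<bar>c\<bar> = 1"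
  by (auto simp: reduced_def)

lemma reduced_nonzero: "reduced q \<Longrightarrow> q \<noteq> 0"
  using reduced_odd[of q] hnorm_eq_0_iff[OF reduced_hurwitz, of q] by auto

text \<open>The trace form \<open>(x, y) \<mapsto> 2 * quat_re (x * y)\<close> is nondegenerate modulo every odd number, so an odd
common divisor of all traces of \<open>q * y\<close> divides \<open>q\<close>. Since \<open>q\<close> is reduced, some combination of
these traces is congruent to \<open>1\<close> modulo the norm.\<close>

lemma reduced_trace_unit:
  assumes "reduced q"
  obtains y k where "y \<in> hurwitz" "2 * quat_re (q * y) = of_int (1 + k * int (hnorm q))"
proof -
  define m where "m = int (hnorm q)"
  obtain A B C D :: int where two: "2 * q = Quat (of_int A) (of_int B) (of_int C) (of_int D)"
    using hurwitz_two_times[OF reduced_hurwitz[OF assms]] by blast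
  then have AB: "2 * quat_re q = of_int A" "2 * quat_i q = of_int B" "2 * quat_j q = of_int C" "2 * quat_k q = of_int D"
    by (auto simp: times_quat_def)
  define d where "d = gcd (gcd (gcd A B) (gcd C D)) m"
  obtain u1 v1 where 1: "u1 * A + v1 * B = gcd A B" using bezout_int by blast
  obtain u2 v2 where 2: "u2 * C + v2 * D = gcd C D" using bezout_int by blast
  obtain u3 v3 where 3: "u3 * gcd A B + v3 * gcd C D = gcd (gcd A B) (gcd C D)" using bezout_int by blast
  obtain u v where 4: "u * gcd (gcd A B) (gcd C D) + v * m = d" unfolding d_def using bezout_int by blast
  have bez: "u * u3 * u1 * A + u * u3 * v1 * B + u * v3 * u2 * C + u * v3 * v2 * D + v * m = d"
  proof -
    have "u * u3 * u1 * A + u * u3 * v1 * B + u * v3 * u2 * C + u * v3 * v2 * D + v * m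
        = u * (u3 * (u1 * A + v1 * B) + v3 * (u2 * C + v2 * D)) + v * m"
      by (simp add: algebra_simps)
    then show ?thesis unfolding 1 2 3 4 .
  qed
  have dvd: "d dvd A" "d dvd B" "d dvd C" "d dvd D" "d dvd m" unfolding d_def
    by (meson dvd_trans gcd_dvd1 gcd_dvd2)+
  then obtain A' B' C' D' where ABD: "A = d * A'" "B = d * B'" "C = d * C'" "D = d * D'"
    by (auto elim!: dvdE)
  have "odd d" using dvd(5) reduced_odd[OF assms] unfolding m_def by (metis dvd_trans even_of_nat)
  then obtain e where e: "d = 2 * e + 1" by (elim oddE)
  define z where "z = Quat (of_int A') (of_int B') (of_int C') (of_int D')"
  have zH: "z \<in> hurwitz" unfolding z_def by (rule int_quat_in_hurwitz)
  have "of_int d * z = 2 * q"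
    unfolding two z_def ABD by (simp add: of_int_quat quat_op_defs)
  then have "of_int d * (of_int (e + 1) * z - q) = of_int (e + 1) * (2 * q) - of_int d * q"
    by (metis mult.assoc of_int_quat_commute right_diff_distrib)
  also have "\<dots> = of_int (2 * (e + 1) - d) * q" by (simp add: algebra_simps)
  also have "\<dots> = q" by (simp add: e)
  finally have "\<bar>d\<bar> = 1"
    using reduced_primitive[OF assms, of "of_int (e + 1) * z - q" d]
      hurwitz_diff[OF hurwitz_mult[OF hurwitz_of_int zH] reduced_hurwitz[OF assms]] by metis
  then have d1: "d = 1" unfolding d_def by simp
  define y where "y = Quat (of_int (u * u3 * u1)) (of_int (-(u * u3 * v1))) (of_int (-(u * v3 * u2))) (of_int (-(u * v3 * v2)))"
  have "2 * quat_re (q * y) = of_int (u * u3 * u1) * (2 * quat_re q) + of_int (u * u3 * v1) * (2 * quat_i q)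
      + of_int (u * v3 * u2) * (2 * quat_j q) + of_int (u * v3 * v2) * (2 * quat_k q)"
    by (simp add: y_def times_quat_def algebra_simps)
  also have "\<dots> = of_int (d - v * m)"
    unfolding AB bez[symmetric] by simp
  finally have "2 * quat_re (q * y) = of_int (1 + (- v) * m)" by (simp add: d1)
  moreover have "y \<in> hurwitz" unfolding y_def by (rule int_quat_in_hurwitz)
  ultimately show thesis using that unfolding m_def by blast
qed

text \<open>In terms of \<open>2 \<times> 2\<close> matrices modulo \<open>m = hnorm q\<close>, an \<open>x\<close> that preserves the image of the rank one
matrix \<open>q\<close> acts as a scalar on the quotient by this image. The scalar is found with traces: for \<open>y\<close> as in
\<open>reduced_trace_unit\<close> and \<open>c = 2 * quat_re (qcnj q * x * qcnj y)\<close>, the identity \<open>qcnj_sandwich\<close> shows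
that \<open>2 * quat_re (q * y) * x - c\<close> lies in \<open>rspan q\<close>, and the first factor is \<open>1\<close> modulo \<open>m\<close>.\<close>

lemma reduced_idealizer:
  assumes q: "reduced q" and x: "x \<in> hurwitz" and z: "z \<in> hurwitz" and "x * q = q * z"
  shows "\<exists>c w. w \<in> hurwitz \<and> x = of_int c + q * w"
proof -
  have qH: "q \<in> hurwitz" using reduced_hurwitz[OF q] .
  obtain y k where y: "y \<in> hurwitz" and t: "2 * quat_re (q * y) = of_int (1 + k * int (hnorm q))"
    using reduced_trace_unit[OF q] by blast
  obtain c where c: "2 * quat_re (qcnj q * (x * qcnj y)) = of_int c"
    using hurwitz_trace x y qH hurwitz_mult hurwitz_qcnj by meson
  define T where "T = q * y + qcnj y * qcnj q"
  have T: "T = of_int (1 + k * int (hnorm q))"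
    unfolding T_def using quat_trace[of "q * y"] t qscal_of_int by (simp only: qcnj_mult)
  have "qcnj q * (x * T) = qcnj q * (x * q) * y + qcnj q * (x * qcnj y) * qcnj q"
    by (simp add: T_def algebra_simps)
  also have "qcnj q * (x * q) * y = qcnj q * (q * (z * y))"
    by (simp add: assms(4) mult.assoc)
  also have "qcnj q * (x * qcnj y) * qcnj q = qcnj q * of_int c - qcnj q * (q * (y * qcnj x))"
  proof -
    have "qscal (qnorm q) * (y * qcnj x) = qcnj q * (q * (y * qcnj x))"
      by (simp only: mult.assoc[symmetric] qcnj_mult_self)
    then show ?thesis
      by (simp only: qcnj_sandwich c qcnj_mult qcnj_simps qscal_of_int of_int_quat_commute)
  qed
  finally have "qcnj q * (x * T) = qcnj q * (of_int c + q * (z * y - y * qcnj x))"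
    by (simp add: algebra_simps)
  moreover have "qcnj q \<noteq> 0" using reduced_nonzero[OF q] by (metis qcnj_simps(1) qcnj_simps(6))
  ultimately have xT: "x * T = of_int c + q * (z * y - y * qcnj x)" by simp
  have "x = x * T - of_int (int (hnorm q)) * (x * of_int k)"
  proof -
    have "x * of_int (1 + k * int (hnorm q)) = x + of_int (int (hnorm q)) * (x * of_int k)"
      by (simp only: of_int_add of_int_mult of_int_1 distrib_left mult_1_right of_int_quat_commute[of "int (hnorm q)"] mult.assoc)
    then show ?thesis unfolding T by simp
  qed
  also have "of_int (int (hnorm q)) * (x * of_int k) = q * (qcnj q * x * of_int k)"
    unfolding hnorm_self(1)[OF qH, symmetric] by (simp add: mult.assoc)
  finally have "x = of_int c + q * (z * y - y * qcnj x - qcnj q * x * of_int k)"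
    unfolding xT by (simp add: algebra_simps)
  moreover have "z * y - y * qcnj x - qcnj q * x * of_int k \<in> hurwitz"
    using qH x y z by (intro hurwitz_diff hurwitz_mult hurwitz_qcnj hurwitz_of_int)
  ultimately show ?thesis by blast
qed

text \<open>The two-sided ideal generated by a reduced quaternion is the whole order. Averaging over the
quaternion group, \<open>w - i w i - j w j - k w k = 4 * quat_re w\<close>; for \<open>w = q * y\<close> as in
\<open>reduced_trace_unit\<close> this number is prime to the norm \<open>q * qcnj q\<close>.\<close>

lemma reduced_generates_one:
  assumes q: "reduced q"
  obtains y a b where "y \<in> hurwitz"
    "1 = of_int a * (q * y - Quat 0 1 0 0 * q * (y * Quat 0 1 0 0) - Quat 0 0 1 0 * q * (y * Quat 0 0 1 0)
        - Quat 0 0 0 1 * q * (y * Quat 0 0 0 1)) + of_int b * (q * qcnj q)"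
proof -
  define m where "m = int (hnorm q)"
  obtain y k where y: "y \<in> hurwitz" and t: "2 * quat_re (q * y) = of_int (1 + k * m)"
    using reduced_trace_unit[OF q] unfolding m_def by blast
  define w where "w = q * y"
  have "coprime (2 * (1 + k * m)) m"
  proof -
    have "coprime 2 m" using reduced_odd[OF q] by (simp add: m_def)
    moreover have "coprime (1 + k * m) m" by (rule coprimeI) (metis dvd_add_left_iff dvd_mult)
    ultimately show ?thesis by (metis coprime_mult_left_iff)
  qed
  then obtain a b where ab: "a * (2 * (1 + k * m)) + b * m = 1"
    using bezout_int[of "2 * (1 + k * m)" m] by (auto simp: coprime_iff_gcd_eq_1)
  have "w - Quat 0 1 0 0 * w * Quat 0 1 0 0 - Quat 0 0 1 0 * w * Quat 0 0 1 0 - Quat 0 0 0 1 * w * Quat 0 0 0 1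
      = qscal (2 * (2 * quat_re w))"
    by (simp add: quat_comp_defs)
  also have "\<dots> = of_int (2 * (1 + k * m))"
    unfolding w_def t qscal_of_int[symmetric] by simp
  finally have "q * y - Quat 0 1 0 0 * q * (y * Quat 0 1 0 0) - Quat 0 0 1 0 * q * (y * Quat 0 0 1 0)
        - Quat 0 0 0 1 * q * (y * Quat 0 0 0 1) = of_int (2 * (1 + k * m))"
    by (simp add: w_def mult.assoc)
  moreover have "q * qcnj q = of_int m" using hnorm_self(1)[OF reduced_hurwitz[OF q]] by (simp add: m_def)
  moreover have "(1 :: quat) = of_int a * of_int (2 * (1 + k * m)) + of_int b * of_int m"
    by (metis ab of_int_1 of_int_add of_int_mult)
  ultimately show thesis using that[OF y, of a b] by simp
qed

lemma quat_units_hurwitz: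
  "Quat 0 1 0 0 \<in> hurwitz" "Quat 0 0 1 0 \<in> hurwitz" "Quat 0 0 0 1 \<in> hurwitz"
  using int_quat_in_hurwitz[of 0 1 0 0] int_quat_in_hurwitz[of 0 0 1 0] int_quat_in_hurwitz[of 0 0 0 1]
  by simp_all

lemma rspan_of_int_mult: "x \<in> rspan q \<Longrightarrow> of_int n * x \<in> rspan q"
  using rspan_mult_right[OF _ hurwitz_of_int, of x q n] by (simp add: of_int_quat_commute)

text \<open>By \<open>reduced_generates_one\<close> the element \<open>p = p * 1\<close> is a combination of elements \<open>p * u * q * v\<close>.\<close>

lemma reduced_absorb:
  assumes q: "reduced q" and p: "p \<in> hurwitz" and absorb: "\<And>y. y \<in> hurwitz \<Longrightarrow> p * y * q \<in> rspan q"
  shows "p \<in> rspan q"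
proof -
  obtain y a b where y: "y \<in> hurwitz"
    and one: "1 = of_int a * (q * y - Quat 0 1 0 0 * q * (y * Quat 0 1 0 0) - Quat 0 0 1 0 * q * (y * Quat 0 0 1 0)
        - Quat 0 0 0 1 * q * (y * Quat 0 0 0 1)) + of_int b * (q * qcnj q)"
    using reduced_generates_one[OF q] by blast
  have mem: "p * u * q * (y * v) \<in> rspan q" if "u \<in> hurwitz" "v \<in> hurwitz" for u v
    using absorb[OF that(1)] rspan_mult_right hurwitz_mult[OF y that(2)] by blast
  have pm: "p * (q * qcnj q) \<in> rspan q"
  proof -
    have "p * (q * qcnj q) = q * (qcnj q * p)"
      using hnorm_self(1)[OF reduced_hurwitz[OF q]] of_int_quat_commute by (metis mult.assoc)
    then show ?thesis
      unfolding mem_rspan_iff using hurwitz_mult[OF hurwitz_qcnj[OF reduced_hurwitz[OF q]] p] by blast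
  qed
  have "p = p * 1" by simp
  also have "\<dots> = of_int a * (p * 1 * q * (y * 1) - p * Quat 0 1 0 0 * q * (y * Quat 0 1 0 0)
      - p * Quat 0 0 1 0 * q * (y * Quat 0 0 1 0) - p * Quat 0 0 0 1 * q * (y * Quat 0 0 0 1))
      + of_int b * (p * (q * qcnj q))"
    by (subst one) (simp only: distrib_left right_diff_distrib of_int_quat_left_commute mult.assoc mult_1_left mult_1_right)
  also have "\<dots> \<in> rspan q"
    by (intro add_subgroup_add[OF add_subgroup_rspan] add_subgroup_diff[OF add_subgroup_rspan]
        rspan_of_int_mult mem pm hurwitz_1 quat_units_hurwitz)
  finally show ?thesis .
qed

text \<open>For reduced \<open>q\<close> these are the elements that preserve the image of \<open>q\<close> modulo \<open>hnorm q\<close>, that is, an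
Eichler order of level \<open>hnorm q\<close>.\<close>

definition eichler :: "quat \<Rightarrow> quat set" where
  "eichler q = {x \<in> hurwitz. \<exists>c::int. x - of_int c \<in> rspan q}"

lemma add_subgroup_eichler: "add_subgroup (eichler q)"
proof (rule add_subgroupI)
  show "0 \<in> eichler q"
    unfolding eichler_def using hurwitz_0 add_subgroup_zero[OF add_subgroup_rspan] by (auto intro!: exI[of _ 0])
  fix x y assume "x \<in> eichler q" "y \<in> eichler q"
  then obtain c d where "x \<in> hurwitz" "y \<in> hurwitz" "x - of_int c \<in> rspan q" "y - of_int d \<in> rspan q"
    by (auto simp: eichler_def)
  moreover have "x - y - of_int (c - d) = (x - of_int c) - (y - of_int d)" by simp
  ultimately show "x - y \<in> eichler q"
    unfolding eichler_def using hurwitz_diff add_subgroup_diff[OF add_subgroup_rspan] by (metis (mono_tags, lifting) mem_Collect_eq)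
qed

lemma rspan_subset_eichler: "q \<in> hurwitz \<Longrightarrow> rspan q \<subseteq> eichler q"
  unfolding eichler_def using rspan_subset_hurwitz by (auto intro!: exI[of _ 0])

text \<open>If \<open>of_int c = q * w\<close>, then \<open>of_int c * qcnj q\<close> is \<open>w\<close> times the norm \<open>m\<close>. After cancelling
\<open>gcd c m\<close>, the number \<open>m div gcd c m\<close> divides \<open>qcnj q\<close>, and so it is a unit.\<close>

lemma of_int_in_rspan_reduced_iff:
  assumes q: "reduced q"
  shows "of_int c \<in> rspan q \<longleftrightarrow> int (hnorm q) dvd c"
proof
  have qH: "q \<in> hurwitz" using reduced_hurwitz[OF q] .
  assume "int (hnorm q) dvd c"
  then obtain d where "c = int (hnorm q) * d" by blast
  then show "of_int c \<in> rspan q"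
    using rspan_of_int_mult[OF hnorm_in_rspan[OF qH], of d] by (metis mult.commute of_int_mult)
next
  have qH: "q \<in> hurwitz" using reduced_hurwitz[OF q] .
  define m where "m = int (hnorm q)"
  have m0: "m \<noteq> 0" using reduced_nonzero[OF q] hnorm_eq_0_iff[OF qH] by (simp add: m_def)
  assume "of_int c \<in> rspan q"
  then obtain w where w: "w \<in> hurwitz" "of_int c = q * w" by (auto simp: mem_rspan_iff)
  define g where "g = gcd c m"
  have g0: "g \<noteq> 0" using m0 by (simp add: g_def)
  obtain c' m' where c': "c = g * c'" "m = g * m'" unfolding g_def by (meson dvdE gcd_dvd1 gcd_dvd2)
  have "of_int g * (of_int m' * w) = qcnj q * (q * w)"
    using hnorm_self(2)[OF qH] c'(2) unfolding m_def by (metis mult.assoc of_int_mult)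
  also have "\<dots> = of_int g * (of_int c' * qcnj q)"
    unfolding w(2)[symmetric] of_int_quat_commute[of c "qcnj q", symmetric] by (simp add: c'(1) mult.assoc)
  finally have eq: "of_int m' * w = of_int c' * qcnj q" using g0 by simp
  obtain a b where "a * c + b * m = g" unfolding g_def using bezout_int by blast
  then have "g * (a * c' + b * m') = g * 1" unfolding c' by (simp add: algebra_simps)
  then have ab: "a * c' + b * m' = 1" using g0 by simp
  have "qcnj q = of_int (a * c' + b * m') * qcnj q" by (simp add: ab)
  also have "\<dots> = of_int a * (of_int c' * qcnj q) + of_int m' * (of_int b * qcnj q)"
    by (simp only: of_int_add of_int_mult distrib_right mult.assoc of_int_quat_left_commute[of _ m'])
  also have "\<dots> = of_int m' * (of_int a * w + of_int b * qcnj q)"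
    unfolding eq[symmetric] by (simp only: distrib_left of_int_quat_left_commute[of _ m'])
  finally have "qcnj (qcnj q) = qcnj (of_int m' * (of_int a * w + of_int b * qcnj q))" by simp
  then have "q = of_int m' * qcnj (of_int a * w + of_int b * qcnj q)"
    by (simp only: qcnj_mult qcnj_simps(1,5) of_int_quat_commute)
  moreover have "qcnj (of_int a * w + of_int b * qcnj q) \<in> hurwitz"
    using w(1) qH by (intro hurwitz_qcnj hurwitz_add hurwitz_mult hurwitz_of_int)
  ultimately have "\<bar>m'\<bar> = 1" using reduced_primitive[OF q] by blast
  then have "m dvd g" using c'(2) by (auto simp: abs_if split: if_splits)
  then show "int (hnorm q) dvd c" using c'(1) unfolding m_def by simp
qed

text \<open>The quotient of the Eichler order by \<open>rspan q\<close> is \<open>\<int>\<close> modulo \<open>hnorm q\<close>, whereas \<open>rspan q\<close> has index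
\<open>(hnorm q)\<^sup>2\<close> in the full order.\<close>

lemma idx_eichler:
  assumes q: "reduced q"
  shows "idx hurwitz (eichler q) = hnorm q"
proof -
  have qH: "q \<in> hurwitz" using reduced_hurwitz[OF q] .
  have m0: "hnorm q \<noteq> 0" using reduced_nonzero[OF q] hnorm_eq_0_iff[OF qH] by simp
  define Z :: "quat set" where "Z = range of_int"
  have Z: "add_subgroup Z"
    unfolding Z_def by (rule add_subgroupI) (auto simp flip: of_int_diff intro: image_eqI[of _ _ 0])
  have Zr: "add_subgroup (Z \<inter> rspan q)"
    using Z add_subgroup_rspan[of q] by (auto simp: add_subgroup_def)
  have "idx (eichler q) (rspan q) = idx Z (Z \<inter> rspan q)"
  proof (rule idx_second_iso[symmetric, OF Z _ add_subgroup_rspan])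
    show "Z \<subseteq> eichler q"
    proof
      fix x assume "x \<in> Z"
      then obtain c where "x = of_int c" by (auto simp: Z_def)
      then show "x \<in> eichler q"
        unfolding eichler_def using hurwitz_of_int add_subgroup_zero[OF add_subgroup_rspan]
        by (auto intro!: exI[of _ c])
    qed
    show "\<exists>s\<in>Z. x - s \<in> rspan q" if "x \<in> eichler q" for x
      using that unfolding Z_def eichler_def by blast
  qed
  also have "\<dots> = card ((\<lambda>x. \<lfloor>quat_re x\<rfloor> mod int (hnorm q)) ` Z)"
  proof (rule idx_eq_card_image[OF Zr])
    fix x y assume "x \<in> Z" "y \<in> Z"
    then obtain c d where "x = of_int c" "y = of_int d" by (auto simp: Z_def)
    then show "(\<lfloor>quat_re x\<rfloor> mod int (hnorm q) = \<lfloor>quat_re y\<rfloor> mod int (hnorm q)) \<longleftrightarrow> x - y \<in> Z \<inter> rspan q"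
      using of_int_in_rspan_reduced_iff[OF q, of "c - d"]
      by (auto simp: mod_eq_dvd_iff Z_def simp flip: of_int_diff)
  qed
  also have "(\<lambda>x. \<lfloor>quat_re x\<rfloor> mod int (hnorm q)) ` Z = {0..<int (hnorm q)}"
  proof
    show "(\<lambda>x. \<lfloor>quat_re x\<rfloor> mod int (hnorm q)) ` Z \<subseteq> {0..<int (hnorm q)}" using m0 by auto
    show "{0..<int (hnorm q)} \<subseteq> (\<lambda>x. \<lfloor>quat_re x\<rfloor> mod int (hnorm q)) ` Z"
    proof
      fix c assume "c \<in> {0..<int (hnorm q)}"
      then have "c = \<lfloor>quat_re (of_int c)\<rfloor> mod int (hnorm q)" by simp
      then show "c \<in> (\<lambda>x. \<lfloor>quat_re x\<rfloor> mod int (hnorm q)) ` Z" unfolding Z_def by blast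
    qed
  qed
  finally have "idx (eichler q) (rspan q) = hnorm q" by simp
  moreover have "idx hurwitz (rspan q) = idx hurwitz (eichler q) * idx (eichler q) (rspan q)"
    by (rule idx_tower[OF add_subgroup_hurwitz add_subgroup_eichler add_subgroup_rspan rspan_subset_eichler[OF qH]])
       (auto simp: eichler_def)
  ultimately show ?thesis
    using idx_rspan[OF qH reduced_nonzero[OF q]] m0 by (simp add: power2_eq_square)
qed

section \<open>Decomposition of right ideals and the two-sided ideals\<close>

definition one_plus_i :: quat where "one_plus_i = Quat 1 1 0 0"

text \<open>The generators of the two-sided ideals. The square of \<open>1 + i\<close> is \<open>2 * i\<close>, twice a unit, and this
is why it occurs at most once.\<close>

definition twist :: "int \<Rightarrow> bool \<Rightarrow> quat" where
  "twist n e = of_int n * (if e then one_plus_i else 1)"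

lemma one_plus_i_hurwitz: "one_plus_i \<in> hurwitz"
  using int_quat_in_hurwitz[of 1 1 0 0] by (simp add: one_plus_i_def)

lemma twist_hurwitz: "twist n e \<in> hurwitz"
  unfolding twist_def by (auto intro: hurwitz_mult hurwitz_of_int one_plus_i_hurwitz hurwitz_1)

lemma one_plus_i_nonzero: "one_plus_i \<noteq> 0" by (simp add: one_plus_i_def zero_quat_def)

lemma twist_nonzero: "n \<noteq> 0 \<Longrightarrow> twist n e \<noteq> 0"
  unfolding twist_def using one_plus_i_nonzero by simp

lemma hnorm_one_plus_i: "hnorm one_plus_i = 2"
  by (simp add: hnorm_def qnorm_def one_plus_i_def)

lemma hnorm_twist: "hnorm (twist n e) = nat (n\<^sup>2) * (if e then 2 else 1)"
proof -
  have "hnorm (1::quat) = 1" by (simp add: hnorm_def)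
  then show ?thesis
    by (auto simp: twist_def hnorm_mult hurwitz_of_int one_plus_i_hurwitz hurwitz_1 hnorm_one_plus_i hnorm_of_int)
qed

text \<open>Conjugation by \<open>1 + i\<close> is a quarter turn about the first axis.\<close>

lemma one_plus_i_normalizes:
  assumes "x \<in> hurwitz"
  shows "\<exists>y\<in>hurwitz. x * one_plus_i = one_plus_i * y" "\<exists>y\<in>hurwitz. one_plus_i * x = y * one_plus_i"
proof -
  obtain A B C D :: int where x: "x = Quat (of_int A / 2) (of_int B / 2) (of_int C / 2) (of_int D / 2)"
    and par: "even (A - D)" "even (B - D)" "even (C - D)"
    using assms unfolding hurwitz_iff_half_ints by blast
  have "Quat (of_int A / 2) (of_int B / 2) (of_int D / 2) (of_int (-C) / 2) \<in> hurwitz"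
    unfolding hurwitz_iff_half_ints using par
    by (intro exI[of _ A] exI[of _ B] exI[of _ D] exI[of _ "-C"]) simp
  moreover have "x * one_plus_i = one_plus_i * Quat (of_int A / 2) (of_int B / 2) (of_int D / 2) (of_int (-C) / 2)"
    by (simp add: x one_plus_i_def quat_comp_defs field_simps)
  ultimately show "\<exists>y\<in>hurwitz. x * one_plus_i = one_plus_i * y" by blast
  have "Quat (of_int A / 2) (of_int B / 2) (of_int (-D) / 2) (of_int C / 2) \<in> hurwitz"
    unfolding hurwitz_iff_half_ints using par
    by (intro exI[of _ A] exI[of _ B] exI[of _ "-D"] exI[of _ C]) simp
  moreover have "one_plus_i * x = Quat (of_int A / 2) (of_int B / 2) (of_int (-D) / 2) (of_int C / 2) * one_plus_i"
    by (simp add: x one_plus_i_def quat_comp_defs field_simps)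
  ultimately show "\<exists>y\<in>hurwitz. one_plus_i * x = y * one_plus_i" by blast
qed

lemma twist_normalizes:
  assumes "x \<in> hurwitz"
  shows "\<exists>y\<in>hurwitz. x * twist n e = twist n e * y" "\<exists>y\<in>hurwitz. twist n e * x = y * twist n e"
proof -
  obtain y y' where y: "y \<in> hurwitz" "x * one_plus_i = one_plus_i * y" and y': "y' \<in> hurwitz" "one_plus_i * x = y' * one_plus_i"
    using one_plus_i_normalizes[OF assms] by blast
  show "\<exists>y\<in>hurwitz. x * twist n e = twist n e * y"
  proof (cases e)
    case True
    then have "x * twist n e = twist n e * y"
      by (simp add: twist_def of_int_quat_left_commute y(2) mult.assoc)
    then show ?thesis using y(1) by blast
  next
    case False
    then have "x * twist n e = twist n e * x" by (simp add: twist_def of_int_quat_commute)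
    then show ?thesis using assms by blast
  qed
  show "\<exists>y\<in>hurwitz. twist n e * x = y * twist n e"
  proof (cases e)
    case True
    then have "twist n e * x = y' * twist n e"
      by (simp add: twist_def of_int_quat_left_commute y'(2) mult.assoc)
    then show ?thesis using y'(1) by blast
  next
    case False
    then have "twist n e * x = x * twist n e" by (simp add: twist_def of_int_quat_commute)
    then show ?thesis using assms by blast
  qed
qed

lemma rspan_mult_twist: "rspan (p * twist n e) = (\<lambda>x. x * twist n e) ` rspan p"
proof
  show "rspan (p * twist n e) \<subseteq> (\<lambda>x. x * twist n e) ` rspan p"
  proof
    fix x assume "x \<in> rspan (p * twist n e)"
    then obtain z where z: "z \<in> hurwitz" "x = p * twist n e * z" by (auto simp: mem_rspan_iff)
    obtain y where y: "y \<in> hurwitz" "twist n e * z = y * twist n e" using twist_normalizes(2)[OF z(1)] by blast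
    have "x = (p * y) * twist n e" using z(2) y(2) by (simp add: mult.assoc)
    moreover have "p * y \<in> rspan p" using y(1) mem_rspan_iff by blast
    ultimately show "x \<in> (\<lambda>x. x * twist n e) ` rspan p" by blast
  qed
  show "(\<lambda>x. x * twist n e) ` rspan p \<subseteq> rspan (p * twist n e)"
  proof
    fix x assume "x \<in> (\<lambda>x. x * twist n e) ` rspan p"
    then obtain z where z: "z \<in> hurwitz" "x = p * z * twist n e" by (auto simp: mem_rspan_iff)
    obtain y where y: "y \<in> hurwitz" "z * twist n e = twist n e * y" using twist_normalizes(1)[OF z(1)] by blast
    have "x = p * twist n e * y" using z(2) y(2) by (simp add: mult.assoc)
    then show "x \<in> rspan (p * twist n e)" using y(1) mem_rspan_iff by blast
  qed
qed

text \<open>The quotient is \<open>x * (1 - i) / 2\<close>, which lies in the order as soon as the coordinates of \<open>x\<close> are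
integers with even sum. If they were halves of odd integers, then the sum of four odd squares would
be \<open>4\<close> modulo \<open>8\<close> and the norm would be odd.\<close>

lemma even_hnorm_imp_one_plus_i_dvd:
  assumes x: "x \<in> hurwitz" and ev: "even (hnorm x)"
  shows "\<exists>y\<in>hurwitz. x = y * one_plus_i"
proof -
  obtain A B C D :: int where xq: "x = Quat (of_int A / 2) (of_int B / 2) (of_int C / 2) (of_int D / 2)"
    and par: "even (A - D)" "even (B - D)" "even (C - D)"
    using x unfolding hurwitz_iff_half_ints by blast
  have "of_int (4 * int (hnorm x)) = (of_int (A\<^sup>2 + B\<^sup>2 + C\<^sup>2 + D\<^sup>2) :: rat)"
    using of_nat_hnorm[OF x] by (simp add: xq qnorm_def power_divide)
  then have N: "4 * int (hnorm x) = A\<^sup>2 + B\<^sup>2 + C\<^sup>2 + D\<^sup>2" by (simp only: of_int_eq_iff)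
  obtain h where h: "hnorm x = 2 * h" using ev by blast
  have "even D"
  proof (rule ccontr)
    assume "odd D"
    then have "odd A" "odd B" "odd C" using par by auto
    then obtain a b c d where abcd: "A = 2*a+1" "B = 2*b+1" "C = 2*c+1" "D = 2*d+1"
      using \<open>odd D\<close> by (meson oddE)
    have "4 * (2 * int h) = 4 * (a*(a+1) + b*(b+1) + c*(c+1) + d*(d+1) + 1)"
      using N unfolding h abcd by (simp add: power2_eq_square algebra_simps)
    then have "2 * int h = a*(a+1) + b*(b+1) + c*(c+1) + d*(d+1) + 1"
      by (metis mult_left_cancel zero_neq_numeral)
    moreover have "even (a*(a+1) + b*(b+1) + c*(c+1) + d*(d+1))" by simp
    ultimately show False by (metis dvd_triv_left even_plus_one_iff)
  qed
  then have "even A" "even B" "even C" using par by auto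
  then obtain a b c d where abcd: "A = 2*a" "B = 2*b" "C = 2*c" "D = 2*d"
    using \<open>even D\<close> by (meson evenE)
  have "2 * int h = a\<^sup>2 + b\<^sup>2 + c\<^sup>2 + d\<^sup>2" using N unfolding h abcd by (simp add: power2_eq_square)
  then have "even (a\<^sup>2 + b\<^sup>2 + c\<^sup>2 + d\<^sup>2)" by (metis dvd_triv_left)
  then have ev4: "even (a + b + c + d)" by simp
  define y where "y = Quat (of_int (a + b) / 2) (of_int (b - a) / 2) (of_int (c - d) / 2) (of_int (c + d) / 2)"
  have "y \<in> hurwitz"
    unfolding y_def hurwitz_iff_half_ints
    by (intro exI[of _ "a+b"] exI[of _ "b-a"] exI[of _ "c-d"] exI[of _ "c+d"]) (use ev4 in auto)
  moreover have "x = y * one_plus_i"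
    by (simp add: xq abcd y_def one_plus_i_def quat_op_defs field_simps)
  ultimately show ?thesis by blast
qed

lemma rspan_mult_hunit:
  assumes "hunit u"
  shows "rspan (q * u) = rspan q"
proof -
  obtain v where u: "u \<in> hurwitz" "v \<in> hurwitz" "u * v = 1" using assms by (auto simp: hunit_def)
  then have "q * u * v = q" by (simp add: mult.assoc)
  then show "rspan (q * u) = rspan q"
    using rspan_mult_subset[OF u(1), of q] rspan_mult_subset[OF u(2), of "q * u"] by simp
qed

lemma rspan_twist_mult_one_plus_i: "\<exists>n' e'. (n > 0 \<longrightarrow> n' > 0) \<and> rspan (p * twist n e * one_plus_i) = rspan (p * twist n' e')"
proof (cases e)
  case False
  then have "p * twist n e * one_plus_i = p * twist n True" by (simp add: twist_def mult.assoc)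
  then show ?thesis by metis
next
  case True
  have "hunit (Quat 0 1 0 0)"
    by (rule hunit_if_hnorm_1) (auto simp: quat_units_hurwitz hnorm_def qnorm_def)
  moreover have "one_plus_i * one_plus_i = 2 * Quat 0 1 0 0" by (simp add: one_plus_i_def times_quat_def)
  then have "of_int n * one_plus_i * one_plus_i = of_int (n * 2) * Quat 0 1 0 0"
    unfolding mult.assoc of_int_mult by simp
  then have "p * twist n e * one_plus_i = (p * twist (2 * n) False) * Quat 0 1 0 0"
    using True by (simp only: twist_def mult.assoc if_True if_False mult_1_right mult.commute[of 2 n])
  ultimately have "rspan (p * twist n e * one_plus_i) = rspan (p * twist (2 * n) False)"
    using rspan_mult_hunit by metis
  then show ?thesis by (metis zero_less_mult_iff zero_less_numeral)
qed

lemma twist_1_True: "twist 1 True = one_plus_i" and twist_False: "twist n False = of_int n"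
  by (simp_all add: twist_def)

text \<open>Descent on the norm: a quaternion that is not reduced has a factor \<open>1 + i\<close> or an integer factor. Such
factors normalize the order and can be collected on the right.\<close>

lemma reduced_decomposition:
  assumes "q \<in> hurwitz" "q \<noteq> 0"
  shows "\<exists>p n e. reduced p \<and> n > 0 \<and> rspan q = rspan (p * twist n e)"
  using assms
proof (induction "hnorm q" arbitrary: q rule: less_induct)
  case less
  have pos: "hnorm q > 0" using less.prems hnorm_eq_0_iff by blast
  consider "reduced q" | "even (hnorm q)" | "odd (hnorm q)" "\<not> reduced q" by blast
  then show ?case
  proof cases
    case 1
    then have "rspan q = rspan (q * twist 1 False)" by (simp add: twist_def)
    then show ?thesis using 1 by (metis zero_less_one)
  next
    case 2
    then obtain y where y: "y \<in> hurwitz" "q = y * one_plus_i" using even_hnorm_imp_one_plus_i_dvd less.prems by blast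
    have "hnorm q = hnorm y * 2" using hnorm_mult[OF y(1) one_plus_i_hurwitz] y(2) hnorm_one_plus_i by simp
    then have "hnorm y < hnorm q" "y \<noteq> 0" using pos y less.prems by auto
    then obtain p n e where p: "reduced p" "n > 0" "rspan y = rspan (p * twist n e)"
      using less.hyps y(1) by blast
    have "rspan q = rspan (p * twist n e * one_plus_i)"
      unfolding y(2) using p(3) rspan_mult_twist[of _ 1 True] by (simp add: twist_1_True)
    then show ?thesis using p(1,2) rspan_twist_mult_one_plus_i by metis
  next
    case 3
    then obtain c x where x: "x \<in> hurwitz" "q = of_int c * x" "\<bar>c\<bar> \<noteq> 1"
      using less.prems by (auto simp: reduced_def)
    then have c0: "c \<noteq> 0" and x0: "x \<noteq> 0" using less.prems by auto
    have "\<bar>c\<bar> \<ge> 2" using c0 x(3) by auto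
    then have "c\<^sup>2 \<ge> 2\<^sup>2" by (metis abs_ge_zero abs_numeral abs_le_square_iff abs_of_nonneg)
    moreover have "hnorm q = nat (c\<^sup>2) * hnorm x"
      using hnorm_mult[OF hurwitz_of_int x(1)] x(2) hnorm_of_int by simp
    moreover have "hnorm x > 0" using x0 x(1) hnorm_eq_0_iff by blast
    ultimately have "hnorm x < hnorm q" by simp
    then obtain p n e where p: "reduced p" "n > 0" "rspan x = rspan (p * twist n e)"
      using less.hyps x(1) x0 by blast
    have "rspan q = rspan (of_int c * (p * twist n e))"
      unfolding x(2) rspan_mult using p(3) by (simp add: rspan_mult)
    also have "of_int c * (p * twist n e) = p * twist \<bar>c\<bar> False * twist n e * of_int (sgn c)"
    proof -
      have "c = \<bar>c\<bar> * sgn c" by (simp add: abs_mult_sgn)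
      then have "of_int c = (of_int (sgn c) :: quat) * of_int \<bar>c\<bar>" by (metis mult.commute of_int_mult)
      then show ?thesis unfolding twist_False by (metis mult.assoc of_int_quat_commute)
    qed
    also have "rspan \<dots> = rspan (p * twist \<bar>c\<bar> False * twist n e)"
    proof (rule rspan_mult_hunit)
      have "(sgn c)\<^sup>2 = 1" using c0 by (simp add: sgn_if)
      then show "hunit (of_int (sgn c))"
        by (intro hunit_if_hnorm_1 hurwitz_of_int) (simp add: hnorm_of_int)
    qed
    also have "p * twist \<bar>c\<bar> False * twist n e = p * twist (\<bar>c\<bar> * n) e"
      by (simp add: twist_def mult.assoc)
    finally show ?thesis using p(1,2) c0 by (metis mult_pos_pos zero_less_abs_iff)
  qed
qed

text \<open>Write \<open>1\<close> as a combination of elements \<open>u * p * v\<close> by \<open>reduced_generates_one\<close>. Then \<open>twist n e\<close> is the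
same combination of elements \<open>u * p * v * twist n e\<close>, and in these \<open>twist n e\<close> can be moved next to \<open>p\<close>.\<close>

lemma reduced_cancel_in_ideal:
  assumes I: "add_subgroup I" "\<And>x z. x \<in> I \<Longrightarrow> z \<in> hurwitz \<Longrightarrow> x * z \<in> I"
      "\<And>x z. x \<in> I \<Longrightarrow> z \<in> hurwitz \<Longrightarrow> z * x \<in> I"
    and p: "reduced p" and mem: "p * twist n e \<in> I"
  shows "twist n e \<in> I"
proof -
  obtain y a b where y: "y \<in> hurwitz"
    and one: "1 = of_int a * (p * y - Quat 0 1 0 0 * p * (y * Quat 0 1 0 0) - Quat 0 0 1 0 * p * (y * Quat 0 0 1 0)
        - Quat 0 0 0 1 * p * (y * Quat 0 0 0 1)) + of_int b * (p * qcnj p)"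
    using reduced_generates_one[OF p] by blast
  have mem': "u * p * v * twist n e \<in> I" if uv: "u \<in> hurwitz" "v \<in> hurwitz" for u v
  proof -
    obtain v' where v': "v' \<in> hurwitz" "v * twist n e = twist n e * v'" using twist_normalizes(1)[OF uv(2)] by blast
    have "u * p * v * twist n e = u * ((p * twist n e) * v')" by (simp add: mult.assoc v'(2))
    then show ?thesis using I(2,3) mem v'(1) uv(1) by metis
  qed
  have pc: "qcnj p \<in> hurwitz" using p reduced_hurwitz hurwitz_qcnj by blast
  have "twist n e = 1 * twist n e" by simp
  also have "\<dots> = of_int a * (1 * p * y * twist n e - Quat 0 1 0 0 * p * (y * Quat 0 1 0 0) * twist n e
      - Quat 0 0 1 0 * p * (y * Quat 0 0 1 0) * twist n e - Quat 0 0 0 1 * p * (y * Quat 0 0 0 1) * twist n e)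
      + of_int b * (1 * p * qcnj p * twist n e)"
    by (subst one) (simp only: distrib_right left_diff_distrib mult.assoc mult_1_left)
  also have "\<dots> \<in> I"
    by (intro add_subgroup_add[OF I(1)] add_subgroup_diff[OF I(1)] I(3) mem' pc y
        hurwitz_1 hurwitz_of_int quat_units_hurwitz hurwitz_mult)
  finally show ?thesis .
qed

lemma rspan_twist_left_closed: "x \<in> rspan (twist n e) \<Longrightarrow> z \<in> hurwitz \<Longrightarrow> z * x \<in> rspan (twist n e)"
  unfolding mem_rspan_iff
  using twist_normalizes(1)[of z n e] hurwitz_mult by (metis mult.assoc)

lemma reduced_decomposition_unique_subset:
  assumes "reduced p" "reduced p'" "rspan (p * twist n e) = rspan (p' * twist n' e')"
  shows "rspan (twist n e) \<subseteq> rspan (twist n' e')"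
proof -
  have "p' * twist n' e' \<in> rspan (twist n' e')"
    using rspan_twist_left_closed[OF rspan_self] assms(2) reduced_hurwitz by blast
  then have "rspan (p' * twist n' e') \<subseteq> rspan (twist n' e')"
    unfolding rspan_def[of "p' * twist n' e'"] using rspan_mult_right by blast
  then have "p * twist n e \<in> rspan (twist n' e')" using assms(3) rspan_self by blast
  then have "twist n e \<in> rspan (twist n' e')"
    using reduced_cancel_in_ideal[OF add_subgroup_rspan _ _ assms(1)] rspan_mult_right rspan_twist_left_closed by blast
  then show ?thesis unfolding rspan_def[of "twist n e"] using rspan_mult_right by blast
qed

lemma square_ne_two_squares:
  assumes "(m :: nat) > 0" shows "m\<^sup>2 \<noteq> 2 * n\<^sup>2"
proof
  assume eq: "m\<^sup>2 = 2 * n\<^sup>2"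
  then have n: "n > 0" using assms by (cases "n = 0") auto
  have "multiplicity 2 (m\<^sup>2) = 2 * multiplicity 2 m"
    using assms by (simp add: prime_elem_multiplicity_power_distrib)
  moreover have "multiplicity 2 (2 * n\<^sup>2) = 1 + 2 * multiplicity 2 n"
    using n by (simp add: prime_elem_multiplicity_mult_distrib prime_elem_multiplicity_power_distrib)
  ultimately have "2 * multiplicity 2 m = 1 + 2 * multiplicity 2 n" using eq by metis
  then show False by presburger
qed

text \<open>The two-sided ideal \<open>rspan (twist n e)\<close> is generated by \<open>p * twist n e\<close>, so it can be read off from the
right ideal. Its norm is \<open>n\<^sup>2\<close> or \<open>2 * n\<^sup>2\<close>, which determines \<open>n\<close> and \<open>e\<close>, and cancelling it on the right
gives the reduced factor.\<close>

lemma reduced_decomposition_unique: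
  assumes "reduced p" "reduced p'" "n > 0" "n' > 0" "rspan (p * twist n e) = rspan (p' * twist n' e')"
  shows "rspan p = rspan p' \<and> n = n' \<and> e = e'"
proof -
  have "rspan (twist n e) = rspan (twist n' e')"
    using reduced_decomposition_unique_subset assms by blast
  then have "hnorm (twist n e) = hnorm (twist n' e')"
    using hnorm_eq_if_rspan_eq twist_hurwitz twist_nonzero assms(3,4) by (metis less_numeral_extra(3))
  then have N: "(nat n)\<^sup>2 * (if e then 2 else 1) = (nat n')\<^sup>2 * (if e' then 2 else 1)"
    using assms(3,4) by (simp only: hnorm_twist nat_power_eq)
  have "e = e'"
  proof (rule ccontr)
    assume "e \<noteq> e'"
    then have "(nat n)\<^sup>2 = 2 * (nat n')\<^sup>2 \<or> (nat n')\<^sup>2 = 2 * (nat n)\<^sup>2" using N by (auto split: if_splits)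
    then show False using square_ne_two_squares assms(3,4) by (meson zero_less_nat_eq)
  qed
  moreover have "n = n'" using N assms(3,4) \<open>e = e'\<close> by (auto split: if_splits)
  moreover have "rspan p = rspan p'"
  proof -
    have "inj (\<lambda>x. x * twist n e)"
      using twist_nonzero[of n e] assms(3) by (auto simp: inj_def)
    moreover have "(\<lambda>x. x * twist n e) ` rspan p = (\<lambda>x. x * twist n e) ` rspan p'"
      using assms(5) \<open>n = n'\<close> \<open>e = e'\<close> by (simp add: rspan_mult_twist)
    ultimately show ?thesis by (simp add: inj_image_eq_iff)
  qed
  ultimately show ?thesis by blast
qed

definition reduced_ideals :: "quat set set" where
  "reduced_ideals = rspan ` {q. reduced q}"

lemma bij_betw_right_ideals:
  "bij_betw (\<lambda>(P, n, e). (\<lambda>x. x * twist n e) ` P) (reduced_ideals \<times> {0<..} \<times> UNIV) nonzero_right_ideals"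
  (is "bij_betw ?f ?A _")
  unfolding bij_betw_def
proof
  have f: "?f (rspan p, n, e) = rspan (p * twist n e)" for p n e by (simp add: rspan_mult_twist)
  show "inj_on ?f ?A"
  proof (rule inj_onI)
    fix t t' assume "t \<in> ?A" "t' \<in> ?A" and eq: "?f t = ?f t'"
    then obtain p n e p' n' e' where t: "t = (rspan p, n, e)" "t' = (rspan p', n', e')" "reduced p" "reduced p'" "n > 0" "n' > 0"
      by (auto simp: reduced_ideals_def)
    have "rspan (p * twist n e) = rspan (p' * twist n' e')"
      using eq unfolding t(1,2) f .
    then show "t = t'" using reduced_decomposition_unique[OF t(3-6)] t(1,2) by blast
  qed
  show "?f ` ?A = nonzero_right_ideals"
  proof
    show "?f ` ?A \<subseteq> nonzero_right_ideals"
    proof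
      fix I assume "I \<in> ?f ` ?A"
      then obtain p n e where p: "reduced p" "n > 0" "I = rspan (p * twist n e)"
        by (auto simp: reduced_ideals_def rspan_mult_twist)
      then have "p * twist n e \<in> hurwitz" "p * twist n e \<noteq> 0"
        using hurwitz_mult[OF reduced_hurwitz twist_hurwitz] reduced_nonzero twist_nonzero by auto
      then show "I \<in> nonzero_right_ideals" using p(3) nonzero_right_ideals_eq by blast
    qed
    show "nonzero_right_ideals \<subseteq> ?f ` ?A"
    proof
      fix I assume "I \<in> nonzero_right_ideals"
      then obtain q where "q \<in> hurwitz" "q \<noteq> 0" "I = rspan q"
        unfolding nonzero_right_ideals_eq by blast
      then obtain p n e where p: "reduced p" "n > 0" "I = rspan (p * twist n e)"
        using reduced_decomposition by metis
      then show "I \<in> ?f ` ?A"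
        by (intro image_eqI[of _ _ "(rspan p, n, e)"]) (auto simp: reduced_ideals_def rspan_mult_twist)
    qed
  qed
qed

lemma ideal_hurwitz_iff:
  "ideal I hurwitz_ring \<longleftrightarrow> right_ideal I hurwitz_ring \<and> (\<forall>x\<in>I. \<forall>z\<in>hurwitz. z * x \<in> I)"
proof
  assume "ideal I hurwitz_ring"
  then show "right_ideal I hurwitz_ring \<and> (\<forall>x\<in>I. \<forall>z\<in>hurwitz. z * x \<in> I)"
    using ideal.axioms(1)[of I hurwitz_ring] ideal.I_l_closed[of I hurwitz_ring] ideal.I_r_closed[of I hurwitz_ring]
    by (simp add: right_ideal_def hurwitz_ring_def)
next
  assume "right_ideal I hurwitz_ring \<and> (\<forall>x\<in>I. \<forall>z\<in>hurwitz. z * x \<in> I)"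
  then show "ideal I hurwitz_ring"
    by (intro ideal.intro ring_hurwitz ideal_axioms.intro) (simp_all add: right_ideal_def hurwitz_ring_def)
qed

lemma nonzero_ideals_eq: "nonzero_ideals = (\<lambda>(n, e). rspan (twist n e)) ` ({0<..} \<times> UNIV)"
proof
  show "(\<lambda>(n, e). rspan (twist n e)) ` ({0<..} \<times> UNIV) \<subseteq> nonzero_ideals"
  proof clarsimp
    fix n e assume "(0::int) < n"
    then have "rspan (twist n e) \<noteq> {0}" using rspan_self twist_nonzero by (metis less_numeral_extra(3) singletonD)
    then show "rspan (twist n e) \<in> nonzero_ideals"
      by (simp add: nonzero_ideals_def ideal_hurwitz_iff right_ideal_rspan twist_hurwitz rspan_twist_left_closed)
  qed
  show "nonzero_ideals \<subseteq> (\<lambda>(n, e). rspan (twist n e)) ` ({0<..} \<times> UNIV)"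
  proof
    fix I assume "I \<in> nonzero_ideals"
    then have I: "right_ideal I hurwitz_ring" "I \<noteq> {0}" "\<And>x z. x \<in> I \<Longrightarrow> z \<in> hurwitz \<Longrightarrow> z * x \<in> I"
      by (auto simp: nonzero_ideals_def ideal_hurwitz_iff)
    then obtain q where "q \<in> hurwitz" "q \<noteq> 0" "I = rspan q"
      using right_ideal_principal[OF I(1,2)] by metis
    then obtain p n e where p: "reduced p" "n > 0" "I = rspan (p * twist n e)"
      using reduced_decomposition by metis
    have "twist n e \<in> I"
      using reduced_cancel_in_ideal[of I p n e] I(1,3) p(1,3) rspan_self
      unfolding right_ideal_hurwitz_iff by blast
    then have "rspan (twist n e) \<subseteq> I"
      using I(1) unfolding rspan_def right_ideal_hurwitz_iff by blast
    moreover have "I \<subseteq> rspan (twist n e)"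
    proof -
      have "p * twist n e \<in> rspan (twist n e)"
        using rspan_twist_left_closed[OF rspan_self] p(1) reduced_hurwitz by blast
      then show ?thesis unfolding p(3) rspan_def[of "p * twist n e"] using rspan_mult_right by blast
    qed
    ultimately show "I \<in> (\<lambda>(n, e). rspan (twist n e)) ` ({0<..} \<times> UNIV)"
      using p(2) by (auto intro!: image_eqI[of _ _ "(n, e)"])
  qed
qed

lemma bij_betw_ideals:
  "bij_betw (\<lambda>(n, e). rspan (twist n e)) ({0<..} \<times> UNIV) nonzero_ideals"
  unfolding bij_betw_def
proof
  have one: "reduced 1"
  proof -
    have "\<bar>c\<bar> = 1" if "x \<in> hurwitz" "1 = of_int c * x" for c x
    proof -
      have "1 = nat (c\<^sup>2) * hnorm x"
        using hnorm_mult[OF hurwitz_of_int[of c] that(1)] that(2)[symmetric] by (simp add: hnorm_of_int) (simp add: hnorm_def)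
      then have "nat (c\<^sup>2) = 1" by (metis nat_1_eq_mult_iff)
      then have "c\<^sup>2 = 1" by linarith
      then show ?thesis by (auto simp: power2_eq_1_iff)
    qed
    then show ?thesis by (simp add: reduced_def hurwitz_1) (simp add: hnorm_def)
  qed
  show "inj_on (\<lambda>(n, e). rspan (twist n e)) ({0<..} \<times> UNIV)"
    using reduced_decomposition_unique[OF one one] by (auto simp: inj_on_def)
  show "(\<lambda>(n, e). rspan (twist n e)) ` ({0<..} \<times> UNIV) = nonzero_ideals"
    by (rule nonzero_ideals_eq[symmetric])
qed

text \<open>The index of a right ideal is a perfect square, and the Dirichlet series below run over its root, the
norm of a generator.\<close>

definition ideal_norm :: "quat set \<Rightarrow> nat" where
  "ideal_norm I = (THE n. n\<^sup>2 = ideal_index I)"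

lemma ideal_norm_rspan: "q \<in> hurwitz \<Longrightarrow> q \<noteq> 0 \<Longrightarrow> ideal_norm (rspan q) = hnorm q"
  unfolding ideal_norm_def by (rule the_equality) (simp_all add: ideal_index_eq_idx idx_rspan)

lemma ideal_index_eq_norm_square:
  assumes "I \<in> nonzero_right_ideals"
  shows "ideal_index I = (ideal_norm I)\<^sup>2"
proof -
  obtain q where "q \<in> hurwitz" "q \<noteq> 0" "I = rspan q"
    using assms unfolding nonzero_right_ideals_eq by blast
  then show ?thesis by (simp add: ideal_index_eq_idx ideal_norm_rspan idx_rspan)
qed

section \<open>Coincidence site lattices of pure quaternions\<close>

text \<open>The properties that the three lattices share: they consist of pure quaternions, \<open>x \<mapsto> qcnj q * x * q\<close>
preserves them for every Hurwitz quaternion \<open>q\<close>, and conjugation by \<open>1 + i\<close> is a symmetry.\<close>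

definition cubic :: "quat set \<Rightarrow> bool" where
  "cubic G \<longleftrightarrow> add_subgroup G \<and> (\<forall>x\<in>G. quat_re x = 0) \<and>
     (\<forall>x\<in>G. \<forall>q\<in>hurwitz. qcnj q * x * q \<in> G) \<and> (*) one_plus_i ` G = (\<lambda>y. y * one_plus_i) ` G"

lemma cubicD:
  assumes "cubic G"
  shows "add_subgroup G" "x \<in> G \<Longrightarrow> quat_re x = 0"
    "x \<in> G \<Longrightarrow> q \<in> hurwitz \<Longrightarrow> qcnj q * x * q \<in> G"
    "(*) one_plus_i ` G = (\<lambda>y. y * one_plus_i) ` G"
  using assms by (auto simp: cubic_def)

text \<open>The intersection of \<open>G\<close> with \<open>q * G * inverse q\<close>, written without denominators.\<close>

definition qcsl :: "quat set \<Rightarrow> quat \<Rightarrow> quat set" where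
  "qcsl G q = {x \<in> G. \<exists>y\<in>G. x * q = q * y}"

lemma add_subgroup_qcsl:
  assumes "add_subgroup G" shows "add_subgroup (qcsl G q)"
proof (rule add_subgroupI)
  show "0 \<in> qcsl G q" using add_subgroup_zero[OF assms] by (auto simp: qcsl_def intro!: bexI[of _ 0])
next
  fix x y assume "x \<in> qcsl G q" "y \<in> qcsl G q"
  then obtain x' y' where "x \<in> G" "y \<in> G" "x' \<in> G" "y' \<in> G" "x * q = q * x'" "y * q = q * y'"
    by (auto simp: qcsl_def)
  then show "x - y \<in> qcsl G q"
    unfolding qcsl_def using add_subgroup_diff[OF assms]
    by (auto intro!: bexI[of _ "x' - y'"] simp: left_diff_distrib right_diff_distrib)
qed

lemma add_subgroup_mult_nat: "add_subgroup G \<Longrightarrow> x \<in> G \<Longrightarrow> of_nat n * x \<in> G" for x :: quat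
  by (induction n) (auto simp: add_subgroup_zero distrib_right intro: add_subgroup_add)

lemma add_subgroup_mult_int: "add_subgroup G \<Longrightarrow> x \<in> G \<Longrightarrow> of_int n * x \<in> G" for x :: quat
  using add_subgroup_mult_nat[of G x "nat n"] add_subgroup_uminus[OF _ add_subgroup_mult_nat[of G x "nat (- n)"]]
  by (cases "n \<ge> 0") auto

text \<open>Lattices with \<open>2 G \<subseteq> G' \<subseteq> G\<close> have corresponding coincidence site lattices: if \<open>x * q = q * y\<close>, then
\<open>hnorm q\<close> times \<open>y\<close> is \<open>qcnj q * x * q\<close>, which lies in the lattice of \<open>x\<close>. Since \<open>hnorm q\<close> is odd,
it is enough to know that \<open>2 * y\<close> lies in that lattice too.\<close>

context
  fixes G G' :: "quat set" and q :: quat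
  assumes G: "cubic G" and G': "cubic G'" and sub: "G' \<subseteq> G" and two: "\<And>x. x \<in> G \<Longrightarrow> of_int 2 * x \<in> G'"
    and q: "q \<in> hurwitz" and odd: "odd (hnorm q)"
begin

private lemma half: obtains l where "int (hnorm q) = 2 * l + 1"
  using odd by (metis even_of_nat oddE)

private lemma q0: "q \<noteq> 0"
  using odd hnorm_eq_0_iff[OF q] by auto

lemma qcsl_sublattice: "qcsl G' q = G' \<inter> qcsl G q"
proof -
  have "y \<in> G'" if "x \<in> G'" "y \<in> G" "x * q = q * y" for x y
  proof -
    obtain l where l: "int (hnorm q) = 2 * l + 1" by (rule half)
    have "of_int (int (hnorm q)) * y = qcnj q * x * q"
      using hnorm_self(2)[OF q] that(3) by (metis mult.assoc)
    then have "qcnj q * x * q = y + of_int l * (of_int 2 * y)"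
      unfolding l by (simp add: algebra_simps mult_2)
    then have "y = qcnj q * x * q - of_int l * (of_int 2 * y)" by simp
    then show ?thesis
      using cubicD(3)[OF G' that(1) q] add_subgroup_mult_int[OF cubicD(1)[OF G'] two[OF that(2)]]
        add_subgroup_diff[OF cubicD(1)[OF G']] by metis
  qed
  then show ?thesis using sub by (auto simp: qcsl_def)
qed

lemma qcsl_superlattice: "qcsl G q = {x \<in> G. of_int 2 * x \<in> qcsl G' q}"
proof
  show "qcsl G q \<subseteq> {x \<in> G. of_int 2 * x \<in> qcsl G' q}"
  proof
    fix x assume "x \<in> qcsl G q"
    then obtain y where y: "x \<in> G" "y \<in> G" "x * q = q * y" by (auto simp: qcsl_def)
    have "of_int 2 * x * q = q * (of_int 2 * y)"
      by (simp only: mult.assoc y(3) of_int_quat_left_commute)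
    then show "x \<in> {x \<in> G. of_int 2 * x \<in> qcsl G' q}"
      using y two unfolding qcsl_def by blast
  qed
  show "{x \<in> G. of_int 2 * x \<in> qcsl G' q} \<subseteq> qcsl G q"
  proof clarify
    fix x assume x: "x \<in> G" and "of_int 2 * x \<in> qcsl G' q"
    then obtain y' where y': "y' \<in> G'" "of_int 2 * x * q = q * y'" by (auto simp: qcsl_def)
    define y where "y = inverse q * x * q"
    have xy: "x * q = q * y" using q0 by (simp add: y_def mult.assoc[symmetric])
    have "q * (of_int 2 * y) = q * y'"
      using y'(2) by (simp only: mult.assoc xy of_int_quat_left_commute)
    then have y2: "of_int 2 * y = y'" using q0 by simp
    obtain l where l: "int (hnorm q) = 2 * l + 1" by (rule half)
    have "of_int (int (hnorm q)) * y = qcnj q * x * q"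
      using hnorm_self(2)[OF q] xy by (metis mult.assoc)
    then have "qcnj q * x * q = y + of_int l * (of_int 2 * y)"
      unfolding l by (simp add: algebra_simps mult_2)
    then have "y = qcnj q * x * q - of_int l * y'" unfolding y2 by simp
    moreover have "of_int l * y' \<in> G" using add_subgroup_mult_int[OF cubicD(1)[OF G]] y'(1) sub by blast
    ultimately have "y \<in> G"
      using cubicD(3)[OF G x q] add_subgroup_diff[OF cubicD(1)[OF G]] by metis
    then show "x \<in> qcsl G q" using x xy by (auto simp: qcsl_def)
  qed
qed

text \<open>Each \<open>x\<close> in \<open>G\<close> is congruent to \<open>(hnorm q + 1) * x\<close> modulo \<open>qcsl G q\<close>, and this multiple lies in
\<open>G'\<close> because \<open>hnorm q + 1\<close> is even.\<close>

lemma idx_qcsl_sublattice: "idx G' (qcsl G' q) = idx G (qcsl G q)"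
  unfolding qcsl_sublattice
proof (rule idx_second_iso[OF cubicD(1)[OF G'] sub add_subgroup_qcsl[OF cubicD(1)[OF G]]])
  fix x assume x: "x \<in> G"
  obtain l where l: "int (hnorm q) = 2 * l + 1" by (rule half)
  have "of_int (int (hnorm q)) * x * q = q * (qcnj q * x * q)"
    by (simp only: hnorm_self(1)[OF q, symmetric] mult.assoc)
  then have mx: "of_int (int (hnorm q)) * x \<in> qcsl G q"
    using cubicD(3)[OF G x q] add_subgroup_mult_int[OF cubicD(1)[OF G] x] unfolding qcsl_def by blast
  have "x - of_int (l + 1) * (of_int 2 * x) = - (of_int (int (hnorm q)) * x)"
    unfolding l by (simp add: algebra_simps mult_2)
  then have "x - of_int (l + 1) * (of_int 2 * x) \<in> qcsl G q"
    using add_subgroup_uminus[OF add_subgroup_qcsl[OF cubicD(1)[OF G]] mx] by simp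
  moreover have "of_int (l + 1) * (of_int 2 * x) \<in> G'"
    by (rule add_subgroup_mult_int[OF cubicD(1)[OF G'] two[OF x]])
  ultimately show "\<exists>s\<in>G'. x - s \<in> qcsl G q" by blast
qed

end

definition pure_p :: "quat set" where "pure_p = {x \<in> hurwitz. quat_re x = 0}"
text \<open>The imaginary parts of the Hurwitz quaternions.\<close>

definition pure_bcc :: "quat set" where "pure_bcc = {x. quat_re x = 0 \<and> (\<exists>r. qscal r + x \<in> hurwitz)}"
definition pure_fcc :: "quat set" where
  "pure_fcc = {Quat 0 (of_int l) (of_int m) (of_int n) | l m n. even (l + m + n)}"

lemma pure_p_eq: "pure_p = {Quat 0 (of_int l) (of_int m) (of_int n) | l m n. True}"
proof
  show "pure_p \<subseteq> {Quat 0 (of_int l) (of_int m) (of_int n) | l m n. True}"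
  proof
    fix x assume "x \<in> pure_p"
    then obtain A B C D :: int where x: "x = Quat (of_int A / 2) (of_int B / 2) (of_int C / 2) (of_int D / 2)"
      "even (A - D)" "even (B - D)" "even (C - D)" "A = 0"
      unfolding pure_p_def hurwitz_iff_half_ints by auto
    then have "even D" "even B" "even C" by auto
    then obtain b c d where "B = 2 * b" "C = 2 * c" "D = 2 * d" by (meson evenE)
    then show "x \<in> {Quat 0 (of_int l) (of_int m) (of_int n) | l m n. True}"
      using x by (auto intro!: exI[of _ b] exI[of _ c] exI[of _ d])
  qed
  show "{Quat 0 (of_int l) (of_int m) (of_int n) | l m n. True} \<subseteq> pure_p"
    using int_quat_in_hurwitz[of 0] by (auto simp: pure_p_def)
qed

lemma pure_bcc_eq:
  "pure_bcc = pure_p \<union> (+) (Quat 0 (1/2) (1/2) (1/2)) ` pure_p"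
proof
  show "pure_bcc \<subseteq> pure_p \<union> (+) (Quat 0 (1/2) (1/2) (1/2)) ` pure_p"
  proof
    fix x assume "x \<in> pure_bcc"
    then obtain r where "qscal r + x \<in> hurwitz" and re: "quat_re x = 0" by (auto simp: pure_bcc_def)
    then obtain A B C D :: int where x: "qscal r + x = Quat (of_int A / 2) (of_int B / 2) (of_int C / 2) (of_int D / 2)"
      and par: "even (A - D)" "even (B - D)" "even (C - D)"
      unfolding hurwitz_iff_half_ints by blast
    have "quat_i (qscal r + x) = of_int B / 2" "quat_j (qscal r + x) = of_int C / 2" "quat_k (qscal r + x) = of_int D / 2"
      unfolding x by simp_all
    then have xq: "x = Quat 0 (of_int B / 2) (of_int C / 2) (of_int D / 2)"
      using re by (intro quat.expand) simp
    show "x \<in> pure_p \<union> (+) (Quat 0 (1/2) (1/2) (1/2)) ` pure_p"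
    proof (cases "even D")
      case True
      then have "even B" "even C" using par by auto
      then obtain b c d where "B = 2 * b" "C = 2 * c" "D = 2 * d" using True by (meson evenE)
      then have "x = Quat 0 (of_int b) (of_int c) (of_int d)" using xq by simp
      then show ?thesis unfolding pure_p_eq by blast
    next
      case False
      then have "odd B" "odd C" using par by auto
      then obtain b c d where "B = 2 * b + 1" "C = 2 * c + 1" "D = 2 * d + 1" using False by (meson oddE)
      then have "x = Quat 0 (1/2) (1/2) (1/2) + Quat 0 (of_int b) (of_int c) (of_int d)"
        using xq by (simp add: plus_quat_def field_simps)
      then show ?thesis unfolding pure_p_eq by blast
    qed
  qed
  show "pure_p \<union> (+) (Quat 0 (1/2) (1/2) (1/2)) ` pure_p \<subseteq> pure_bcc"
  proof
    fix x assume "x \<in> pure_p \<union> (+) (Quat 0 (1/2) (1/2) (1/2)) ` pure_p"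
    then consider "x \<in> pure_p" | y where "y \<in> pure_p" "x = Quat 0 (1/2) (1/2) (1/2) + y" by blast
    then show "x \<in> pure_bcc"
    proof cases
      case 1
      then have "qscal 0 + x \<in> hurwitz" by (simp add: qscal_simps pure_p_def)
      then show ?thesis using 1 by (auto simp: pure_bcc_def pure_p_def)
    next
      case 2
      have "Quat (1/2) (1/2) (1/2) (1/2) \<in> hurwitz"
        unfolding hurwitz_iff_half_ints by (intro exI[of _ 1]) simp
      then have "Quat (1/2) (1/2) (1/2) (1/2) + y \<in> hurwitz"
        using 2 hurwitz_add by (simp add: pure_p_def)
      moreover have "qscal (1/2) + x = Quat (1/2) (1/2) (1/2) (1/2) + y"
        using 2 by (simp add: qscal_def plus_quat_def)
      ultimately have "qscal (1/2) + x \<in> hurwitz" by metis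
      then show ?thesis using 2 by (auto simp: pure_bcc_def pure_p_def)
    qed
  qed
qed

text \<open>A sum of integers has the same parity as the sum of their squares.\<close>

lemma pure_fcc_iff: "x \<in> pure_fcc \<longleftrightarrow> x \<in> pure_p \<and> even (hnorm x)"
proof -
  have "even (hnorm (Quat 0 (of_int l) (of_int m) (of_int n))) \<longleftrightarrow> even (l + m + n)" for l m n
  proof -
    have "qnorm (Quat 0 (of_int l) (of_int m) (of_int n)) = of_int (l\<^sup>2 + m\<^sup>2 + n\<^sup>2)"
      by (simp add: qnorm_def)
    then have "hnorm (Quat 0 (of_int l) (of_int m) (of_int n)) = nat (l\<^sup>2 + m\<^sup>2 + n\<^sup>2)"
      by (simp only: hnorm_def floor_of_int)
    then show ?thesis by (simp add: even_nat_iff)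
  qed
  then show ?thesis unfolding pure_fcc_def pure_p_eq by auto
qed

lemma quat_re_sandwich: "quat_re (qcnj q * x * q) = qnorm q * quat_re x"
  by (simp add: quat_comp_defs algebra_simps power2_eq_square)

lemma one_plus_i_conj_pure:
  "one_plus_i * Quat 0 a b c = Quat 0 a (- c) b * one_plus_i" "Quat 0 a b c * one_plus_i = one_plus_i * Quat 0 a c (- b)"
  by (simp_all add: one_plus_i_def quat_comp_defs)

lemma one_plus_i_normalizes_pureI:
  assumes "\<And>a b c. Quat 0 a b c \<in> G \<Longrightarrow> Quat 0 a (- c) b \<in> G"
    and "\<And>a b c. Quat 0 a b c \<in> G \<Longrightarrow> Quat 0 a c (- b) \<in> G"
    and re: "\<And>x. x \<in> G \<Longrightarrow> quat_re x = 0"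
  shows "(*) one_plus_i ` G = (\<lambda>y. y * one_plus_i) ` G"
proof
  have form: "\<exists>a b c. x = Quat 0 a b c" if "x \<in> G" for x
    using re[OF that] by (metis quat.collapse)
  show "(*) one_plus_i ` G \<subseteq> (\<lambda>y. y * one_plus_i) ` G"
  proof clarify
    fix x assume "x \<in> G"
    then obtain a b c where "x = Quat 0 a b c" using form by blast
    then show "one_plus_i * x \<in> (\<lambda>y. y * one_plus_i) ` G" using assms(1) \<open>x \<in> G\<close> one_plus_i_conj_pure(1) by auto
  qed
  show "(\<lambda>y. y * one_plus_i) ` G \<subseteq> (*) one_plus_i ` G"
  proof clarify
    fix x assume "x \<in> G"
    then obtain a b c where "x = Quat 0 a b c" using form by blast
    then show "x * one_plus_i \<in> (*) one_plus_i ` G" using assms(2) \<open>x \<in> G\<close> one_plus_i_conj_pure(2) by auto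
  qed
qed

lemma pure_p_sign_permute:
  "Quat 0 a b c \<in> pure_p \<Longrightarrow> Quat 0 a (- c) b \<in> pure_p \<and> Quat 0 a c (- b) \<in> pure_p"
  unfolding pure_p_eq by (auto simp flip: of_int_minus)

lemma cubic_pure_p: "cubic pure_p"
  unfolding cubic_def
proof (intro conjI ballI)
  show "add_subgroup pure_p"
    by (rule add_subgroupI) (auto simp: pure_p_def hurwitz_0 hurwitz_diff)
  show "qcnj q * x * q \<in> pure_p" if "x \<in> pure_p" "q \<in> hurwitz" for x q
    using that by (auto simp: pure_p_def quat_re_sandwich intro!: hurwitz_mult hurwitz_qcnj)
  show "(*) one_plus_i ` pure_p = (\<lambda>y. y * one_plus_i) ` pure_p"
    by (rule one_plus_i_normalizes_pureI) (use pure_p_sign_permute in \<open>auto simp: pure_p_def\<close>)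
qed (auto simp: pure_p_def)

lemma cubic_pure_bcc: "cubic pure_bcc"
  unfolding cubic_def
proof (intro conjI ballI)
  show "add_subgroup pure_bcc"
  proof (rule add_subgroupI)
    show "0 \<in> pure_bcc" by (auto simp: pure_bcc_def qscal_simps hurwitz_0 intro!: exI[of _ 0])
    fix x y assume "x \<in> pure_bcc" "y \<in> pure_bcc"
    then obtain r s where "qscal r + x \<in> hurwitz" "qscal s + y \<in> hurwitz" "quat_re x = 0" "quat_re y = 0"
      by (auto simp: pure_bcc_def)
    moreover have "qscal (r - s) + (x - y) = (qscal r + x) - (qscal s + y)" by (simp flip: qscal_simps(5))
    ultimately have "qscal (r - s) + (x - y) \<in> hurwitz" using hurwitz_diff by metis
    then show "x - y \<in> pure_bcc" using \<open>quat_re x = 0\<close> \<open>quat_re y = 0\<close> by (auto simp: pure_bcc_def)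
  qed
  show "qcnj q * x * q \<in> pure_bcc" if "x \<in> pure_bcc" "q \<in> hurwitz" for x q
  proof -
    obtain r where r: "qscal r + x \<in> hurwitz" "quat_re x = 0" using \<open>x \<in> pure_bcc\<close> by (auto simp: pure_bcc_def)
    have "qcnj q * (qscal r * q) = qscal (r * qnorm q)"
      by (simp only: qscal_left_commute qcnj_mult_self qscal_simps(1))
    then have "qcnj q * (qscal r + x) * q = qscal (r * qnorm q) + qcnj q * x * q"
      by (simp add: distrib_left distrib_right mult.assoc)
    then have "qscal (r * qnorm q) + qcnj q * x * q \<in> hurwitz"
      using r(1) that(2) hurwitz_mult hurwitz_qcnj by metis
    then show ?thesis using r(2) by (auto simp: pure_bcc_def quat_re_sandwich)
  qed
  show "(*) one_plus_i ` pure_bcc = (\<lambda>y. y * one_plus_i) ` pure_bcc"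
  proof (rule one_plus_i_normalizes_pureI)
    fix a b c assume "Quat 0 a b c \<in> pure_bcc"
    then consider "Quat 0 a b c \<in> pure_p" | y where "y \<in> pure_p" "Quat 0 a b c = Quat 0 (1/2) (1/2) (1/2) + y"
      unfolding pure_bcc_eq by blast
    then have "Quat 0 a (- c) b \<in> pure_bcc \<and> Quat 0 a c (- b) \<in> pure_bcc"
    proof cases
      case 1 then show ?thesis using pure_p_sign_permute unfolding pure_bcc_eq by blast
    next
      case 2
      then obtain l m n where "Quat 0 a b c = Quat 0 (1/2) (1/2) (1/2) + Quat 0 (of_int l) (of_int m) (of_int n)"
        unfolding pure_p_eq by blast
      then have "Quat 0 a (- c) b = Quat 0 (1/2) (1/2) (1/2) + Quat 0 (of_int l) (of_int (- n - 1)) (of_int m)"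
        "Quat 0 a c (- b) = Quat 0 (1/2) (1/2) (1/2) + Quat 0 (of_int l) (of_int n) (of_int (- m - 1))"
        by (auto simp: plus_quat_def)
      then show ?thesis unfolding pure_bcc_eq pure_p_eq by blast
    qed
    then show "Quat 0 a (- c) b \<in> pure_bcc" "Quat 0 a c (- b) \<in> pure_bcc" by auto
  qed (auto simp: pure_bcc_def)
qed (auto simp: pure_bcc_def)

lemma cubic_pure_fcc: "cubic pure_fcc"
  unfolding cubic_def
proof (intro conjI ballI)
  show "add_subgroup pure_fcc"
  proof (rule add_subgroupI)
    show "0 \<in> pure_fcc" by (auto simp: pure_fcc_def zero_quat_def intro!: exI[of _ 0])
    fix x y assume "x \<in> pure_fcc" "y \<in> pure_fcc"
    then obtain l m n l' m' n' :: int where "x = Quat 0 (of_int l) (of_int m) (of_int n)"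
        "y = Quat 0 (of_int l') (of_int m') (of_int n')" and ev: "even (l + m + n)" "even (l' + m' + n')"
      unfolding pure_fcc_def by blast
    then have "x - y = Quat 0 (of_int (l - l')) (of_int (m - m')) (of_int (n - n'))"
      by (simp add: minus_quat_def)
    moreover have "even ((l - l') + (m - m') + (n - n'))" using ev by auto
    ultimately show "x - y \<in> pure_fcc" unfolding pure_fcc_def by blast
  qed
  show "quat_re x = 0" if "x \<in> pure_fcc" for x using that by (auto simp: pure_fcc_def)
  show "qcnj q * x * q \<in> pure_fcc" if "x \<in> pure_fcc" "q \<in> hurwitz" for x q
  proof -
    have x: "x \<in> pure_p" "x \<in> hurwitz" "even (hnorm x)" using \<open>x \<in> pure_fcc\<close> by (auto simp: pure_fcc_iff pure_p_def)
    have "hnorm (qcnj q * x * q) = hnorm q * hnorm x * hnorm q"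
      using that(2) x(2) by (simp add: hnorm_mult hurwitz_mult hurwitz_qcnj)
    then show ?thesis unfolding pure_fcc_iff using cubicD(3)[OF cubic_pure_p x(1) that(2)] x(3) by simp
  qed
  show "(*) one_plus_i ` pure_fcc = (\<lambda>y. y * one_plus_i) ` pure_fcc"
  proof (rule one_plus_i_normalizes_pureI)
    fix a b c assume "Quat 0 a b c \<in> pure_fcc"
    then obtain l m n :: int where "a = of_int l" "b = of_int m" "c = of_int n" "even (l + m + n)"
      unfolding pure_fcc_def by blast
    then have "Quat 0 a (- c) b = Quat 0 (of_int l) (of_int (- n)) (of_int m)" "even (l + (- n) + m)"
      "Quat 0 a c (- b) = Quat 0 (of_int l) (of_int n) (of_int (- m))" "even (l + n + (- m))" by auto
    then show "Quat 0 a (- c) b \<in> pure_fcc" "Quat 0 a c (- b) \<in> pure_fcc" unfolding pure_fcc_def by blast+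
  qed (auto simp: pure_fcc_def)
qed

lemma pure_p_subset_bcc: "pure_p \<subseteq> pure_bcc" unfolding pure_bcc_eq by blast
lemma pure_fcc_subset_p: "pure_fcc \<subseteq> pure_p" using pure_fcc_iff by blast

lemma two_bcc_in_p: "x \<in> pure_bcc \<Longrightarrow> of_int 2 * x \<in> pure_p"
proof -
  assume "x \<in> pure_bcc"
  then obtain r where r: "qscal r + x \<in> hurwitz" "quat_re x = 0" by (auto simp: pure_bcc_def)
  have "of_int 2 * x = (qscal r + x) - qcnj (qscal r + x)"
    using r(2) by (intro quat.expand) (simp add: times_quat_def)
  then have "of_int 2 * x \<in> hurwitz" using r(1) hurwitz_diff hurwitz_qcnj by metis
  then show ?thesis using r(2) by (simp add: pure_p_def times_quat_def)
qed

lemma two_p_in_fcc: "x \<in> pure_p \<Longrightarrow> of_int 2 * x \<in> pure_fcc"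
proof -
  assume "x \<in> pure_p"
  then obtain l m n :: int where "x = Quat 0 (of_int l) (of_int m) (of_int n)" unfolding pure_p_eq by blast
  then have "of_int 2 * x = Quat 0 (of_int (2 * l)) (of_int (2 * m)) (of_int (2 * n))"
    by (simp add: times_quat_def)
  moreover have "even (2 * l + 2 * m + 2 * n)" by simp
  ultimately show ?thesis unfolding pure_fcc_def by blast
qed

lemma qcsl_pure_p:
  assumes q: "reduced q"
  shows "qcsl pure_p q = pure_p \<inter> eichler q"
proof
  have qH: "q \<in> hurwitz" using reduced_hurwitz[OF q] .
  show "qcsl pure_p q \<subseteq> pure_p \<inter> eichler q"
  proof
    fix x assume "x \<in> qcsl pure_p q"
    then obtain y where x: "x \<in> pure_p" "y \<in> pure_p" "x * q = q * y" by (auto simp: qcsl_def)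
    then obtain c w where "w \<in> hurwitz" "x = of_int c + q * w"
      using reduced_idealizer[OF q, of x y] by (auto simp: pure_p_def)
    then have "x - of_int c \<in> rspan q" by (auto simp: mem_rspan_iff)
    then show "x \<in> pure_p \<inter> eichler q" using x(1) by (auto simp: eichler_def pure_p_def)
  qed
  show "pure_p \<inter> eichler q \<subseteq> qcsl pure_p q"
  proof
    fix x assume "x \<in> pure_p \<inter> eichler q"
    then obtain c w where x: "x \<in> pure_p" "w \<in> hurwitz" "x - of_int c = q * w"
      by (auto simp: eichler_def mem_rspan_iff)
    define y where "y = of_int c + w * q"
    have yH: "y \<in> hurwitz" unfolding y_def using x(2) qH by (intro hurwitz_add hurwitz_mult hurwitz_of_int)
    have "x = of_int c + q * w" using x(3) by (simp add: algebra_simps)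
    then have xq: "x * q = q * y" by (simp add: y_def distrib_left distrib_right of_int_quat_commute mult.assoc)
    have "qcnj q * x * q = qscal (qnorm q) * y" by (simp add: mult.assoc xq) (simp add: mult.assoc[symmetric] qcnj_mult_self)
    then have "quat_re (qscal (qnorm q) * y) = 0" using quat_re_sandwich[of q x] x(1) by (simp add: pure_p_def)
    then have "quat_re y = 0" using reduced_nonzero[OF q] by (simp add: times_quat_def)
    then show "x \<in> qcsl pure_p q" using x(1) yH xq by (auto simp: qcsl_def pure_p_def)
  qed
qed

lemma hnorm_mult_in_rspan: "q \<in> hurwitz \<Longrightarrow> x \<in> hurwitz \<Longrightarrow> of_int (int (hnorm q)) * x \<in> rspan q"
  using hnorm_in_rspan rspan_mult_right by blast

lemma hurwitz_diff_cnj_pure: "x \<in> hurwitz \<Longrightarrow> x - qcnj x \<in> pure_p"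
  by (simp add: pure_p_def hurwitz_diff hurwitz_qcnj)

lemma minus_qcnj:
  assumes "x \<in> hurwitz" shows "\<exists>t::int. x - qcnj x = of_int 2 * x - of_int t"
proof -
  obtain t :: int where "2 * quat_re x = of_int t" using hurwitz_trace[OF assms] by blast
  then have "x - qcnj x = of_int 2 * x - of_int t"
    by (intro quat.expand) (simp add: times_quat_def)
  then show ?thesis by blast
qed

text \<open>Twice an element of the order is an integer plus a pure element. Since the Eichler order contains the
integers and all multiples of the odd number \<open>hnorm q\<close>, the pure elements represent all its cosets.\<close>

lemma idx_qcsl_pure_p:
  assumes q: "reduced q"
  shows "idx pure_p (qcsl pure_p q) = hnorm q"
proof -
  have qH: "q \<in> hurwitz" using reduced_hurwitz[OF q] .
  obtain l where l: "int (hnorm q) = 2 * l + 1" using reduced_odd[OF q] by (metis even_of_nat oddE)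
  have "idx pure_p (pure_p \<inter> eichler q) = idx hurwitz (eichler q)"
  proof (rule idx_second_iso[OF cubicD(1)[OF cubic_pure_p] _ add_subgroup_eichler])
    show "pure_p \<subseteq> hurwitz" by (auto simp: pure_p_def)
    fix x assume x: "x \<in> hurwitz"
    obtain t :: int where t: "x - qcnj x = of_int 2 * x - of_int t" using minus_qcnj[OF x] by blast
    have "x - of_int (l + 1) * (x - qcnj x) - of_int ((l + 1) * t) = - (of_int (int (hnorm q)) * x)"
      unfolding t l by (simp add: algebra_simps mult_2)
    also have "\<dots> \<in> rspan q"
      using add_subgroup_uminus[OF add_subgroup_rspan hnorm_mult_in_rspan[OF qH x]] .
    finally have "x - of_int (l + 1) * (x - qcnj x) \<in> eichler q"
      unfolding eichler_def
      using x by (blast intro: hurwitz_diff hurwitz_mult hurwitz_of_int hurwitz_qcnj)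
    moreover have "of_int (l + 1) * (x - qcnj x) \<in> pure_p"
      by (rule add_subgroup_mult_int[OF cubicD(1)[OF cubic_pure_p] hurwitz_diff_cnj_pure[OF x]])
    ultimately show "\<exists>s\<in>pure_p. x - s \<in> eichler q" by blast
  qed
  then show ?thesis using qcsl_pure_p[OF q] idx_eichler[OF q] by simp
qed

text \<open>The element \<open>x - qcnj x\<close> is pure and differs from \<open>2 * x\<close> by an integer, and \<open>2\<close> is invertible modulo
the Eichler order, whose index is odd.\<close>

lemma eichler_from_qcsl:
  assumes q: "reduced q"
  shows "eichler q = {x \<in> hurwitz. x - qcnj x \<in> qcsl pure_p q}"
proof
  have qH: "q \<in> hurwitz" using reduced_hurwitz[OF q] .
  have ofint: "of_int t \<in> eichler q" for t
    using hurwitz_of_int add_subgroup_zero[OF add_subgroup_rspan] by (auto simp: eichler_def intro!: exI[of _ t])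
  show "eichler q \<subseteq> {x \<in> hurwitz. x - qcnj x \<in> qcsl pure_p q}"
  proof
    fix x assume x: "x \<in> eichler q"
    then have xH: "x \<in> hurwitz" by (simp add: eichler_def)
    obtain t :: int where "x - qcnj x = of_int 2 * x - of_int t" using minus_qcnj[OF xH] by blast
    then have "x - qcnj x \<in> eichler q"
      using add_subgroup_diff[OF add_subgroup_eichler add_subgroup_mult_int[OF add_subgroup_eichler x] ofint] by metis
    then show "x \<in> {x \<in> hurwitz. x - qcnj x \<in> qcsl pure_p q}"
      using xH hurwitz_diff_cnj_pure by (simp add: qcsl_pure_p[OF q])
  qed
  show "{x \<in> hurwitz. x - qcnj x \<in> qcsl pure_p q} \<subseteq> eichler q"
  proof clarify
    fix x assume x: "x \<in> hurwitz" "x - qcnj x \<in> qcsl pure_p q"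
    obtain l where l: "int (hnorm q) = 2 * l + 1" using reduced_odd[OF q] by (metis even_of_nat oddE)
    obtain t :: int where t: "x - qcnj x = of_int 2 * x - of_int t" using minus_qcnj[OF x(1)] by blast
    have "x = of_int (int (hnorm q)) * x - of_int l * ((x - qcnj x) + of_int t)"
      unfolding t l by (simp add: algebra_simps mult_2)
    moreover have "of_int (int (hnorm q)) * x \<in> eichler q"
      using hnorm_mult_in_rspan[OF qH x(1)] rspan_subset_eichler[OF qH] by blast
    moreover have "x - qcnj x \<in> eichler q" using x(2) by (simp add: qcsl_pure_p[OF q])
    ultimately show "x \<in> eichler q"
      using add_subgroup_diff[OF add_subgroup_eichler] add_subgroup_add[OF add_subgroup_eichler]
        add_subgroup_mult_int[OF add_subgroup_eichler] ofint by metis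
  qed
qed

text \<open>If \<open>p * y\<close> lies in \<open>\<int> + rspan q\<close> for all \<open>y\<close>, then \<open>p * y * q\<close> lies in \<open>rspan q\<close>, and
\<open>reduced_absorb\<close> applies.\<close>

lemma rspan_subset_if_eichler_eq:
  assumes p: "reduced p" and q: "reduced q" and eq: "eichler p = eichler q"
  shows "rspan p \<subseteq> rspan q"
proof -
  have pH: "p \<in> hurwitz" and qH: "q \<in> hurwitz" using p q reduced_hurwitz by auto
  have "p * y * q \<in> rspan q" if y: "y \<in> hurwitz" for y
  proof -
    have "p * y \<in> eichler q"
      using rspan_subset_eichler[OF pH] rspan_mult_right[OF rspan_self y] eq by blast
    then obtain c w where w: "w \<in> hurwitz" "p * y - of_int c = q * w" by (auto simp: eichler_def mem_rspan_iff)
    then have "p * y = of_int c + q * w" by (simp add: algebra_simps)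
    then have "p * y * q = q * (of_int c + w * q)"
      by (simp add: distrib_left distrib_right of_int_quat_commute mult.assoc)
    moreover have "of_int c + w * q \<in> hurwitz" using w(1) qH by (intro hurwitz_add hurwitz_mult hurwitz_of_int)
    ultimately show ?thesis by (auto simp: mem_rspan_iff)
  qed
  then have "p \<in> rspan q" using reduced_absorb[OF q pH] by blast
  then show ?thesis unfolding rspan_def[of p] using rspan_mult_right by blast
qed

lemma qcsl_pure_p_eq_iff:
  assumes "reduced p" "reduced q"
  shows "qcsl pure_p p = qcsl pure_p q \<longleftrightarrow> rspan p = rspan q"
proof
  assume "qcsl pure_p p = qcsl pure_p q"
  then have "eichler p = eichler q" using eichler_from_qcsl assms by simp
  then show "rspan p = rspan q" using rspan_subset_if_eichler_eq assms by blast
next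
  assume "rspan p = rspan q"
  then have "eichler p = eichler q" unfolding eichler_def by simp
  then show "qcsl pure_p p = qcsl pure_p q" using qcsl_pure_p assms by simp
qed

lemma cubic_lattice_qcsl:
  assumes "G \<in> {pure_p, pure_bcc, pure_fcc}"
  shows "cubic G"
    and "reduced q \<Longrightarrow> idx G (qcsl G q) = hnorm q"
    and "reduced p \<Longrightarrow> reduced q \<Longrightarrow> qcsl G p = qcsl G q \<longleftrightarrow> rspan p = rspan q"
proof -
  note A = qcsl_sublattice qcsl_superlattice idx_qcsl_sublattice
  note bcc = A[OF cubic_pure_bcc cubic_pure_p pure_p_subset_bcc two_bcc_in_p reduced_hurwitz reduced_odd]
  note fcc = A[OF cubic_pure_p cubic_pure_fcc pure_fcc_subset_p two_p_in_fcc reduced_hurwitz reduced_odd]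
  show "cubic G" using assms cubic_pure_p cubic_pure_bcc cubic_pure_fcc by blast
  show "idx G (qcsl G q) = hnorm q" if "reduced q"
    using assms bcc(3)[of q] fcc(3)[of q] that idx_qcsl_pure_p[OF that] by auto
  show "qcsl G p = qcsl G q \<longleftrightarrow> rspan p = rspan q" if pq: "reduced p" "reduced q"
  proof -
    have "qcsl pure_bcc p = qcsl pure_bcc q \<longleftrightarrow> qcsl pure_p p = qcsl pure_p q"
      using bcc(1,2)[of p] bcc(1,2)[of q] pq by metis
    moreover have "qcsl pure_fcc p = qcsl pure_fcc q \<longleftrightarrow> qcsl pure_p p = qcsl pure_p q"
      using fcc(1,2)[of p] fcc(1,2)[of q] pq by metis
    ultimately show ?thesis using assms qcsl_pure_p_eq_iff[OF pq] by blast
  qed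
qed

lemma qcsl_mult_normalizer:
  assumes "t \<noteq> 0" "(*) t ` G = (\<lambda>y. y * t) ` G"
  shows "qcsl G (q * t) = qcsl G q"
proof -
  have "(\<exists>y\<in>G. x * (q * t) = q * t * y) \<longleftrightarrow> (\<exists>y\<in>G. x * q = q * y)" for x
  proof
    assume "\<exists>y\<in>G. x * (q * t) = q * t * y"
    then obtain y where y: "y \<in> G" "x * (q * t) = q * t * y" by blast
    then obtain y' where y': "y' \<in> G" "t * y = y' * t" using assms(2) by blast
    have "(x * q) * t = (q * y') * t" using y(2) y'(2) by (simp add: mult.assoc)
    then show "\<exists>y\<in>G. x * q = q * y" using y'(1) assms(1) by auto
  next
    assume "\<exists>y\<in>G. x * q = q * y"
    then obtain y where y: "y \<in> G" "x * q = q * y" by blast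
    then obtain y' where y': "y' \<in> G" "y * t = t * y'" using assms(2) by blast
    have "x * (q * t) = q * t * y'" using y(2) y'(2) by (metis mult.assoc)
    then show "\<exists>y\<in>G. x * (q * t) = q * t * y" using y'(1) by blast
  qed
  then show ?thesis by (simp add: qcsl_def)
qed

lemma qcsl_mult_qscal:
  assumes "r \<noteq> 0" shows "qcsl G (q * qscal r) = qcsl G q"
proof (rule qcsl_mult_normalizer)
  show "qscal r \<noteq> 0" using assms by (simp add: qscal_def zero_quat_def)
  show "(*) (qscal r) ` G = (\<lambda>y. y * qscal r) ` G" by (simp add: qscal_commute)
qed

lemma qcsl_mult_hunit:
  assumes G: "cubic G" and u: "hunit u"
  shows "qcsl G (q * u) = qcsl G q"
proof (rule qcsl_mult_normalizer)
  obtain v where uH: "u \<in> hurwitz" and v: "v \<in> hurwitz" "u * v = 1" "v * u = 1" using u by (auto simp: hunit_def)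
  have "hnorm u * hnorm v = 1" using hnorm_mult[OF uH v(1)] v(2) by (simp add: hnorm_def)
  then have 1: "u * qcnj u = 1" "qcnj u * u = 1" using hnorm_self[OF uH] by simp_all
  then show "u \<noteq> 0" by auto
  show "(*) u ` G = (\<lambda>y. y * u) ` G"
  proof safe
    fix y assume "y \<in> G"
    then have "u * y * qcnj u \<in> G" using cubicD(3)[OF G _ hurwitz_qcnj[OF uH], of y] by simp
    moreover have "u * y = u * y * qcnj u * u" by (simp add: mult.assoc 1)
    ultimately show "u * y \<in> (\<lambda>y. y * u) ` G" by blast
  next
    fix y assume "y \<in> G"
    then have "qcnj u * y * u \<in> G" using cubicD(3)[OF G _ uH, of y] by simp
    moreover have "y * u = u * (qcnj u * y * u)" by (simp add: mult.assoc[symmetric] 1)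
    ultimately show "y * u \<in> (*) u ` G" by blast
  qed
qed

lemma ex_reduced_same_qcsl:
  assumes "q \<noteq> 0"
  shows "\<exists>p. reduced p \<and> (\<forall>G. cubic G \<longrightarrow> qcsl G q = qcsl G p)"
proof -
  have "\<exists>d::int. d \<noteq> 0 \<and> q * of_int d \<in> hurwitz"
  proof -
    obtain a b c d a' b' c' d' :: int where r: "quat_re q = of_int a / of_int a'" "quat_i q = of_int b / of_int b'"
      "quat_j q = of_int c / of_int c'" "quat_k q = of_int d / of_int d'"
      and pos: "a' > 0" "b' > 0" "c' > 0" "d' > 0"
      by (metis Fract_of_int_quotient quotient_of_denom_pos quotient_of_div surj_pair)
    have "q * of_int (a' * b' * c' * d') = Quat (of_int (a * b' * c' * d')) (of_int (b * a' * c' * d'))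
        (of_int (c * a' * b' * d')) (of_int (d * a' * b' * c'))"
      using pos by (intro quat.expand) (simp add: times_quat_def r field_simps)
    then have "q * of_int (a' * b' * c' * d') \<in> hurwitz" using int_quat_in_hurwitz by metis
    moreover have "a' * b' * c' * d' \<noteq> 0" using pos by simp
    ultimately show ?thesis by blast
  qed
  then obtain d :: int where d: "d \<noteq> 0" "q * of_int d \<in> hurwitz" by blast
  then have d0: "q * of_int d \<noteq> 0" using assms by simp
  obtain p n e where p: "reduced p" "n > 0" "rspan (q * of_int d) = rspan (p * twist n e)"
    using reduced_decomposition[OF d(2) d0] by blast
  obtain u where u: "hunit u" "p * twist n e = q * of_int d * u" using p(3) rspan_eq_iff_hunit[OF d(2) d0] by blast
  have "qcsl G q = qcsl G p" if G: "cubic G" for G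
  proof -
    have "qcsl G q = qcsl G (q * of_int d)" using qcsl_mult_qscal[of "of_int d"] d(1) by (simp add: qscal_of_int)
    also have "\<dots> = qcsl G (p * twist n e)" using qcsl_mult_hunit[OF G u(1)] u(2) by simp
    also have "p * twist n e = (if e then p * one_plus_i else p) * qscal (of_int n)"
      by (simp add: twist_def qscal_of_int of_int_quat_commute mult.assoc)
    also have "qcsl G \<dots> = qcsl G (if e then p * one_plus_i else p)"
      using p(2) by (intro qcsl_mult_qscal) simp
    also have "\<dots> = qcsl G p"
      using qcsl_mult_normalizer[OF one_plus_i_nonzero cubicD(4)[OF G]] by simp
    finally show ?thesis .
  qed
  then show ?thesis using p(1) by blast
qed

section \<open>Rotations and quaternions\<close>

definition vec_of_quat :: "quat \<Rightarrow> real ^ 3" where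
  "vec_of_quat x = vector [of_rat (quat_i x), of_rat (quat_j x), of_rat (quat_k x)]"

lemma vec_of_quat_nth:
  "vec_of_quat x $ 1 = of_rat (quat_i x)" "vec_of_quat x $ 2 = of_rat (quat_j x)"
  "vec_of_quat x $ 3 = of_rat (quat_k x)"
  by (simp_all add: vec_of_quat_def)

lemma vec_of_quat_diff: "vec_of_quat (x - y) = vec_of_quat x - vec_of_quat y"
  by (simp add: vec_eq_iff forall_3 vec_of_quat_nth of_rat_diff)

lemma vec_of_quat_inj:
  "quat_re x = 0 \<Longrightarrow> quat_re y = 0 \<Longrightarrow> vec_of_quat x = vec_of_quat y \<longleftrightarrow> x = y"
  by (auto simp: vec_eq_iff forall_3 vec_of_quat_nth intro: quat.expand)

lemma lat_p_eq: "lat_p = vec_of_quat ` pure_p"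
proof
  show "lat_p \<subseteq> vec_of_quat ` pure_p"
  proof
    fix x assume "x \<in> lat_p"
    then obtain l m n :: int where "x $ 1 = of_int l" "x $ 2 = of_int m" "x $ 3 = of_int n"
      unfolding lat_p_def by (auto elim!: Ints_cases) (metis Ints_cases)
    then have "x = vec_of_quat (Quat 0 (of_int l) (of_int m) (of_int n))"
      by (simp add: vec_eq_iff forall_3 vec_of_quat_nth)
    then show "x \<in> vec_of_quat ` pure_p" unfolding pure_p_eq by blast
  qed
  show "vec_of_quat ` pure_p \<subseteq> lat_p"
    unfolding pure_p_eq lat_p_def by (auto simp: forall_3 vec_of_quat_nth)
qed

lemma lat_bcc_eq: "lat_bcc = vec_of_quat ` pure_bcc"
proof -
  have "(1/2) *\<^sub>R vector [1, 1, 1] + vec_of_quat x = vec_of_quat (Quat 0 (1/2) (1/2) (1/2) + x)" for x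
    by (simp add: vec_eq_iff forall_3 vec_of_quat_nth of_rat_add of_rat_divide)
  then show ?thesis
    unfolding lat_bcc_def pure_bcc_eq lat_p_eq by (simp add: image_Un image_image)
qed

lemma lat_fcc_eq: "lat_fcc = vec_of_quat ` pure_fcc"
proof -
  have *: "vec_of_quat (Quat 0 (of_int l) (of_int m) (of_int n)) = vector [of_int l, of_int m, of_int n]" for l m n
    by (simp add: vec_of_quat_def)
  show ?thesis unfolding lat_fcc_def pure_fcc_def *[symmetric] by blast
qed

definition acts_as :: "real ^ 3 ^ 3 \<Rightarrow> quat \<Rightarrow> bool" where
  "acts_as R q \<longleftrightarrow> q \<noteq> 0 \<and> (\<forall>x. quat_re x = 0 \<longrightarrow> R *v vec_of_quat x = vec_of_quat (q * x * inverse q))"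

lemma quat_re_conj: "quat_re (q * x * inverse q) = quat_re x" if "q \<noteq> 0"
proof -
  have "q * x * inverse q = qscal (1 / qnorm q) * (qcnj (qcnj q) * x * qcnj q)"
    by (simp add: inverse_quat_def mult.assoc qscal_left_commute)
  also have "quat_re \<dots> = quat_re x"
    using that quat_re_sandwich[of "qcnj q" x] by (simp add: times_quat_def[of "qscal _"])
  finally show ?thesis .
qed

lemma csl_eq_image_qcsl:
  assumes act: "acts_as R q" and G: "\<And>x. x \<in> G \<Longrightarrow> quat_re x = 0"
  shows "csl (vec_of_quat ` G) R = vec_of_quat ` qcsl G q"
proof -
  have q: "q \<noteq> 0" using act by (simp add: acts_as_def)
  have iff: "vec_of_quat x = R *v vec_of_quat y \<longleftrightarrow> x * q = q * y" if "x \<in> G" "y \<in> G" for x y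
  proof -
    have "vec_of_quat x = R *v vec_of_quat y \<longleftrightarrow> x = q * y * inverse q"
      using act G that quat_re_conj[OF q] by (simp add: acts_as_def vec_of_quat_inj)
    also have "\<dots> \<longleftrightarrow> x * q = q * y"
    proof
      assume "x = q * y * inverse q"
      then show "x * q = q * y" using q by (simp add: mult.assoc)
    next
      assume "x * q = q * y"
      then show "x = q * y * inverse q" using q by (metis mult.assoc mult_1_right right_inverse)
    qed
    finally show ?thesis .
  qed
  show ?thesis
  proof
    show "csl (vec_of_quat ` G) R \<subseteq> vec_of_quat ` qcsl G q"
    proof
      fix v assume "v \<in> csl (vec_of_quat ` G) R"
      then obtain x y where "x \<in> G" "y \<in> G" "v = vec_of_quat x" "v = R *v vec_of_quat y"
        by (auto simp: csl_def)
      then show "v \<in> vec_of_quat ` qcsl G q" using iff[of x y] by (auto simp: qcsl_def)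
    qed
    show "vec_of_quat ` qcsl G q \<subseteq> csl (vec_of_quat ` G) R"
    proof
      fix v assume "v \<in> vec_of_quat ` qcsl G q"
      then obtain x y where "x \<in> G" "y \<in> G" "v = vec_of_quat x" "x * q = q * y"
        by (auto simp: qcsl_def)
      then show "v \<in> csl (vec_of_quat ` G) R" using iff[of x y] unfolding csl_def by blast
    qed
  qed
qed

text \<open>The Euler-Rodrigues matrix of the rotation \<open>x \<mapsto> q x q\<inverse>\<close>.\<close>

definition rotation_of_quat :: "quat \<Rightarrow> real ^ 3 ^ 3" where
  "rotation_of_quat q =
     (let w = of_rat (quat_re q); x = of_rat (quat_i q); y = of_rat (quat_j q); z = of_rat (quat_k q);
          N = w\<^sup>2 + x\<^sup>2 + y\<^sup>2 + z\<^sup>2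
      in vector [vector [(w\<^sup>2 + x\<^sup>2 - y\<^sup>2 - z\<^sup>2) / N, 2 * (x * y - w * z) / N, 2 * (x * z + w * y) / N],
                 vector [2 * (x * y + w * z) / N, (w\<^sup>2 - x\<^sup>2 + y\<^sup>2 - z\<^sup>2) / N, 2 * (y * z - w * x) / N],
                 vector [2 * (x * z - w * y) / N, 2 * (y * z + w * x) / N, (w\<^sup>2 - x\<^sup>2 - y\<^sup>2 + z\<^sup>2) / N]])"

lemma acts_as_rotation_of_quat:
  assumes "q \<noteq> 0" shows "acts_as (rotation_of_quat q) q"
proof -
  have "rotation_of_quat q *v vec_of_quat v = vec_of_quat (q * v * inverse q)" if re: "quat_re v = 0" for v
  proof -
    obtain w x y z where q: "q = Quat w x y z" by (cases q)
    obtain a b c where v: "v = Quat 0 a b c" using re by (metis quat.collapse)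
    have inv: "inverse q = Quat (w / qnorm q) (- x / qnorm q) (- y / qnorm q) (- z / qnorm q)"
      by (simp add: inverse_quat_def times_quat_def q qcnj_def)
    have N: "qnorm q = w\<^sup>2 + x\<^sup>2 + y\<^sup>2 + z\<^sup>2" by (simp add: q qnorm_def)
    have "q * v * inverse q = Quat 0
        (((w\<^sup>2 + x\<^sup>2 - y\<^sup>2 - z\<^sup>2) / qnorm q) * a + (2 * (x * y - w * z) / qnorm q) * b + (2 * (x * z + w * y) / qnorm q) * c)
        ((2 * (x * y + w * z) / qnorm q) * a + ((w\<^sup>2 - x\<^sup>2 + y\<^sup>2 - z\<^sup>2) / qnorm q) * b + (2 * (y * z - w * x) / qnorm q) * c)
        ((2 * (x * z - w * y) / qnorm q) * a + (2 * (y * z + w * x) / qnorm q) * b + ((w\<^sup>2 - x\<^sup>2 - y\<^sup>2 + z\<^sup>2) / qnorm q) * c)"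
      unfolding inv unfolding q v
      by (simp add: times_quat_def add_divide_distrib diff_divide_distrib power2_eq_square algebra_simps)
    then show ?thesis
      by (simp add: vec_eq_iff forall_3 vec_of_quat_nth matrix_vector_mult_def sum_3 rotation_of_quat_def Let_def
          of_rat_add of_rat_mult of_rat_divide of_rat_diff of_rat_power N) (simp add: q v)
  qed
  then show ?thesis using assms by (simp add: acts_as_def)
qed

lemma rotation_of_quat_in_SO3Q:
  assumes "q \<noteq> 0" shows "rotation_of_quat q \<in> SO3Q"
proof -
  define w x y z :: real where defs: "w = of_rat (quat_re q)" "x = of_rat (quat_i q)" "y = of_rat (quat_j q)" "z = of_rat (quat_k q)"
  define N where "N = w\<^sup>2 + x\<^sup>2 + y\<^sup>2 + z\<^sup>2"
  have "N = of_rat (qnorm q)" by (simp add: N_def defs qnorm_def of_rat_add of_rat_power)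
  then have N0: "N \<noteq> 0" using assms by simp
  let ?R = "rotation_of_quat q"
  have R: "?R = vector [vector [(w\<^sup>2 + x\<^sup>2 - y\<^sup>2 - z\<^sup>2) / N, 2 * (x * y - w * z) / N, 2 * (x * z + w * y) / N],
                 vector [2 * (x * y + w * z) / N, (w\<^sup>2 - x\<^sup>2 + y\<^sup>2 - z\<^sup>2) / N, 2 * (y * z - w * x) / N],
                 vector [2 * (x * z - w * y) / N, 2 * (y * z + w * x) / N, (w\<^sup>2 - x\<^sup>2 - y\<^sup>2 + z\<^sup>2) / N]]"
    by (simp add: rotation_of_quat_def Let_def N_def defs)
  have "transpose ?R ** ?R = mat 1"
    unfolding R using N0
    by (simp add: vec_eq_iff forall_3 matrix_matrix_mult_def sum_3 transpose_def mat_def divide_simps)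
       (simp add: N_def power2_eq_square algebra_simps)
  then have "orthogonal_matrix ?R" by (simp add: orthogonal_matrix)
  moreover have "det ?R = 1"
    unfolding R det_3 using N0
    by (simp add: divide_simps) (simp add: N_def power2_eq_square algebra_simps)
  moreover have "?R $ i $ j \<in> \<rat>" for i j
  proof -
    have "w \<in> \<rat>" "x \<in> \<rat>" "y \<in> \<rat>" "z \<in> \<rat>" by (simp_all add: defs)
    then have "N \<in> \<rat>" unfolding N_def by (intro Rats_add Rats_power)
    have "\<forall>i j. ?R $ i $ j \<in> \<rat>"
      unfolding R forall_3
      using \<open>N \<in> \<rat>\<close> \<open>w \<in> \<rat>\<close> \<open>x \<in> \<rat>\<close> \<open>y \<in> \<rat>\<close> \<open>z \<in> \<rat>\<close>
      by (simp add: Rats_add Rats_diff Rats_mult Rats_divide Rats_power)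
    then show ?thesis by blast
  qed
  ultimately show ?thesis by (simp add: SO3Q_def rotation_matrix_def)
qed

text \<open>The columns \<open>r 1\<close>, \<open>r 2\<close>, \<open>r 3\<close> of \<open>R\<close>, read as pure quaternions, multiply like \<open>i\<close>, \<open>j\<close>, \<open>k\<close>. With
\<open>e 1\<close>, \<open>e 2\<close>, \<open>e 3\<close> for \<open>i\<close>, \<open>j\<close>, \<open>k\<close>, the sum \<open>Q p\<close> of \<open>p\<close> and the three terms
\<open>r j * p * inverse (e j)\<close> therefore satisfies \<open>r j * Q p = Q p * e j\<close>, so that \<open>Q p\<close> induces \<open>R\<close>
if it is not zero.\<close>

lemma acts_as_exists:
  assumes "R \<in> SO3Q"
  shows "\<exists>q. acts_as R q"
proof -
  have rot: "rotation_matrix R" and rat: "\<And>i j. R $ i $ j \<in> \<rat>" using assms by (auto simp: SO3Q_def)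
  define \<rho> where "\<rho> i j = (SOME r. of_rat r = R $ i $ j)" for i j
  have \<rho>: "R $ i $ j = of_rat (\<rho> i j)" for i j
    unfolding \<rho>_def using rat[of i j] by (metis (mono_tags, lifting) Rats_cases someI_ex)
  define r where "r j = Quat 0 (\<rho> 1 j) (\<rho> 2 j) (\<rho> 3 j)" for j
  have "transpose R ** R = mat 1" using rot by (simp add: rotation_matrix_def orthogonal_matrix)
  then have "\<forall>i j. (\<Sum>k\<in>UNIV. R $ k $ i * R $ k $ j) = (if i = j then 1 else 0)"
    by (simp add: vec_eq_iff matrix_matrix_mult_def transpose_def mat_def)
  then have dots: "\<rho> 1 i * \<rho> 1 j + \<rho> 2 i * \<rho> 2 j + \<rho> 3 i * \<rho> 3 j = (if i = j then 1 else 0)" for i j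
  proof -
    assume "\<forall>i j. (\<Sum>k\<in>UNIV. R $ k $ i * R $ k $ j) = (if i = j then 1 else 0)"
    then have "(of_rat (\<rho> 1 i * \<rho> 1 j + \<rho> 2 i * \<rho> 2 j + \<rho> 3 i * \<rho> 3 j) :: real) = of_rat (if i = j then 1 else 0)"
      by (simp add: sum_3 \<rho> of_rat_add of_rat_mult)
    then show ?thesis by (simp only: of_rat_eq_iff)
  qed
  have cross: "cross3 (R *v axis 1 1) (R *v axis 2 1) = R *v cross3 (axis 1 1) (axis 2 1)"
    by (rule cross_rotation_matrix[OF rot])
  have col: "R *v axis j 1 = vector [R $ 1 $ j, R $ 2 $ j, R $ 3 $ j]" for j
    by (simp add: vec_eq_iff forall_3 matrix_vector_mult_basis column_def)
  have "cross3 (axis 1 1) (axis 2 1) = axis 3 1"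
    by (simp add: cross3_def vec_eq_iff forall_3 axis_def)
  then have cross': "cross3 (vector [R $ 1 $ 1, R $ 2 $ 1, R $ 3 $ 1]) (vector [R $ 1 $ 2, R $ 2 $ 2, R $ 3 $ 2])
      = vector [R $ 1 $ 3, R $ 2 $ 3, R $ 3 $ 3]"
    using cross by (simp only: col)
  have r12: "r 1 * r 2 = r 3"
  proof -
    have "\<rho> 2 1 * \<rho> 3 2 - \<rho> 3 1 * \<rho> 2 2 = \<rho> 1 3" "\<rho> 3 1 * \<rho> 1 2 - \<rho> 1 1 * \<rho> 3 2 = \<rho> 2 3"
      "\<rho> 1 1 * \<rho> 2 2 - \<rho> 2 1 * \<rho> 1 2 = \<rho> 3 3"
      using cross' by (simp_all add: cross3_def vec_eq_iff forall_3 \<rho> flip: of_rat_mult of_rat_diff)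
    then show ?thesis
      using dots[of 1 2] by (simp add: r_def times_quat_def algebra_simps)
  qed
  have sq: "r j * r j = - 1" for j
    using dots[of j j] by (simp add: r_def quat_op_defs algebra_simps)
  have r3: "r 3 = r 1 * r 2" using r12 by simp
  have r21: "r 2 * r 1 = - r 3"
  proof -
    have "r 3 * (r 2 * r 1) = 1" by (simp add: r3 mult.assoc) (metis minus_minus minus_mult_right mult.assoc mult_1_left mult_minus1 sq)
    then have "r 3 * (r 3 * (r 2 * r 1)) = r 3" by simp
    then show ?thesis by (simp add: mult.assoc[symmetric] sq) (metis add.inverse_inverse)
  qed
  have r13: "r 1 * r 3 = - r 2" "r 2 * r 3 = r 1"
    unfolding r3 by (metis mult.assoc mult_minus1 sq) (metis minus_mult_left mult.assoc mult_minus1_right r21 r3 sq minus_minus)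
  define e where "e j = (if j = 1 then Quat 0 1 0 0 else if j = 2 then Quat 0 0 1 0 else Quat 0 0 0 1)" for j :: 3
  have e: "e 1 = Quat 0 1 0 0" "e 2 = Quat 0 0 1 0" "e 3 = Quat 0 0 0 1" by (simp_all add: e_def)
  define Q where "Q p = p - r 1 * p * e 1 - r 2 * p * e 2 - r 3 * p * e 3" for p
  have ee: "e 1 * e 1 = -1" "e 2 * e 2 = -1" "e 1 * e 2 = e 3" "e 2 * e 1 = - e 3" "e 3 * e 1 = e 2" "e 3 * e 2 = - e 1"
    by (simp_all add: e quat_op_defs)
  have inter1: "r 1 * Q p = Q p * e 1" for p
  proof -
    have "r 1 * Q p = r 1 * p - (r 1 * r 1) * p * e 1 - (r 1 * r 2) * p * e 2 - (r 1 * r 3) * p * e 3"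
      by (simp add: Q_def right_diff_distrib mult.assoc)
    also have "\<dots> = r 1 * p + p * e 1 - r 3 * p * e 2 + r 2 * p * e 3"
      by (simp add: sq r12 r13)
    also have "\<dots> = p * e 1 - r 1 * p * (e 1 * e 1) - r 2 * p * (e 2 * e 1) - r 3 * p * (e 3 * e 1)"
      by (simp add: ee)
    also have "\<dots> = Q p * e 1" by (simp add: Q_def left_diff_distrib mult.assoc)
    finally show ?thesis .
  qed
  have inter2: "r 2 * Q p = Q p * e 2" for p
  proof -
    have "r 2 * Q p = r 2 * p - (r 2 * r 1) * p * e 1 - (r 2 * r 2) * p * e 2 - (r 2 * r 3) * p * e 3"
      by (simp add: Q_def right_diff_distrib mult.assoc)
    also have "\<dots> = r 2 * p + r 3 * p * e 1 + p * e 2 - r 1 * p * e 3"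
      by (simp add: sq r21 r13)
    also have "\<dots> = p * e 2 - r 1 * p * (e 1 * e 2) - r 2 * p * (e 2 * e 2) - r 3 * p * (e 3 * e 2)"
      by (simp add: ee)
    also have "\<dots> = Q p * e 2" by (simp add: Q_def left_diff_distrib mult.assoc)
    finally show ?thesis .
  qed
  have inter3: "r 3 * Q p = Q p * e 3" for p
    unfolding r3 by (metis ee(3) inter1 inter2 mult.assoc)
  \<comment> \<open>The trace of the linear map \<open>Q\<close> is \<open>4\<close>, so \<open>Q\<close> does not vanish on all four basis quaternions.\<close>
  have "quat_re (Q 1) + quat_i (Q (e 1)) + quat_j (Q (e 2)) + quat_k (Q (e 3)) = 4"
    by (simp add: Q_def e r_def times_quat_def)
  then have "\<exists>p. Q p \<noteq> 0"
    by (rule contrapos_pp) simp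
  then obtain p where p: "Q p \<noteq> 0" by blast
  have "R *v vec_of_quat x = vec_of_quat (Q p * x * inverse (Q p))" if re: "quat_re x = 0" for x
  proof -
    define s where "s = qscal (quat_i x) * r 1 + qscal (quat_j x) * r 2 + qscal (quat_k x) * r 3"
    have x: "x = qscal (quat_i x) * e 1 + qscal (quat_j x) * e 2 + qscal (quat_k x) * e 3"
      using re by (intro quat.expand) (simp add: e times_quat_def)
    have "s * Q p = qscal (quat_i x) * (Q p * e 1) + qscal (quat_j x) * (Q p * e 2) + qscal (quat_k x) * (Q p * e 3)"
      by (simp add: s_def distrib_right mult.assoc inter1 inter2 inter3)
    also have "\<dots> = Q p * x"
      by (subst (4) x) (simp only: distrib_left qscal_left_commute)
    finally have "s = Q p * x * inverse (Q p)" using p by (metis mult.assoc mult_1_right right_inverse)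
    moreover have "R *v vec_of_quat x = vec_of_quat s"
      by (simp add: vec_eq_iff forall_3 vec_of_quat_nth matrix_vector_mult_def sum_3 s_def r_def times_quat_def
          of_rat_add of_rat_mult \<rho> mult.commute)
    ultimately show ?thesis by simp
  qed
  then show ?thesis using p by (auto simp: acts_as_def)
qed

definition lattice_pairs :: "((real ^ 3) set \<times> quat set) set" where
  "lattice_pairs = {(lat_p, pure_p), (lat_bcc, pure_bcc), (lat_fcc, pure_fcc)}"

lemma lattice_pairsD:
  assumes "(\<Gamma>, G) \<in> lattice_pairs"
  shows "\<Gamma> = vec_of_quat ` G" "G \<in> {pure_p, pure_bcc, pure_fcc}" "x \<in> G \<Longrightarrow> quat_re x = 0"
proof -
  show "\<Gamma> = vec_of_quat ` G" and G: "G \<in> {pure_p, pure_bcc, pure_fcc}"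
    using assms lat_p_eq lat_bcc_eq lat_fcc_eq by (auto simp: lattice_pairs_def)
  show "quat_re x = 0" if "x \<in> G"
    by (rule cubicD(2)[OF cubic_lattice_qcsl(1)[OF G] that])
qed

lemma idx_vec_of_quat_image:
  assumes "cubic G"
  shows "idx (vec_of_quat ` G) (vec_of_quat ` qcsl G q) = idx G (qcsl G q)"
  by (rule idx_image[OF cubicD(1)[OF assms] add_subgroup_qcsl[OF cubicD(1)[OF assms]]])
     (auto simp: qcsl_def vec_of_quat_diff inj_on_def vec_of_quat_inj cubicD(2)[OF assms])

lemma SO3Q_reduced:
  assumes "R \<in> SO3Q"
  shows "\<exists>p. reduced p \<and> (\<forall>(\<Gamma>, G) \<in> lattice_pairs. csl \<Gamma> R = vec_of_quat ` qcsl G p)"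
proof -
  obtain q where q: "acts_as R q" using acts_as_exists[OF assms] by blast
  then obtain p where p: "reduced p" "\<And>G. cubic G \<Longrightarrow> qcsl G q = qcsl G p"
    using ex_reduced_same_qcsl acts_as_def by metis
  have "csl \<Gamma> R = vec_of_quat ` qcsl G p" if "(\<Gamma>, G) \<in> lattice_pairs" for \<Gamma> G
    using csl_eq_image_qcsl[OF q lattice_pairsD(3)[OF that]] p(2)[OF cubic_lattice_qcsl(1)[OF lattice_pairsD(2)[OF that]]]
      lattice_pairsD(1)[OF that] by simp
  then show ?thesis using p(1) by blast
qed

lemma csl_rotation_of_quat:
  assumes "reduced q" "(\<Gamma>, G) \<in> lattice_pairs"
  shows "csl \<Gamma> (rotation_of_quat q) = vec_of_quat ` qcsl G q"
  using csl_eq_image_qcsl[OF acts_as_rotation_of_quat[OF reduced_nonzero[OF assms(1)]] lattice_pairsD(3)[OF assms(2)]]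
    lattice_pairsD(1)[OF assms(2)] by simp

lemma group_index_qcsl:
  assumes "reduced q" "(\<Gamma>, G) \<in> lattice_pairs"
  shows "group_index (add_group_on \<Gamma>) (vec_of_quat ` qcsl G q) = hnorm q"
  unfolding group_index_add_group_on lattice_pairsD(1)[OF assms(2)]
  using idx_vec_of_quat_image[OF cubic_lattice_qcsl(1)[OF lattice_pairsD(2)[OF assms(2)]]]
    cubic_lattice_qcsl(2)[OF lattice_pairsD(2)[OF assms(2)] assms(1)] by simp

lemma coincidence_index_eq_hnorm:
  assumes "R \<in> SO3Q"
  shows "\<exists>p. reduced p \<and> (\<forall>\<Gamma>\<in>{lat_p, lat_bcc, lat_fcc}. coincidence_index \<Gamma> R = hnorm p)"
proof -
  obtain p where p: "reduced p" "\<forall>(\<Gamma>, G) \<in> lattice_pairs. csl \<Gamma> R = vec_of_quat ` qcsl G p"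
    using SO3Q_reduced[OF assms] by blast
  have "coincidence_index \<Gamma> R = hnorm p" if "(\<Gamma>, G) \<in> lattice_pairs" for \<Gamma> G
  proof -
    have "csl \<Gamma> R = vec_of_quat ` qcsl G p" using p(2) that by blast
    then show ?thesis using group_index_qcsl[OF p(1) that] by (simp add: coincidence_index_def)
  qed
  then show ?thesis using p(1) by (auto simp: lattice_pairs_def)
qed

lemma coincidence_spectrum_eq:
  assumes "(\<Gamma>, G) \<in> lattice_pairs"
  shows "coincidence_spectrum \<Gamma> = hnorm ` {q. reduced q}"
proof
  show "coincidence_spectrum \<Gamma> \<subseteq> hnorm ` {q. reduced q}"
    unfolding coincidence_spectrum_def using coincidence_index_eq_hnorm assms by (fastforce simp: lattice_pairs_def)
  show "hnorm ` {q. reduced q} \<subseteq> coincidence_spectrum \<Gamma>"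
  proof clarify
    fix q assume q: "reduced q"
    then have "coincidence_index \<Gamma> (rotation_of_quat q) = hnorm q"
      using csl_rotation_of_quat[OF q assms] group_index_qcsl[OF q assms] by (simp add: coincidence_index_def)
    then show "hnorm q \<in> coincidence_spectrum \<Gamma>"
      unfolding coincidence_spectrum_def using rotation_of_quat_in_SO3Q[OF reduced_nonzero[OF q]] by (metis image_eqI)
  qed
qed

text \<open>The bijection sends \<open>rspan p\<close> to the image of \<open>qcsl G p\<close>. It is well defined and injective by
\<open>cubic_lattice_qcsl\<close>, and it reaches every coincidence site lattice by \<open>SO3Q_reduced\<close>.\<close>

lemma csls_of_index_bij:
  assumes L: "(\<Gamma>, G) \<in> lattice_pairs"
  shows "\<exists>f. bij_betw f {P \<in> reduced_ideals. ideal_norm P = m} (csls_of_index \<Gamma> m)"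
proof -
  note GD = lattice_pairsD[OF L]
  have inj: "vec_of_quat ` qcsl G p = vec_of_quat ` qcsl G q \<longleftrightarrow> rspan p = rspan q" if "reduced p" "reduced q" for p q
  proof -
    have "inj_on vec_of_quat G" using GD(3) by (auto simp: inj_on_def vec_of_quat_inj)
    then have "vec_of_quat ` qcsl G p = vec_of_quat ` qcsl G q \<longleftrightarrow> qcsl G p = qcsl G q"
      by (rule inj_on_image_eq_iff) (auto simp: qcsl_def)
    then show ?thesis using cubic_lattice_qcsl(3)[OF GD(2) that] by simp
  qed
  define f where "f P = vec_of_quat ` qcsl G (SOME p. reduced p \<and> P = rspan p)" for P
  have f: "f (rspan p) = vec_of_quat ` qcsl G p" if "reduced p" for p
  proof -
    have "reduced (SOME p'. reduced p' \<and> rspan p = rspan p') \<and> rspan p = rspan (SOME p'. reduced p' \<and> rspan p = rspan p')"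
      by (rule someI[of _ p]) (simp add: that)
    then show ?thesis unfolding f_def using inj that by metis
  qed
  have norm: "ideal_norm (rspan p) = hnorm p" if "reduced p" for p
    using ideal_norm_rspan reduced_hurwitz reduced_nonzero that by blast
  have "bij_betw f {P \<in> reduced_ideals. ideal_norm P = m} (csls_of_index \<Gamma> m)"
    unfolding bij_betw_def
  proof
    show "inj_on f {P \<in> reduced_ideals. ideal_norm P = m}"
    proof (rule inj_onI)
      fix P Q assume "P \<in> {P \<in> reduced_ideals. ideal_norm P = m}" "Q \<in> {P \<in> reduced_ideals. ideal_norm P = m}"
        and eq: "f P = f Q"
      then obtain p q where pq: "reduced p" "reduced q" and PQ: "P = rspan p" "Q = rspan q"
        by (auto simp: reduced_ideals_def)
      have "vec_of_quat ` qcsl G p = vec_of_quat ` qcsl G q"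
        using eq unfolding PQ f[OF pq(1)] f[OF pq(2)] .
      then show "P = Q" unfolding PQ inj[OF pq] .
    qed
    show "f ` {P \<in> reduced_ideals. ideal_norm P = m} = csls_of_index \<Gamma> m"
    proof
      show "f ` {P \<in> reduced_ideals. ideal_norm P = m} \<subseteq> csls_of_index \<Gamma> m"
      proof clarify
        fix P assume "P \<in> reduced_ideals" "m = ideal_norm P"
        then obtain p where p: "reduced p" "P = rspan p" "m = hnorm p" using norm by (auto simp: reduced_ideals_def)
        then have "f P = csl \<Gamma> (rotation_of_quat p)" "group_index (add_group_on \<Gamma>) (f P) = m"
          using f csl_rotation_of_quat[OF _ L] group_index_qcsl[OF _ L] by simp_all
        then show "f P \<in> csls_of_index \<Gamma> (ideal_norm P)"
          using \<open>m = ideal_norm P\<close> rotation_of_quat_in_SO3Q[OF reduced_nonzero[OF p(1)]] by (auto simp: csls_of_index_def)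
      qed
      show "csls_of_index \<Gamma> m \<subseteq> f ` {P \<in> reduced_ideals. ideal_norm P = m}"
      proof
        fix K assume "K \<in> csls_of_index \<Gamma> m"
        then obtain R where R: "R \<in> SO3Q" "K = csl \<Gamma> R" "group_index (add_group_on \<Gamma>) K = m"
          by (auto simp: csls_of_index_def)
        obtain p where p: "reduced p" "\<forall>(\<Gamma>, G) \<in> lattice_pairs. csl \<Gamma> R = vec_of_quat ` qcsl G p"
          using SO3Q_reduced[OF R(1)] by blast
        then have K: "K = vec_of_quat ` qcsl G p" using R(2) L by blast
        then have "K = f (rspan p)" "hnorm p = m" using f[OF p(1)] group_index_qcsl[OF p(1) L] R(3) by simp_all
        then show "K \<in> f ` {P \<in> reduced_ideals. ideal_norm P = m}"
          using p(1) norm[OF p(1)] by (auto simp: reduced_ideals_def)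
      qed
    qed
  qed
  then show ?thesis by blast
qed

section \<open>Counting right ideals of odd norm\<close>

text \<open>With \<open>p = 2 * h + 1\<close>, the numbers \<open>x\<^sup>2\<close> and the numbers \<open>- 1 - x\<^sup>2\<close> for \<open>0 \<le> x \<le> h\<close> represent \<open>h + 1\<close>
residue classes each, so the two sets of classes meet.\<close>

lemma two_squares_plus_one_prime:
  assumes "prime (p :: nat)" "odd p"
  shows "\<exists>a b :: int. int p dvd a\<^sup>2 + b\<^sup>2 + 1"
proof -
  obtain h where h: "p = 2 * h + 1" using assms(2) by (elim oddE)
  define X :: "int set" where "X = {0..int h}"
  define f g :: "int \<Rightarrow> int" where "f x = x\<^sup>2 mod int p" and "g x = (- 1 - x\<^sup>2) mod int p" for x
  have sq_inj: "x = y" if "x \<in> X" "y \<in> X" "int p dvd x\<^sup>2 - y\<^sup>2" for x y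
  proof -
    have "x\<^sup>2 - y\<^sup>2 = (x - y) * (x + y)" by (simp add: power2_eq_square algebra_simps)
    then have "int p dvd x - y \<or> int p dvd x + y"
      using that(3) assms(1) by (simp add: prime_dvd_mult_iff)
    then show ?thesis
    proof
      assume "int p dvd x - y"
      moreover have "\<bar>x - y\<bar> < int p" using that(1,2) h by (auto simp: X_def)
      ultimately show ?thesis using zdvd_not_zless[of "\<bar>x - y\<bar>" "int p"] by auto
    next
      assume "int p dvd x + y"
      moreover have "0 \<le> x + y" "x + y < int p" using that(1,2) h by (auto simp: X_def)
      moreover have "0 < x + y \<Longrightarrow> int p \<le> x + y"
        using zdvd_imp_le \<open>int p dvd x + y\<close> by blast
      ultimately have "x + y = 0" by linarith
      then show ?thesis using that(1,2) by (auto simp: X_def)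
    qed
  qed
  have "inj_on f X" "inj_on g X"
  proof -
    show "inj_on f X"
      by (rule inj_onI) (auto simp: f_def mod_eq_dvd_iff intro: sq_inj)
    show "inj_on g X"
    proof (rule inj_onI)
      fix x y assume xy: "x \<in> X" "y \<in> X" "g x = g y"
      then have "int p dvd (- 1 - x\<^sup>2) - (- 1 - y\<^sup>2)" by (simp only: g_def mod_eq_dvd_iff)
      then have "int p dvd y\<^sup>2 - x\<^sup>2" by simp
      then show "x = y" using sq_inj[of y x] xy by simp
    qed
  qed
  then have cards: "card (f ` X) = h + 1" "card (g ` X) = h + 1"
    by (simp_all add: card_image X_def)
  have fin: "finite (f ` X)" "finite (g ` X)" by (simp_all add: X_def)
  have "f ` X \<union> g ` X \<subseteq> {0..<int p}" using h by (auto simp: f_def g_def)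
  then have "card (f ` X \<union> g ` X) \<le> card {0..<int p}" by (intro card_mono) simp_all
  then have "f ` X \<inter> g ` X \<noteq> {}"
    using cards card_Un_disjoint[OF fin] h by fastforce
  then obtain x y where "f x = g y" by blast
  then have "int p dvd x\<^sup>2 - (- 1 - y\<^sup>2)" by (simp only: f_def g_def mod_eq_dvd_iff)
  then have "int p dvd x\<^sup>2 + y\<^sup>2 + 1" by (simp add: algebra_simps)
  then show ?thesis by blast
qed

text \<open>Multiply up the prime factors. A prime that is new is handled by the Chinese remainder theorem. If it
divides the previous modulus, then it cannot divide both \<open>a\<close> and \<open>b\<close>, and a solution lifts as in
Hensel's lemma.\<close>

lemma two_squares_plus_one:
  "odd m \<Longrightarrow> \<exists>a b :: int. int m dvd a\<^sup>2 + b\<^sup>2 + 1"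
proof (induction m rule: less_induct)
  case (less m)
  show ?case
  proof (cases "m = 1")
    case True then show ?thesis by simp
  next
    case False
    then obtain p where p: "prime p" "p dvd m" using prime_factor_nat by blast
    then obtain n where n: "m = p * n" by blast
    have odd: "odd p" "odd n" using less.prems n by auto
    have "n > 0" using odd(2) by (auto intro: Nat.gr0I)
    then have "n < m" using n prime_gt_1_nat[OF p(1)] by simp
    then obtain a b :: int where ab: "int n dvd a\<^sup>2 + b\<^sup>2 + 1" using less.IH odd(2) by blast
    have pi: "prime (int p)" using p(1) by simp
    show ?thesis
    proof (cases "p dvd n")
      case False
      then have cop: "coprime (int p) (int n)" using pi by (simp add: prime_imp_coprime)
      then obtain u v where uv: "u * int p + v * int n = 1" by (metis bezout_int coprime_imp_gcd_eq_1)
      obtain c d :: int where cd: "int p dvd c\<^sup>2 + d\<^sup>2 + 1"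
        using two_squares_plus_one_prime[OF p(1) odd(1)] by blast
      define a' b' where "a' = a + int n * (v * (c - a))" and "b' = b + int n * (v * (d - b))"
      have vn: "v * int n = 1 - u * int p" using uv by simp
      have "a' = a + (v * int n) * (c - a)" "b' = b + (v * int n) * (d - b)" by (simp_all add: a'_def b'_def)
      then have a'p: "a' = c + int p * (u * (a - c))" "b' = d + int p * (u * (b - d))"
        unfolding vn by (simp_all add: algebra_simps)
      have "a'\<^sup>2 + b'\<^sup>2 + 1 = (a\<^sup>2 + b\<^sup>2 + 1) + int n * (v * (c - a) * (2 * a + int n * (v * (c - a))) + v * (d - b) * (2 * b + int n * (v * (d - b))))"
        by (simp add: a'_def b'_def power2_eq_square algebra_simps)
      then have 1: "int n dvd a'\<^sup>2 + b'\<^sup>2 + 1" using ab by (metis dvd_add dvd_triv_left)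
      have "a'\<^sup>2 + b'\<^sup>2 + 1 = (c\<^sup>2 + d\<^sup>2 + 1) + int p * (u * (a - c) * (2 * c + int p * (u * (a - c))) + u * (b - d) * (2 * d + int p * (u * (b - d))))"
        unfolding a'p by (simp add: power2_eq_square algebra_simps)
      then have 2: "int p dvd a'\<^sup>2 + b'\<^sup>2 + 1" using cd by (metis dvd_add dvd_triv_left)
      have "int p * int n dvd a'\<^sup>2 + b'\<^sup>2 + 1" using divides_mult[OF 2 1 cop] .
      then show ?thesis unfolding n by auto
    next
      case True
      obtain k where k: "a\<^sup>2 + b\<^sup>2 + 1 = int n * k" using ab by blast
      have lift: "\<exists>a' b'. int m dvd a'\<^sup>2 + b'\<^sup>2 + 1" if "\<not> int p dvd a" "a\<^sup>2 + b\<^sup>2 + 1 = int n * k" for a b :: int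
      proof -
        have "\<not> int p dvd 2" using odd(1) pi by (metis even_of_nat primes_dvd_imp_eq two_is_prime_nat dvd_refl of_nat_dvd_iff of_nat_numeral p(1))
        then have "\<not> int p dvd 2 * a" using that(1) pi by (simp add: prime_dvd_mult_iff)
        then have "coprime (int p) (2 * a)" by (rule prime_imp_coprime[OF pi])
        then obtain u v where uv: "u * int p + v * (2 * a) = 1" by (metis bezout_int coprime_imp_gcd_eq_1)
        define x where "x = - (k * v)"
        have v2: "v * (2 * a) = 1 - u * int p" using uv by simp
        have "(a + int n * x)\<^sup>2 + b\<^sup>2 + 1 = (a\<^sup>2 + b\<^sup>2 + 1) + int n * (2 * a * x + int n * x\<^sup>2)"
          by (simp add: power2_eq_square algebra_simps)
        also have "\<dots> = int n * (k - k * (v * (2 * a)) + int n * x\<^sup>2)"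
          unfolding that(2) by (simp add: x_def algebra_simps)
        also have "\<dots> = int n * (k * u * int p + int n * x\<^sup>2)"
          unfolding v2 by (simp add: algebra_simps)
        finally have "(a + int n * x)\<^sup>2 + b\<^sup>2 + 1 = int n * (k * u * int p + int n * x\<^sup>2)" .
        moreover have "int p dvd k * u * int p + int n * x\<^sup>2" using True by simp
        ultimately have "int n * int p dvd (a + int n * x)\<^sup>2 + b\<^sup>2 + 1" by simp
        then show ?thesis unfolding n by (auto simp: mult.commute)
      qed
      have "\<not> int p dvd a \<or> \<not> int p dvd b"
      proof (rule ccontr)
        assume "\<not> ?thesis"
        then have "int p dvd a\<^sup>2 + b\<^sup>2" by (simp add: power2_eq_square)
        moreover have "int p dvd a\<^sup>2 + b\<^sup>2 + 1" using True ab by (meson dvd_trans of_nat_dvd_iff)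
        ultimately have "int p dvd 1" by (metis dvd_add_right_iff)
        then show False using pi by (metis not_prime_unit)
      qed
      then show ?thesis
        using lift[of a b] lift[of b a] k by (auto simp: add.commute)
    qed
  qed
qed

text \<open>Let \<open>n\<close> be odd and \<open>a\<^sup>2 + b\<^sup>2 + 1\<close> divisible by \<open>n\<close>. Sending \<open>i\<close> to the matrix with rows \<open>(0, -1)\<close>,
\<open>(1, 0)\<close> and \<open>j\<close> to the one with rows \<open>(a, b)\<close>, \<open>(b, -a)\<close> identifies the Hurwitz order modulo \<open>n\<close> with
the \<open>2 \<times> 2\<close> matrices modulo \<open>n\<close>. Column vectors are written as Gaussian integers.\<close>

definition gauss :: "quat set" where
  "gauss = {Quat (of_int u) (of_int v) 0 0 | u v. True}"

text \<open>Its matrix is twice the matrix unit with entry \<open>1\<close> in the upper left corner.\<close>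

definition eps :: "int \<Rightarrow> int \<Rightarrow> quat" where
  "eps a b = Quat 1 0 (- of_int a) (of_int b)"

text \<open>Twice the first column of the matrix of \<open>x\<close>; the second column is the first column of \<open>x * i\<close>. The
factor \<open>2\<close> clears the denominators and is invertible modulo \<open>n\<close>.\<close>

definition column :: "int \<Rightarrow> int \<Rightarrow> quat \<Rightarrow> quat" where
  "column a b x = Quat (2 * quat_re x + 2 * of_int a * quat_j x - 2 * of_int b * quat_k x)
                    (2 * quat_i x + 2 * of_int b * quat_j x + 2 * of_int a * quat_k x) 0 0"

abbreviation qi :: quat where "qi \<equiv> Quat 0 1 0 0"
abbreviation qj :: quat where "qj \<equiv> Quat 0 0 1 0"
abbreviation qk :: quat where "qk \<equiv> Quat 0 0 0 1"

text \<open>A right ideal of matrices consists of all matrices whose columns lie in one fixed module; these two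
operations pass from the ideal to the module and back.\<close>

definition column_lattice :: "int \<Rightarrow> int \<Rightarrow> quat set \<Rightarrow> quat set" where
  "column_lattice a b I = {g \<in> gauss. g * eps a b \<in> I}"

definition ideal_of_lattice :: "int \<Rightarrow> int \<Rightarrow> quat set \<Rightarrow> quat set" where
  "ideal_of_lattice a b L = {x \<in> hurwitz. column a b x \<in> L \<and> column a b (x * qi) \<in> L}"

definition lattice_mod :: "int \<Rightarrow> quat set \<Rightarrow> bool" where
  "lattice_mod n L \<longleftrightarrow> L \<subseteq> gauss \<and> add_subgroup L \<and> (\<forall>g\<in>gauss. of_int n * g \<in> L)"

lemma lattice_modD:
  "lattice_mod n L \<Longrightarrow> L \<subseteq> gauss" "lattice_mod n L \<Longrightarrow> add_subgroup L"
  "lattice_mod n L \<Longrightarrow> g \<in> gauss \<Longrightarrow> of_int n * g \<in> L"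
  by (auto simp: lattice_mod_def)

lemma gauss_hurwitz: "gauss \<subseteq> hurwitz"
  unfolding gauss_def using int_quat_in_hurwitz[of _ _ 0 0] by auto

lemma add_subgroup_gauss: "add_subgroup gauss"
proof (rule add_subgroupI)
  show "0 \<in> gauss" by (auto simp: gauss_def zero_quat_def intro!: exI[of _ 0])
  fix x y assume "x \<in> gauss" "y \<in> gauss"
  then obtain u v u' v' where "x = Quat (of_int u) (of_int v) 0 0" "y = Quat (of_int u') (of_int v') 0 0"
    unfolding gauss_def by blast
  then have "x - y = Quat (of_int (u - u')) (of_int (v - v')) 0 0" by (simp add: minus_quat_def)
  then show "x - y \<in> gauss" unfolding gauss_def by blast
qed

lemma column_diff: "column a b (x - y) = column a b x - column a b y"
  and column_add: "column a b (x + y) = column a b x + column a b y"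
  and column_of_int: "column a b (of_int n * x) = of_int n * column a b x"
  and column_uminus: "column a b (- x) = - column a b x"
  by (simp_all add: column_def quat_op_defs of_int_quat algebra_simps)

lemma hurwitz_double_coords:
  assumes "x \<in> hurwitz"
  obtains A B C D :: int where "2 * quat_re x = of_int A" "2 * quat_i x = of_int B"
    "2 * quat_j x = of_int C" "2 * quat_k x = of_int D"
  using assms unfolding hurwitz_iff_half_ints by fastforce

lemma column_gauss:
  assumes "x \<in> hurwitz" shows "column a b x \<in> gauss"
proof -
  obtain A B C D :: int where *: "2 * quat_re x = of_int A" "2 * quat_i x = of_int B"
    "2 * quat_j x = of_int C" "2 * quat_k x = of_int D"
    using hurwitz_double_coords[OF assms] by blast
  have "column a b x = Quat (2 * quat_re x + of_int a * (2 * quat_j x) - of_int b * (2 * quat_k x))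
      (2 * quat_i x + of_int b * (2 * quat_j x) + of_int a * (2 * quat_k x)) 0 0"
    by (simp add: column_def)
  also have "\<dots> = Quat (of_int (A + a * C - b * D)) (of_int (B + b * C + a * D)) 0 0"
    unfolding * by simp
  finally show ?thesis unfolding gauss_def by blast
qed

lemma odd_cancel_two:
  fixes x :: quat
  assumes "add_subgroup H" "odd n" "of_int n * x \<in> H" "of_int 2 * x \<in> H"
  shows "x \<in> H"
proof -
  obtain l where l: "n = 2 * l + 1" using assms(2) by (elim oddE)
  have "x = of_int n * x - of_int l * (of_int 2 * x)" unfolding l by (simp add: algebra_simps mult_2)
  then show ?thesis using add_subgroup_diff[OF assms(1,3) add_subgroup_mult_int[OF assms(1,4)]] by metis
qed

lemma eps_splits_two: "of_int 2 * x = x * eps a b - (x * qi) * eps a b * qi"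
  by (simp add: eps_def quat_op_defs of_int_quat algebra_simps)

text \<open>So \<open>x * eps a b\<close> depends, modulo \<open>n\<close>, only on the first column of \<open>x\<close>.\<close>

lemma column_eps:
  "of_int 2 * (x * eps a b) = column a b x * eps a b
     + of_int (a\<^sup>2 + b\<^sup>2 + 1) * Quat 0 0 (2 * quat_j x) (2 * quat_k x)"
  by (simp add: eps_def column_def quat_op_defs of_int_quat algebra_simps power2_eq_square)

lemma column_mult_qi_qi: "column a b (x * qi * qi) = - column a b x"
  by (simp add: column_def quat_op_defs)

lemma column_mult_qj:
  "column a b (x * qj) = of_int a * column a b x + of_int b * column a b (x * qi)
     - of_int (a\<^sup>2 + b\<^sup>2 + 1) * Quat (2 * quat_j x) (2 * quat_k x) 0 0"
  by (simp add: column_def quat_op_defs of_int_quat algebra_simps power2_eq_square)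

lemma column_gauss_eps:
  assumes "g \<in> gauss"
  shows "column a b (g * eps a b) = of_int 4 * g - of_int (a\<^sup>2 + b\<^sup>2 + 1) * (of_int 2 * g)"
    "column a b (g * eps a b * qi) = of_int (a\<^sup>2 + b\<^sup>2 + 1) * (of_int 2 * (qi * g))"
  using assms unfolding gauss_def
  by (auto simp: column_def eps_def quat_op_defs of_int_quat algebra_simps power2_eq_square)

lemma gauss_mult_qi: "g \<in> gauss \<Longrightarrow> qi * g \<in> gauss"
proof -
  assume "g \<in> gauss"
  then obtain u v :: int where "g = Quat (of_int u) (of_int v) 0 0" unfolding gauss_def by blast
  then have "qi * g = Quat (of_int (- v)) (of_int u) 0 0" by (simp add: times_quat_def)
  then show ?thesis unfolding gauss_def by blast
qed

context
  fixes n a b :: int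
  assumes n: "odd n" "n > 0" and ab: "n dvd a\<^sup>2 + b\<^sup>2 + 1"
begin

private lemma ab_mult:
  obtains k where "a\<^sup>2 + b\<^sup>2 + 1 = n * k"
  using ab by blast

lemma ab_gauss_in_lattice:
  assumes "lattice_mod n L" "g \<in> gauss"
  shows "of_int (a\<^sup>2 + b\<^sup>2 + 1) * g \<in> L"
proof -
  obtain k where k: "a\<^sup>2 + b\<^sup>2 + 1 = n * k" by (rule ab_mult)
  have "of_int (n * k) * g = of_int k * (of_int n * g)"
    by (simp only: mult.commute[of n k] of_int_mult mult.assoc)
  then show ?thesis
    unfolding k using add_subgroup_mult_int[OF lattice_modD(2)[OF assms(1)] lattice_modD(3)[OF assms]] by metis
qed

lemma lattice_mod_column_lattice:
  assumes I: "right_ideal I hurwitz_ring" "of_int n \<in> I"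
  shows "lattice_mod n (column_lattice a b I)"
  unfolding lattice_mod_def
proof (intro conjI ballI)
  have sub: "add_subgroup I" and mult: "\<And>x z. x \<in> I \<Longrightarrow> z \<in> hurwitz \<Longrightarrow> x * z \<in> I"
    using I(1) by (auto simp: right_ideal_hurwitz_iff)
  show "column_lattice a b I \<subseteq> gauss" by (auto simp: column_lattice_def)
  show "add_subgroup (column_lattice a b I)"
    using add_subgroup_zero[OF sub] add_subgroup_zero[OF add_subgroup_gauss]
      add_subgroup_diff[OF sub] add_subgroup_diff[OF add_subgroup_gauss]
    by (intro add_subgroupI) (auto simp: column_lattice_def left_diff_distrib)
  fix g assume g: "g \<in> gauss"
  have "eps a b \<in> hurwitz" unfolding eps_def using int_quat_in_hurwitz[of 1 0 "-a" b] by simp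
  then have "of_int n * (g * eps a b) \<in> I"
    using mult[OF I(2)] g gauss_hurwitz hurwitz_mult by blast
  then show "of_int n * g \<in> column_lattice a b I"
    using g add_subgroup_mult_int[OF add_subgroup_gauss g] by (simp add: column_lattice_def mult.assoc)
qed

text \<open>By \<open>eps_splits_two\<close>, an element \<open>x\<close> is in the right ideal as soon as \<open>x * eps a b\<close> and
\<open>x * i * eps a b\<close> are, and by \<open>column_eps\<close> these only involve the columns of \<open>x\<close>.\<close>

lemma ideal_of_column_lattice:
  assumes I: "right_ideal I hurwitz_ring" "of_int n \<in> I"
  shows "ideal_of_lattice a b (column_lattice a b I) = I"
proof -
  have IH: "I \<subseteq> hurwitz" and sub: "add_subgroup I" and mult: "\<And>x z. x \<in> I \<Longrightarrow> z \<in> hurwitz \<Longrightarrow> x * z \<in> I"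
    using I(1) by (auto simp: right_ideal_hurwitz_iff)
  have epsH: "eps a b \<in> hurwitz" unfolding eps_def using int_quat_in_hurwitz[of 1 0 "-a" b] by simp
  have nI: "of_int n * x \<in> I" if "x \<in> hurwitz" for x using mult[OF I(2) that] .
  have two: "x \<in> I \<longleftrightarrow> of_int 2 * x \<in> I" if "x \<in> hurwitz" for x
    using odd_cancel_two[OF sub n(1) nI[OF that]] add_subgroup_mult_int[OF sub, of x 2] by blast
  have col: "column a b x \<in> column_lattice a b I \<longleftrightarrow> x * eps a b \<in> I" if x: "x \<in> hurwitz" for x
  proof -
    obtain A B C D :: int where coords: "2 * quat_j x = of_int C" "2 * quat_k x = of_int D"
      using hurwitz_double_coords[OF x] by blast
    obtain k where k: "a\<^sup>2 + b\<^sup>2 + 1 = n * k" by (rule ab_mult)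
    define e where "e = of_int (a\<^sup>2 + b\<^sup>2 + 1) * Quat 0 0 (2 * quat_j x) (2 * quat_k x)"
    have "Quat 0 0 (2 * quat_j x) (2 * quat_k x) \<in> hurwitz"
      unfolding coords using int_quat_in_hurwitz[of 0 0 C D] by simp
    then have e: "e \<in> I" unfolding e_def k of_int_mult mult.assoc
      using nI hurwitz_mult hurwitz_of_int by blast
    have eq: "of_int 2 * (x * eps a b) = column a b x * eps a b + e" unfolding e_def by (rule column_eps)
    have "x * eps a b \<in> I \<longleftrightarrow> of_int 2 * (x * eps a b) \<in> I" using two hurwitz_mult[OF x epsH] by blast
    also have "\<dots> \<longleftrightarrow> column a b x * eps a b \<in> I"
      using add_subgroup_diff[OF sub _ e, of "of_int 2 * (x * eps a b)"] add_subgroup_add[OF sub _ e, of "column a b x * eps a b"] eq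
      by auto
    finally show ?thesis using column_gauss[OF x] by (auto simp: column_lattice_def)
  qed
  have "x \<in> I \<longleftrightarrow> x * eps a b \<in> I \<and> x * qi * eps a b \<in> I" if x: "x \<in> hurwitz" for x
  proof
    assume "x \<in> I"
    then show "x * eps a b \<in> I \<and> x * qi * eps a b \<in> I" using mult epsH quat_units_hurwitz(1) by blast
  next
    assume "x * eps a b \<in> I \<and> x * qi * eps a b \<in> I"
    then have "of_int 2 * x \<in> I"
      unfolding eps_splits_two[of x a b] using add_subgroup_diff[OF sub] mult quat_units_hurwitz(1) by blast
    then show "x \<in> I" using two[OF x] by blast
  qed
  then show ?thesis
    unfolding ideal_of_lattice_def using col hurwitz_mult[OF _ quat_units_hurwitz(1)] IH by blast
qed

text \<open>The columns of \<open>x * i\<close> and \<open>x * j\<close> are, modulo \<open>n\<close>, integer combinations of the columns of \<open>x\<close>. For a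
general multiplier \<open>z\<close> this applies to \<open>2 * z\<close>, whose coordinates are integers, and the factor \<open>2\<close> can be
cancelled.\<close>

lemma ideal_of_lattice_properties:
  assumes L: "lattice_mod n L"
  shows "right_ideal (ideal_of_lattice a b L) hurwitz_ring" "of_int n \<in> ideal_of_lattice a b L"
proof -
  have LG: "L \<subseteq> gauss" and sub: "add_subgroup L" and nL: "\<And>g. g \<in> gauss \<Longrightarrow> of_int n * g \<in> L"
    using L by (auto simp: lattice_mod_def)
  define good where "good x \<longleftrightarrow> x \<in> hurwitz \<and> column a b x \<in> L \<and> column a b (x * qi) \<in> L" for x
  have idl: "x \<in> ideal_of_lattice a b L \<longleftrightarrow> good x" for x by (auto simp: ideal_of_lattice_def good_def)
  have diff: "good (x - y)" if "good x" "good y" for x y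
    using that by (auto simp: good_def column_diff left_diff_distrib intro: hurwitz_diff add_subgroup_diff[OF sub])
  have add: "good (x + y)" if "good x" "good y" for x y
    using that by (auto simp: good_def column_add distrib_right intro: hurwitz_add add_subgroup_add[OF sub])
  have int: "good (of_int c * x)" if "good x" for c x
    using that by (auto simp: good_def column_of_int mult.assoc intro: hurwitz_mult hurwitz_of_int add_subgroup_mult_int[OF sub])
  have gi: "good (x * qi)" if "good x" for x
    using that add_subgroup_uminus[OF sub] hurwitz_mult[OF _ quat_units_hurwitz(1)] by (auto simp: good_def column_mult_qi_qi)
  have colj: "column a b (x * qj) \<in> L" if x: "good x" for x
  proof -
    have xH: "x \<in> hurwitz" using x by (simp add: good_def)
    obtain C D :: int where coords: "2 * quat_j x = of_int C" "2 * quat_k x = of_int D"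
      using hurwitz_double_coords[OF xH] by blast
    have "Quat (2 * quat_j x) (2 * quat_k x) 0 0 \<in> gauss" unfolding coords gauss_def by blast
    then have "of_int (a\<^sup>2 + b\<^sup>2 + 1) * Quat (2 * quat_j x) (2 * quat_k x) 0 0 \<in> L"
      by (rule ab_gauss_in_lattice[OF L])
    then show ?thesis
      unfolding column_mult_qj
      using x add_subgroup_mult_int[OF sub] by (auto simp only: good_def intro!: add_subgroup_diff[OF sub] add_subgroup_add[OF sub])
  qed
  have gj: "good (x * qj)" if x: "good x" for x
  proof -
    have "x * qj * qi = - (x * qi * qj)" by (simp add: mult.assoc) (simp add: quat_op_defs)
    then have "column a b (x * qj * qi) = - column a b (x * qi * qj)" by (simp add: column_uminus)
    then have "column a b (x * qj * qi) \<in> L" using colj[OF gi[OF x]] add_subgroup_uminus[OF sub] by simp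
    then show ?thesis using colj[OF x] x hurwitz_mult[OF _ quat_units_hurwitz(2)] by (simp add: good_def)
  qed
  have gk: "good (x * qk)" if x: "good x" for x
  proof -
    have "x * qk = x * qi * qj" by (simp add: mult.assoc) (simp add: quat_op_defs)
    then show ?thesis using gj[OF gi[OF x]] by simp
  qed
  have mult: "good (x * z)" if x: "good x" and z: "z \<in> hurwitz" for x z
  proof -
    have xH: "x \<in> hurwitz" using x by (simp add: good_def)
    have xz: "x * z \<in> hurwitz" using xH z hurwitz_mult by blast
    obtain A B C D :: int where "2 * quat_re z = of_int A" "2 * quat_i z = of_int B"
      "2 * quat_j z = of_int C" "2 * quat_k z = of_int D"
      using hurwitz_double_coords[OF z] by blast
    then have "of_int 2 * z = of_int A + of_int B * qi + of_int C * qj + of_int D * qk"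
      by (intro quat.expand) (simp add: times_quat_def)
    then have "of_int 2 * (x * z) = of_int A * x + of_int B * (x * qi) + of_int C * (x * qj) + of_int D * (x * qk)"
      by (simp only: of_int_quat_left_commute[symmetric] distrib_left) (simp only: of_int_quat_commute of_int_quat_left_commute)
    then have "good (of_int 2 * (x * z))" using x by (simp only: add int gi gj gk)
    then have 2: "of_int 2 * column a b (x * z) \<in> L" "of_int 2 * column a b (x * z * qi) \<in> L"
      by (simp_all only: good_def column_of_int mult.assoc)
    have "column a b (x * z) \<in> L"
      by (rule odd_cancel_two[OF sub n(1) nL[OF column_gauss[OF xz]] 2(1)])
    moreover have "column a b (x * z * qi) \<in> L"
      by (rule odd_cancel_two[OF sub n(1) nL[OF column_gauss[OF hurwitz_mult[OF xz quat_units_hurwitz(1)]]] 2(2)])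
    ultimately show ?thesis using xz by (simp add: good_def)
  qed
  have "good 0" using add_subgroup_zero[OF sub] by (simp add: good_def hurwitz_0 column_def zero_quat_def[symmetric])
  then show "right_ideal (ideal_of_lattice a b L) hurwitz_ring"
    unfolding right_ideal_hurwitz_iff add_subgroup_def Ball_def idl subset_iff
    using diff mult by (simp add: good_def)
  have "column a b (of_int n * x) \<in> L" if "x \<in> hurwitz" for x
    unfolding column_of_int by (rule nL[OF column_gauss[OF that]])
  from this[OF hurwitz_1] this[OF quat_units_hurwitz(1)] show "of_int n \<in> ideal_of_lattice a b L"
    unfolding idl good_def using hurwitz_of_int by simp
qed

lemma eps_mult_in_ideal_of_lattice_iff:
  assumes L: "lattice_mod n L" and g: "g \<in> gauss"
  shows "g * eps a b \<in> ideal_of_lattice a b L \<longleftrightarrow> g \<in> L"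
proof -
  have LG: "L \<subseteq> gauss" and sub: "add_subgroup L" and nL: "\<And>g. g \<in> gauss \<Longrightarrow> of_int n * g \<in> L"
    using L by (auto simp: lattice_mod_def)
  have G2: "of_int c * h \<in> gauss" if "h \<in> gauss" for c h
    using add_subgroup_mult_int[OF add_subgroup_gauss that] .
  have "eps a b \<in> hurwitz" unfolding eps_def using int_quat_in_hurwitz[of 1 0 "-a" b] by simp
  then have H: "g * eps a b \<in> hurwitz" using g gauss_hurwitz hurwitz_mult by blast
  have s: "of_int (a\<^sup>2 + b\<^sup>2 + 1) * (of_int 2 * h) \<in> L" if "h \<in> gauss" for h
    by (rule ab_gauss_in_lattice[OF L G2[OF that]])
  have "g * eps a b \<in> ideal_of_lattice a b L \<longleftrightarrow> of_int 4 * g - of_int (a\<^sup>2 + b\<^sup>2 + 1) * (of_int 2 * g) \<in> L"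
    using H s[OF gauss_mult_qi[OF g]] by (simp add: ideal_of_lattice_def column_gauss_eps[OF g])
  also have "\<dots> \<longleftrightarrow> of_int 4 * g \<in> L"
    using add_subgroup_diff[OF sub _ s[OF g], of "of_int 4 * g"]
      add_subgroup_add[OF sub _ s[OF g], of "of_int 4 * g - of_int (a\<^sup>2 + b\<^sup>2 + 1) * (of_int 2 * g)"] by auto
  also have "\<dots> \<longleftrightarrow> g \<in> L"
  proof
    assume "of_int 4 * g \<in> L"
    then have "of_int 2 * (of_int 2 * g) \<in> L" by (simp only: mult.assoc[symmetric] of_int_mult[symmetric]) simp
    then have "of_int 2 * g \<in> L" by (rule odd_cancel_two[OF sub n(1) nL[OF G2[OF g]]])
    then show "g \<in> L" by (rule odd_cancel_two[OF sub n(1) nL[OF g]])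
  qed (rule add_subgroup_mult_int[OF sub])
  finally show ?thesis .
qed

lemma column_lattice_ideal_of:
  assumes L: "lattice_mod n L"
  shows "column_lattice a b (ideal_of_lattice a b L) = L"
  unfolding column_lattice_def using eps_mult_in_ideal_of_lattice_iff[OF L] lattice_modD(1)[OF L] by blast

text \<open>The two columns of a matrix are arbitrary and independent of each other, which makes the quotient a
product of two copies of \<open>gauss\<close> modulo \<open>L\<close>.\<close>

lemma idx_ideal_of_lattice:
  assumes L: "lattice_mod n L"
  shows "idx hurwitz (ideal_of_lattice a b L) = (idx gauss L)\<^sup>2"
proof -
  have LG: "L \<subseteq> gauss" and sub: "add_subgroup L" and nL: "\<And>g. g \<in> gauss \<Longrightarrow> of_int n * g \<in> L"
    using L by (auto simp: lattice_mod_def)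
  have epsH: "eps a b \<in> hurwitz" unfolding eps_def using int_quat_in_hurwitz[of 1 0 "-a" b] by simp
  define f where "f x = ((+) (column a b x) ` L, (+) (column a b (x * qi)) ` L)" for x
  have subI: "add_subgroup (ideal_of_lattice a b L)"
    using ideal_of_lattice_properties(1)[OF L] by (simp add: right_ideal_hurwitz_iff)
  have "idx hurwitz (ideal_of_lattice a b L) = card (f ` hurwitz)"
  proof (rule idx_eq_card_image[OF subI])
    fix x y assume "x \<in> hurwitz" "y \<in> hurwitz"
    then show "f x = f y \<longleftrightarrow> x - y \<in> ideal_of_lattice a b L"
      by (simp add: f_def translate_eq_iff[OF sub] ideal_of_lattice_def column_diff left_diff_distrib hurwitz_diff)
  qed
  also have "f ` hurwitz = ((\<lambda>x. (+) x ` L) ` gauss) \<times> ((\<lambda>x. (+) x ` L) ` gauss)"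
  proof
    show "f ` hurwitz \<subseteq> ((\<lambda>x. (+) x ` L) ` gauss) \<times> ((\<lambda>x. (+) x ` L) ` gauss)"
      using column_gauss hurwitz_mult[OF _ quat_units_hurwitz(1)] by (auto simp: f_def)
    show "((\<lambda>x. (+) x ` L) ` gauss) \<times> ((\<lambda>x. (+) x ` L) ` gauss) \<subseteq> f ` hurwitz"
    proof safe
      fix p q assume p: "p \<in> gauss" and q: "q \<in> gauss"
      have "coprime (2 * 2 :: int) n" using n(1) by (auto simp only: coprime_mult_left_iff coprime_left_2_iff_odd)
      then have "coprime (4 :: int) n" by simp
      then obtain h k where hk: "h * 4 + k * n = 1" by (metis bezout_int coprime_imp_gcd_eq_1)
      obtain k' where k': "a\<^sup>2 + b\<^sup>2 + 1 = n * k'" by (rule ab_mult)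
      have G: "of_int c * g \<in> gauss" if "g \<in> gauss" for c g
        using add_subgroup_mult_int[OF add_subgroup_gauss that] .
      \<comment> \<open>As \<open>h\<close> inverts \<open>4\<close> modulo \<open>n\<close>, the columns of this quaternion are \<open>p\<close> and \<open>q\<close> by \<open>column_gauss_eps\<close>.\<close>
      define x where "x = of_int h * (p * eps a b) - of_int h * (q * eps a b * qi)"
      have xH: "x \<in> hurwitz"
        unfolding x_def using p q gauss_hurwitz epsH quat_units_hurwitz(1)
        by (intro hurwitz_diff hurwitz_mult hurwitz_of_int) auto
      have L4: "of_int h * (of_int 4 * g - of_int (n * k') * (of_int 2 * g)) - g \<in> L" if "g \<in> gauss" for g
      proof -
        have h4: "h * 4 = 1 - n * k" using hk by (simp add: algebra_simps)
        have e: "of_int h * (of_int 4 * g) = of_int (h * 4) * g"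
          "of_int h * (of_int (n * k') * (of_int 2 * g)) = of_int (h * (n * k' * 2)) * g"
          by (simp_all only: of_int_mult mult.assoc)
        have "of_int h * (of_int 4 * g - of_int (n * k') * (of_int 2 * g)) = of_int (h * 4 - h * (n * k' * 2)) * g"
          by (simp only: right_diff_distrib e of_int_diff left_diff_distrib)
        also have "h * 4 - h * (n * k' * 2) = 1 + n * (- k - 2 * k' * h)"
          unfolding h4 by (simp add: algebra_simps)
        also have "of_int (1 + n * (- k - 2 * k' * h)) * g = g + of_int n * (of_int (- k - 2 * k' * h) * g)"
          by (simp only: of_int_add of_int_1 of_int_mult distrib_right mult_1_left mult.assoc)
        finally have eq: "of_int h * (of_int 4 * g - of_int (n * k') * (of_int 2 * g)) = \<dots>" .
        show ?thesis unfolding eq add_diff_cancel_left' by (rule nL[OF G[OF that]])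
      qed
      have Ls: "of_int h * (of_int (n * k') * (of_int 2 * g)) \<in> L" if "g \<in> gauss" for g
        using ab_gauss_in_lattice[OF L G[OF that]] unfolding k' by (rule add_subgroup_mult_int[OF sub])
      have eq1: "column a b x - p = (of_int h * (of_int 4 * p - of_int (n * k') * (of_int 2 * p)) - p)
          - of_int h * (of_int (n * k') * (of_int 2 * (qi * q)))"
        unfolding x_def column_diff column_of_int column_gauss_eps[OF p] column_gauss_eps[OF q] k' by simp
      have 1: "column a b x - p \<in> L"
        unfolding eq1 by (rule add_subgroup_diff[OF sub L4[OF p] Ls[OF gauss_mult_qi[OF q]]])
      have "x * qi = of_int h * (p * eps a b * qi) - of_int h * (q * eps a b * qi * qi)"
        by (simp add: x_def left_diff_distrib mult.assoc)
      then have eq2: "column a b (x * qi) - q = of_int h * (of_int (n * k') * (of_int 2 * (qi * p)))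
          + (of_int h * (of_int 4 * q - of_int (n * k') * (of_int 2 * q)) - q)"
        by (simp only: column_diff column_of_int column_gauss_eps[OF p] column_gauss_eps[OF q] column_mult_qi_qi k') (simp add: right_diff_distrib)
      have 2: "column a b (x * qi) - q \<in> L"
        unfolding eq2 by (rule add_subgroup_add[OF sub Ls[OF gauss_mult_qi[OF p]] L4[OF q]])
      have "f x = ((+) p ` L, (+) q ` L)" using 1 2 by (simp add: f_def translate_eq_iff[OF sub])
      then show "((+) p ` L, (+) q ` L) \<in> f ` hurwitz" using xH by (metis image_eqI)
    qed
  qed
  finally show ?thesis by (simp add: card_cartesian_product idx_def power2_eq_square)
qed

end

subsection \<open>Sublattices of the square lattice\<close>

text \<open>The lattice with basis \<open>(d, 0)\<close>, \<open>(r, e)\<close>; for \<open>r < d\<close> this is its Hermite normal form.\<close>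

definition hnf :: "nat \<Rightarrow> nat \<Rightarrow> nat \<Rightarrow> quat set" where
  "hnf d e r = {Quat (of_int (int d * s + int r * t)) (of_int (int e * t)) 0 0 | s t. True}"

lemma hnf_iff:
  assumes "e > 0"
  shows "Quat (of_int u) (of_int v) 0 0 \<in> hnf d e r \<longleftrightarrow> int e dvd v \<and> int d dvd u - int r * (v div int e)"
proof
  assume "Quat (of_int u) (of_int v) 0 0 \<in> hnf d e r"
  then obtain s t where "u = int d * s + int r * t" "v = int e * t" unfolding hnf_def by (auto simp flip: of_int_mult of_int_add)
  then show "int e dvd v \<and> int d dvd u - int r * (v div int e)" using assms by simp
next
  assume *: "int e dvd v \<and> int d dvd u - int r * (v div int e)"
  then obtain t s where "v = int e * t" "u - int r * (v div int e) = int d * s" by blast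
  then have "v = int e * t" "u = int d * s + int r * t" using assms by auto
  then show "Quat (of_int u) (of_int v) 0 0 \<in> hnf d e r" unfolding hnf_def by blast
qed

lemma hnf_subset_gauss: "hnf d e r \<subseteq> gauss"
  unfolding hnf_def gauss_def by blast

lemma add_subgroup_hnf: "add_subgroup (hnf d e r)"
proof (rule add_subgroupI)
  have "0 = Quat (of_int (int d * 0 + int r * 0)) (of_int (int e * 0)) 0 0" by (simp add: zero_quat_def)
  then show "0 \<in> hnf d e r" unfolding hnf_def by blast
  fix x y assume "x \<in> hnf d e r" "y \<in> hnf d e r"
  then obtain s t s' t' where "x = Quat (of_int (int d * s + int r * t)) (of_int (int e * t)) 0 0"
    "y = Quat (of_int (int d * s' + int r * t')) (of_int (int e * t')) 0 0" unfolding hnf_def by blast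
  then have "x - y = Quat (of_int (int d * (s - s') + int r * (t - t'))) (of_int (int e * (t - t'))) 0 0"
    by (simp add: minus_quat_def algebra_simps)
  then show "x - y \<in> hnf d e r" unfolding hnf_def by blast
qed

lemma int_mult_gauss:
  "of_int c * Quat (of_int u) (of_int v) 0 0 = Quat (of_int (c * u)) (of_int (c * v)) 0 0"
  by (simp add: times_quat_def)

lemma lattice_mod_hnf: "lattice_mod (int (d * e)) (hnf d e r)"
  unfolding lattice_mod_def
proof (intro conjI ballI hnf_subset_gauss add_subgroup_hnf)
  fix g assume "g \<in> gauss"
  then obtain u v where g: "g = Quat (of_int u) (of_int v) 0 0" unfolding gauss_def by blast
  have "of_int (int (d * e)) * g = Quat (of_int (int (d * e) * u)) (of_int (int (d * e) * v)) 0 0"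
    unfolding g by (rule int_mult_gauss)
  also have "\<dots> = Quat (of_int (int d * (int e * u - int r * v) + int r * (int d * v))) (of_int (int e * (int d * v))) 0 0"
    by (simp add: algebra_simps)
  finally show "of_int (int (d * e)) * g \<in> hnf d e r" unfolding hnf_def by blast
qed

lemma idx_hnf:
  assumes "d > 0" "e > 0"
  shows "idx gauss (hnf d e r) = d * e"
proof -
  define f where "f x = (let u = \<lfloor>quat_re x\<rfloor>; v = \<lfloor>quat_i x\<rfloor> in (v mod int e, (u - int r * (v div int e)) mod int d))" for x
  have f: "f (Quat (of_int u) (of_int v) 0 0) = (v mod int e, (u - int r * (v div int e)) mod int d)" for u v
    by (simp add: f_def)
  have "idx gauss (hnf d e r) = card (f ` gauss)"
  proof (rule idx_eq_card_image[OF add_subgroup_hnf])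
    fix x y assume "x \<in> gauss" "y \<in> gauss"
    then obtain u v u' v' where xy: "x = Quat (of_int u) (of_int v) 0 0" "y = Quat (of_int u') (of_int v') 0 0"
      unfolding gauss_def by blast
    have diff: "x - y = Quat (of_int (u - u')) (of_int (v - v')) 0 0" by (simp add: xy minus_quat_def)
    have "f x = f y \<longleftrightarrow> int e dvd v - v' \<and> int d dvd (u - int r * (v div int e)) - (u' - int r * (v' div int e))"
      unfolding xy f by (simp only: prod.inject mod_eq_dvd_iff)
    also have "\<dots> \<longleftrightarrow> int e dvd v - v' \<and> int d dvd (u - u') - int r * ((v - v') div int e)"
    proof -
      have "(u - int r * (v div int e)) - (u' - int r * (v' div int e)) = (u - u') - int r * ((v - v') div int e)" if dv: "int e dvd v - v'"
      proof -
        obtain k where "v - v' = int e * k" using dv by blast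
        then have "v = v' + int e * k" by simp
        then have div: "(v - v') div int e = v div int e - v' div int e" using assms(2) by simp
        show ?thesis unfolding div by (simp add: algebra_simps)
      qed
      then show ?thesis by metis
    qed
    finally show "f x = f y \<longleftrightarrow> x - y \<in> hnf d e r" unfolding diff hnf_iff[OF assms(2)] .
  qed
  also have "f ` gauss = {0..<int e} \<times> {0..<int d}"
  proof
    show "f ` gauss \<subseteq> {0..<int e} \<times> {0..<int d}" unfolding gauss_def using assms by (auto simp: f)
    show "{0..<int e} \<times> {0..<int d} \<subseteq> f ` gauss"
    proof
      fix z assume "z \<in> {0..<int e} \<times> {0..<int d}"
      then obtain v u where "z = (v, u)" "0 \<le> v" "v < int e" "0 \<le> u" "u < int d" by auto
      then have "z = f (Quat (of_int u) (of_int v) 0 0)" by (simp add: f)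
      then show "z \<in> f ` gauss" unfolding gauss_def by blast
    qed
  qed
  finally show ?thesis by (simp add: card_cartesian_product)
qed

lemma hnf_inj:
  assumes "d > 0" "e > 0" "d' > 0" "e' > 0" "r < d" "r' < d'" "hnf d e r = hnf d' e' r'"
  shows "d = d' \<and> e = e' \<and> r = r'"
proof -
  have basis: "Quat (of_int (int d)) (of_int 0) 0 0 \<in> hnf d e r" "Quat (of_int (int r)) (of_int (int e)) 0 0 \<in> hnf d e r"
    if "e > 0" for d e r using that by (simp_all only: hnf_iff) simp_all
  have dvd: "int d' dvd int d \<and> int e' dvd int e" if "e > 0" "e' > 0" "hnf d e r = hnf d' e' r'" for d e r d' e' r'
    using basis[where d = d and r = r, OF that(1)] that(3) by (simp only: hnf_iff[OF that(2)]) simp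
  have de: "d = d'" "e = e'"
    using dvd[OF assms(2,4,7)] dvd[OF assms(4,2) assms(7)[symmetric]] by (simp_all add: dvd_antisym)
  have "Quat (of_int (int r)) (of_int (int e)) 0 0 \<in> hnf d' e' r'"
    using basis(2)[where d = d and r = r, OF assms(2)] unfolding assms(7) .
  then have "int d' dvd int r - int r' * (int e div int e')" by (simp only: hnf_iff[OF assms(4)])
  then have "int d dvd int r - int r'" using de assms(2) by simp
  then have "int r mod int d = int r' mod int d" by (simp add: mod_eq_dvd_iff)
  then show ?thesis using de assms(5,6) by simp
qed

lemma int_subgroup_principal:
  fixes H :: "int set"
  assumes "add_subgroup H" "n \<in> H" "n > 0"
  shows "\<exists>e>0. H = {int e * t | t. True}"
proof -
  define e where "e = (LEAST k. k > 0 \<and> int k \<in> H)"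
  have "nat n > 0 \<and> int (nat n) \<in> H" using assms by simp
  then have e: "e > 0" "int e \<in> H" unfolding e_def by (metis (mono_tags, lifting) LeastI)+
  have min: "e \<le> k" if "k > 0" "int k \<in> H" for k unfolding e_def using that by (simp add: Least_le)
  have mult: "c * x \<in> H" if "x \<in> H" for c x
  proof -
    have nat: "int k * x \<in> H" for k
      by (induction k) (auto simp: add_subgroup_zero[OF assms(1)] distrib_right that intro: add_subgroup_add[OF assms(1)])
    show ?thesis
    proof (cases "c \<ge> 0")
      case True then show ?thesis using nat[of "nat c"] by simp
    next
      case False then show ?thesis using add_subgroup_uminus[OF assms(1) nat[of "nat (- c)"]] by simp
    qed
  qed
  have "H = {int e * t | t. True}"
  proof
    show "{int e * t | t. True} \<subseteq> H" using mult[OF e(2)] by (auto simp: mult.commute)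
    show "H \<subseteq> {int e * t | t. True}"
    proof
      fix x assume x: "x \<in> H"
      have "x mod int e = x - (x div int e) * int e" by (simp add: minus_div_mult_eq_mod)
      then have "x mod int e \<in> H" using add_subgroup_diff[OF assms(1) x mult[OF e(2)]] by metis
      moreover have "0 \<le> x mod int e" "x mod int e < int e" using e(1) by auto
      ultimately have "x mod int e = 0" using min[of "nat (x mod int e)"] by (cases "x mod int e = 0") auto
      then show "x \<in> {int e * t | t. True}" by (auto elim!: dvdE simp: dvd_eq_mod_eq_0[symmetric])
    qed
  qed
  then show ?thesis using e(1) by blast
qed

text \<open>The second coordinates of the points of \<open>L\<close> form a subgroup of \<open>\<int>\<close>, generated by \<open>e\<close>, and the points on
the first axis form another one, generated by \<open>d\<close>. A point above \<open>e\<close> can be moved along the axis until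
its first coordinate \<open>r\<close> is less than \<open>d\<close>.\<close>

lemma lattice_mod_eq_hnf:
  assumes L: "lattice_mod n L" and n: "n > 0"
  shows "\<exists>d e r. d > 0 \<and> e > 0 \<and> r < d \<and> L = hnf d e r"
proof -
  have LG: "L \<subseteq> gauss" and sub: "add_subgroup L" and nL: "\<And>g. g \<in> gauss \<Longrightarrow> of_int n * g \<in> L"
    using L by (auto simp: lattice_mod_def)
  define P where "P u v \<longleftrightarrow> Quat (of_int u) (of_int v) 0 0 \<in> L" for u v :: int
  have P_diff: "P (u - u') (v - v')" if "P u v" "P u' v'" for u v u' v'
    using add_subgroup_diff[OF sub] that unfolding P_def by (fastforce simp: minus_quat_def)
  have P0: "P 0 0" using add_subgroup_zero[OF sub] by (simp add: P_def zero_quat_def)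
  have n0: "P n 0" "P 0 n"
    using nL[of "Quat (of_int 1) (of_int 0) 0 0"] nL[of "Quat (of_int 0) (of_int 1) 0 0"]
    unfolding P_def gauss_def by (auto simp: times_quat_def)
  have "add_subgroup {v. \<exists>u. P u v}"
  proof (rule add_subgroupI)
    show "0 \<in> {v. \<exists>u. P u v}" using P0 by blast
    show "x - y \<in> {v. \<exists>u. P u v}" if "x \<in> {v. \<exists>u. P u v}" "y \<in> {v. \<exists>u. P u v}" for x y
      using that P_diff by blast
  qed
  then obtain e where e: "e > 0" "{v. \<exists>u. P u v} = {int e * t | t. True}"
    using int_subgroup_principal[of _ n] n0(2) n by blast
  have "add_subgroup {u. P u 0}"
  proof (rule add_subgroupI)
    show "0 \<in> {u. P u 0}" using P0 by blast
    show "x - y \<in> {u. P u 0}" if "x \<in> {u. P u 0}" "y \<in> {u. P u 0}" for x y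
      using that P_diff[of x 0 y 0] by simp
  qed
  then obtain d where d: "d > 0" "{u. P u 0} = {int d * t | t. True}"
    using int_subgroup_principal[of _ n] n0(1) n by blast
  have "int e = int e * 1" by simp
  then have "int e \<in> {v. \<exists>u. P u v}" unfolding e(2) by blast
  then obtain u0 where u0: "P u0 (int e)" by blast
  have P_mult: "P (c * u) (c * v)" if "P u v" for c u v
    using add_subgroup_mult_int[OF sub that[unfolded P_def], of c]
    by (simp add: P_def times_quat_def)
  have P_d: "P (int d * s) 0" for s using d(2) by blast
  define q where "q = u0 div int d"
  define r where "r = nat (u0 mod int d)"
  have r: "u0 = int d * q + int r" "r < d"
    using d(1) by (simp_all add: q_def r_def nat_less_iff)
  have P_iff: "P u v \<longleftrightarrow> (\<exists>s t. u = int d * s + int r * t \<and> v = int e * t)" for u v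
  proof
    assume uv: "P u v"
    then obtain t where t: "v = int e * t" using e(2) by blast
    have "P (u - t * u0) (v - t * int e)" using P_diff[OF uv P_mult[OF u0]] .
    then have "u - t * u0 \<in> {u. P u 0}" by (simp add: t mult.commute)
    then obtain s where "u - t * u0 = int d * s" using d(2) by blast
    then have "u = int d * (s + q * t) + int r * t" by (simp add: r(1) algebra_simps)
    then show "\<exists>s t. u = int d * s + int r * t \<and> v = int e * t" using t by blast
  next
    assume "\<exists>s t. u = int d * s + int r * t \<and> v = int e * t"
    then obtain s t where st: "u = int d * s + int r * t" "v = int e * t" by blast
    have "P (t * u0 - int d * (q * t - s)) (t * int e - 0)" by (rule P_diff[OF P_mult[OF u0] P_d])
    then show "P u v" by (simp add: st r(1) algebra_simps)
  qed
  have "L = hnf d e r"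
  proof
    show "L \<subseteq> hnf d e r"
    proof
      fix x assume x: "x \<in> L"
      then obtain u v :: int where uv: "x = Quat (of_int u) (of_int v) 0 0" using LG unfolding gauss_def by blast
      then have "P u v" using x by (simp add: P_def)
      then show "x \<in> hnf d e r" unfolding P_iff uv hnf_def by blast
    qed
    show "hnf d e r \<subseteq> L"
    proof
      fix x assume "x \<in> hnf d e r"
      then obtain s t where x: "x = Quat (of_int (int d * s + int r * t)) (of_int (int e * t)) 0 0"
        unfolding hnf_def by blast
      have "P (int d * s + int r * t) (int e * t)" unfolding P_iff by blast
      then show "x \<in> L" unfolding x P_def .
    qed
  qed
  then show ?thesis using d(1) e(1) r(2) by blast
qed

subsection \<open>The number of right ideals\<close>

definition hnf_triples :: "nat \<Rightarrow> (nat \<times> nat \<times> nat) set" where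
  "hnf_triples m = {(d, e, r). d * e = m \<and> r < d}"

text \<open>The maps \<open>ideal_of_lattice a b\<close> and \<open>column_lattice a b\<close> are inverse to each other. The index of an
ideal is the square of its norm and also the square of the index of its lattice, so the norm is
the index of the lattice.\<close>

lemma ideals_of_odd_norm_bij:
  assumes "odd m"
  shows "\<exists>f. bij_betw f (hnf_triples m) {I \<in> nonzero_right_ideals. ideal_norm I = m}"
proof -
  obtain a b :: int where ab: "int m dvd a\<^sup>2 + b\<^sup>2 + 1" using two_squares_plus_one[OF assms] by blast
  have m: "odd (int m)" "int m > 0" using assms by (auto intro: odd_pos)
  define f where "f = (\<lambda>(d, e, r). ideal_of_lattice a b (hnf d e r))"
  have lat: "lattice_mod (int m) (hnf d e r)" "d > 0" "e > 0" "r < d" if "(d, e, r) \<in> hnf_triples m" for d e r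
    using that m lattice_mod_hnf[of d e r] by (auto simp: hnf_triples_def intro: Nat.gr0I)
  have "bij_betw f (hnf_triples m) {I \<in> nonzero_right_ideals. ideal_norm I = m}"
    unfolding bij_betw_def
  proof
    show "inj_on f (hnf_triples m)"
    proof (rule inj_onI)
      fix x y assume xy: "x \<in> hnf_triples m" "y \<in> hnf_triples m" "f x = f y"
      obtain d e r d' e' r' where x: "x = (d, e, r)" and y: "y = (d', e', r')" by (metis prod_cases3)
      note l = lat[OF xy(1)[unfolded x]] and l' = lat[OF xy(2)[unfolded y]]
      have eq: "ideal_of_lattice a b (hnf d e r) = ideal_of_lattice a b (hnf d' e' r')"
        using xy(3) by (simp add: f_def x y)
      have "hnf d e r = hnf d' e' r'"
        by (rule trans[OF column_lattice_ideal_of[OF m ab l(1), unfolded eq, symmetric]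
              column_lattice_ideal_of[OF m ab l'(1)]])
      then show "x = y"
        using hnf_inj[OF l(2,3) l'(2,3) l(4) l'(4)] by (simp add: x y)
    qed
    show "f ` hnf_triples m = {I \<in> nonzero_right_ideals. ideal_norm I = m}"
    proof
      show "f ` hnf_triples m \<subseteq> {I \<in> nonzero_right_ideals. ideal_norm I = m}"
      proof
        fix I assume "I \<in> f ` hnf_triples m"
        then obtain d e r where t: "(d, e, r) \<in> hnf_triples m" and I: "I = ideal_of_lattice a b (hnf d e r)"
          by (auto simp: f_def)
        note l = lat[OF t]
        have "right_ideal I hurwitz_ring" "of_int (int m) \<in> I"
          unfolding I by (rule ideal_of_lattice_properties[OF m ab l(1)])+
        moreover have "of_int (int m) \<noteq> (0 :: quat)" using m(2) by simp
        ultimately have IN: "I \<in> nonzero_right_ideals" unfolding nonzero_right_ideals_def by blast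
        have "(ideal_norm I)\<^sup>2 = m\<^sup>2"
          using ideal_index_eq_norm_square[OF IN] idx_ideal_of_lattice[OF m ab l(1)] idx_hnf[OF l(2,3)] t
          by (simp add: ideal_index_eq_idx I hnf_triples_def)
        then show "I \<in> {I \<in> nonzero_right_ideals. ideal_norm I = m}" using IN by simp
      qed
      show "{I \<in> nonzero_right_ideals. ideal_norm I = m} \<subseteq> f ` hnf_triples m"
      proof clarify
        fix I assume I: "I \<in> nonzero_right_ideals" and norm: "m = ideal_norm I"
        then obtain q where q: "q \<in> hurwitz" "q \<noteq> 0" "I = rspan q" unfolding nonzero_right_ideals_eq by blast
        have "hnorm q = m" using norm ideal_norm_rspan[OF q(1,2)] q(3) by simp
        then have mI: "of_int (int m) \<in> I" using hnorm_in_rspan[OF q(1)] q(3) by simp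
        have ri: "right_ideal I hurwitz_ring" using I by (simp add: nonzero_right_ideals_def)
        have L: "lattice_mod (int m) (column_lattice a b I)" by (rule lattice_mod_column_lattice[OF m ab ri mI])
        obtain d e r where der: "d > 0" "e > 0" "r < d" "column_lattice a b I = hnf d e r"
          using lattice_mod_eq_hnf[OF L m(2)] by blast
        have I': "ideal_of_lattice a b (hnf d e r) = I"
          using ideal_of_column_lattice[OF m ab ri mI] der(4) by simp
        have "m\<^sup>2 = (d * e)\<^sup>2"
          using ideal_index_eq_norm_square[OF I] idx_ideal_of_lattice[OF m ab L] idx_hnf[OF der(1,2)] norm der(4) I'
          by (simp add: ideal_index_eq_idx)
        then have "d * e = m" by simp
        then have "(d, e, r) \<in> hnf_triples m" using der(3) by (simp add: hnf_triples_def)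
        then show "I \<in> f ` hnf_triples (ideal_norm I)"
          using I' norm by (auto simp: f_def intro!: image_eqI[of _ _ "(d, e, r)"])
      qed
    qed
  qed
  then show ?thesis by blast
qed

lemma finite_hnf_triples: "m > 0 \<Longrightarrow> finite (hnf_triples m)"
proof (rule finite_subset)
  assume "m > 0"
  then show "hnf_triples m \<subseteq> {..m} \<times> {..m} \<times> {..m}"
    by (auto simp: hnf_triples_def) (metis less_imp_le_nat mult_le_cancel1 nat_le_linear le_trans mult.right_neutral One_nat_def Suc_leI gr0I mult_0_right)
qed auto

text \<open>The ideal of the lattice \<open>hnf 1 m 0\<close>, which has a cyclic quotient, contains \<open>eps a b\<close>. An integer that
divides a generator divides \<open>eps a b\<close>, whose trace is \<open>2\<close>; being odd, it is a unit.\<close>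

lemma ex_reduced_of_odd_norm:
  assumes "odd m" shows "\<exists>q. reduced q \<and> hnorm q = m"
proof -
  obtain a b :: int where ab: "int m dvd a\<^sup>2 + b\<^sup>2 + 1" using two_squares_plus_one[OF assms] by blast
  have m: "odd (int m)" "int m > 0" using assms by (auto intro: odd_pos)
  define I where "I = ideal_of_lattice a b (hnf 1 m 0)"
  have L: "lattice_mod (int m) (hnf 1 m 0)" using lattice_mod_hnf[of 1 m 0] by simp
  have "right_ideal I hurwitz_ring" and mI: "of_int (int m) \<in> I"
    unfolding I_def by (rule ideal_of_lattice_properties[OF m ab L])+
  moreover have "of_int (int m) \<noteq> (0 :: quat)" using m(2) by simp
  ultimately obtain q where q: "q \<in> hurwitz" "q \<noteq> 0" "I = rspan q"
    using right_ideal_principal by blast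
  have "(hnorm q)\<^sup>2 = m\<^sup>2"
    using idx_rspan[OF q(1,2)] idx_ideal_of_lattice[OF m ab L] idx_hnf[of 1 m 0] m(2) q(3) by (simp add: I_def)
  then have norm: "hnorm q = m" by simp
  have "Quat (of_int 1) (of_int 0) 0 0 \<in> hnf 1 m 0" using m(2) by (subst hnf_iff) auto
  then have "Quat (of_int 1) (of_int 0) 0 0 * eps a b \<in> I"
    unfolding I_def using eps_mult_in_ideal_of_lattice_iff[OF m ab L] hnf_subset_gauss by blast
  then have "eps a b \<in> I" by (simp add: one_quat_def[symmetric])
  then obtain z where z: "z \<in> hurwitz" "eps a b = q * z" using q(3) by (auto simp: mem_rspan_iff)
  have "\<bar>c\<bar> = 1" if x: "x \<in> hurwitz" and qx: "q = of_int c * x" for c x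
  proof -
    obtain t :: int where t: "2 * quat_re (x * z) = of_int t" using hurwitz_trace[OF hurwitz_mult[OF x z(1)]] by blast
    have "(2 :: rat) = 2 * quat_re (eps a b)" by (simp add: eps_def)
    also have "\<dots> = of_int c * (2 * quat_re (x * z))" unfolding z(2) qx mult.assoc by (simp add: times_quat_def[of "of_int c"])
    finally have "of_int 2 = (of_int (c * t) :: rat)" unfolding t by simp
    then have "2 = c * t" by (simp only: of_int_eq_iff)
    then have "c dvd 2" by (metis dvd_triv_left)
    have "hnorm q = nat (c\<^sup>2) * hnorm x" using hnorm_mult[OF hurwitz_of_int x] qx by (simp add: hnorm_of_int)
    then have "odd c" using norm assms by (auto simp: even_nat_iff)
    have "c \<le> 2" "- c \<le> 2" using \<open>c dvd 2\<close> zdvd_imp_le[of c 2] zdvd_imp_le[of "-c" 2] by auto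
    then have "c \<in> {-2, -1, 0, 1, 2}" by auto
    then show ?thesis using \<open>odd c\<close> by auto
  qed
  then have "reduced q" using q(1) norm assms by (simp add: reduced_def)
  then show ?thesis using norm by blast
qed

section \<open>Dirichlet series\<close>

lemma has_sum_mult_Times:
  fixes f g :: "_ \<Rightarrow> complex"
  assumes f: "(f has_sum a) A" and g: "(g has_sum b) B"
  shows "((\<lambda>(x, y). f x * g y) has_sum (a * b)) (A \<times> B)"
proof (rule has_sum_SigmaI)
  show "((\<lambda>y. case (x, y) of (x, y) \<Rightarrow> f x * g y) has_sum (f x * b)) B" for x
    using has_sum_cmult_right[OF g, of "f x"] by simp
  show "((\<lambda>x. f x * b) has_sum (a * b)) A"
    by (rule has_sum_cmult_left[OF f])
  have nf: "(\<lambda>x. norm (f x)) summable_on A" and ng: "(\<lambda>y. norm (g y)) summable_on B"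
    using f g by (auto simp: has_sum_imp_summable simp flip: summable_on_iff_abs_summable_on_complex)
  have "(\<lambda>(x, y). norm (f x) * norm (g y)) summable_on A \<times> B"
  proof (rule summable_on_SigmaI)
    show "((\<lambda>y. case (x, y) of (x, y) \<Rightarrow> norm (f x) * norm (g y)) has_sum norm (f x) * infsum (\<lambda>y. norm (g y)) B) B" for x
      using has_sum_cmult_right[OF has_sum_infsum[OF ng], of "norm (f x)"] by simp
    show "(\<lambda>x. norm (f x) * infsum (\<lambda>y. norm (g y)) B) summable_on A"
      by (rule summable_on_cmult_left[OF nf])
  qed auto
  then have "(\<lambda>z. norm (case z of (x, y) \<Rightarrow> f x * g y)) summable_on A \<times> B"
    by (simp add: case_prod_unfold norm_mult)
  then show "(\<lambda>(x, y). f x * g y) summable_on A \<times> B"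
    by (rule abs_summable_summable)
qed

lemma powr_of_nat_mult: "(of_nat (m * n) :: complex) powr s = of_nat m powr s * of_nat n powr s"
  by (simp add: powr_times_real)

lemma powr_of_nat_square: "(of_nat (n\<^sup>2) :: complex) powr (- (s / 2)) = of_nat n powr (- s)"
proof (cases "n = 0")
  case False
  have "(of_nat (n\<^sup>2) :: complex) powr (- (s / 2)) = of_nat n powr (- (s / 2)) * of_nat n powr (- (s / 2))"
    by (simp only: power2_eq_square powr_of_nat_mult)
  also have "\<dots> = of_nat n powr (- (s / 2) + - (s / 2))" using False by (simp only: powr_add)
  finally show ?thesis by simp
qed auto

lemma norm_powr_of_nat: "norm ((of_nat n :: complex) powr (- s)) = real n powr (- Re s)"
  by (subst norm_powr_real_powr) auto

lemma has_sum_zeta: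
  assumes "Re s > 1"
  shows "((\<lambda>n. of_nat n powr (- s)) has_sum zeta s) {1..}"
proof -
  have "summable (\<lambda>n. norm ((of_nat n :: complex) powr (- s)))"
    unfolding norm_powr_of_nat using assms by (simp add: summable_real_powr_iff)
  then have "(\<lambda>n. (of_nat n :: complex) powr (- s)) summable_on UNIV"
    by (rule norm_summable_imp_summable_on)
  then have "(\<lambda>n. (of_nat n :: complex) powr (- s)) summable_on {1..}"
    by (rule summable_on_subset_banach) auto
  then show ?thesis unfolding zeta_def by (rule has_sum_infsum)
qed

lemma has_sum_zeta_odd:
  assumes "Re s > 1"
  shows "((\<lambda>n. of_nat n powr (- s)) has_sum ((1 - 2 powr (- s)) * zeta s)) {n. odd n}"
proof -
  let ?f = "\<lambda>n. (of_nat n :: complex) powr (- s)"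
  have "((\<lambda>n. 2 powr (- s) * ?f n) has_sum (2 powr (- s) * zeta s)) {1..}"
    by (rule has_sum_cmult_right[OF has_sum_zeta[OF assms]])
  moreover have "(\<lambda>n. 2 powr (- s) * ?f n) = ?f \<circ> (*) 2"
    using powr_of_nat_mult[of 2 _ "- s"] by (simp add: fun_eq_iff)
  ultimately have "((?f \<circ> (*) 2) has_sum (2 powr (- s) * zeta s)) {1..}" by metis
  then have ev: "(?f has_sum (2 powr (- s) * zeta s)) ((*) 2 ` {1..})"
    by (subst has_sum_reindex) (auto simp: inj_on_def)
  have "(?f has_sum (zeta s - 2 powr (- s) * zeta s)) ({1..} - (*) 2 ` {1..})"
    by (rule has_sum_Diff[OF has_sum_zeta[OF assms] ev]) auto
  moreover have "{1..} - (*) 2 ` {1..} = {n :: nat. odd n}"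
    by (auto elim!: evenE intro: odd_pos) (metis One_nat_def Suc_leI odd_pos)
  ultimately show ?thesis by (simp add: algebra_simps)
qed

text \<open>The terms after the first one add up to less than \<open>1\<close> in absolute value: they are at most
\<open>1 / (4 * n\<^sup>2)\<close>, and the sum of \<open>1 / n\<^sup>2\<close> is \<open>pi\<^sup>2 / 6\<close>.\<close>

lemma zeta_nonzero:
  assumes "Re s > 4" shows "zeta s \<noteq> 0"
proof
  assume z: "zeta s = 0"
  let ?f = "\<lambda>n. (of_nat n :: complex) powr (- s)"
  have "(?f has_sum (zeta s - 1)) ({1..} - {1})"
    using assms by (intro has_sum_Diff has_sum_zeta has_sum_finiteI) auto
  then have f: "(?f has_sum (- 1)) {2..}"
  proof -
    have "{1..} - {1} = {2 :: nat..}" by auto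
    moreover assume "(?f has_sum (zeta s - 1)) ({1..} - {1})"
    ultimately show ?thesis using z by simp
  qed
  have "(\<lambda>n. 1 / (real n + 1)\<^sup>2) sums (pi\<^sup>2 / 6)"
    using inverse_squares_sums by (simp add: add.commute)
  then have "((\<lambda>n. 1 / (real n + 1)\<^sup>2) has_sum (pi\<^sup>2 / 6)) UNIV"
    by (rule sums_nonneg_imp_has_sum) auto
  then have "((\<lambda>n. 1 / (real n + 1)\<^sup>2) has_sum (pi\<^sup>2 / 6 - 1)) (UNIV - {0})"
    by (rule has_sum_Diff[OF _ has_sum_finiteI]) auto
  then have "((\<lambda>n. 1/4 * (1 / (real n + 1)\<^sup>2)) has_sum (1/4 * (pi\<^sup>2 / 6 - 1))) (UNIV - {0})"
    by (rule has_sum_cmult_right)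
  moreover have "(\<lambda>n. 1/4 * (1 / (real n + 1)\<^sup>2)) = (\<lambda>n. 1/4 * (1 / (real n)\<^sup>2)) \<circ> Suc"
    by (simp add: fun_eq_iff add.commute)
  ultimately have "((\<lambda>n. 1/4 * (1 / (real n)\<^sup>2)) has_sum (1/4 * (pi\<^sup>2 / 6 - 1))) (Suc ` (UNIV - {0}))"
    by (subst has_sum_reindex) auto
  moreover have "Suc ` (UNIV - {0}) = {2..}"
  proof
    show "{2..} \<subseteq> Suc ` (UNIV - {0})"
    proof
      fix n :: nat assume "n \<in> {2..}"
      then have "n = Suc (n - 1)" "n - 1 \<in> UNIV - {0}" by auto
      then show "n \<in> Suc ` (UNIV - {0})" by blast
    qed
  qed auto
  ultimately have g: "((\<lambda>n. 1/4 * (1 / (real n)\<^sup>2)) has_sum (1/4 * (pi\<^sup>2 / 6 - 1))) {2..}"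
    by simp
  have le: "norm (?f n) \<le> 1/4 * (1 / (real n)\<^sup>2)" if "n \<in> {2..}" for n
  proof -
    have n: "real n \<ge> 2" using that by simp
    have "norm (?f n) = real n powr (- Re s)" by (rule norm_powr_of_nat)
    also have "\<dots> \<le> real n powr (- 4)" using assms n by (intro powr_mono) auto
    also have "\<dots> = 1 / (real n)\<^sup>2 * (1 / (real n)\<^sup>2)"
      using n by (simp add: powr_minus powr_numeral divide_simps power2_eq_square power4_eq_xxxx)
    also have "\<dots> \<le> 1/4 * (1 / (real n)\<^sup>2)"
    proof (rule mult_right_mono)
      have "(2::real)\<^sup>2 \<le> (real n)\<^sup>2" using n by (intro power_mono) auto
      then show "1 / (real n)\<^sup>2 \<le> 1/4" by (simp add: divide_simps)
    qed auto
    finally show ?thesis .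
  qed
  have "norm (- 1 :: complex) \<le> 1/4 * (pi\<^sup>2 / 6 - 1)"
    by (rule norm_infsum_le[OF f g le])
  moreover have "pi\<^sup>2 \<le> 4\<^sup>2" using pi_less_4 pi_gt_zero by (intro power_mono) auto
  ultimately show False by simp
qed

definition odd_right_ideals :: "quat set set" where
  "odd_right_ideals = {I \<in> nonzero_right_ideals. odd (ideal_norm I)}"

text \<open>The right ideals of odd norm correspond to triples \<open>(d, e, r)\<close> with \<open>d\<close>, \<open>e\<close> odd and \<open>r < d\<close>, and the norm
is \<open>d * e\<close>. Summation over \<open>r\<close> contributes a factor \<open>d\<close>, which shifts the argument of the first zeta
function.\<close>

lemma has_sum_odd_right_ideals:
  assumes "Re s > 2"
  shows "((\<lambda>I. of_nat (ideal_norm I) powr (- s)) has_sum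
     ((1 - 2 powr (- (s - 1))) * zeta (s - 1) * ((1 - 2 powr (- s)) * zeta s))) odd_right_ideals"
proof -
  define Od where "Od = {n :: nat. odd n}"
  define T where "T = Sigma (Od \<times> Od) (\<lambda>(d, e). {..<d})"
  let ?F = "\<lambda>((d, e), r :: nat). (of_nat (d * e) :: complex) powr (- s)"
  have inner: "((\<lambda>r. ?F ((d, e), r)) has_sum (of_nat d powr (- (s - 1)) * of_nat e powr (- s))) {..<d}"
    if "d \<in> Od" for d e
  proof (rule has_sum_finiteI)
    have "d \<noteq> 0" using that by (auto simp: Od_def intro: Nat.gr0I)
    have "(\<Sum>r<d. ?F ((d, e), r)) = of_nat d * (of_nat d powr (- s) * of_nat e powr (- s))"
      by (simp only: prod.case powr_of_nat_mult sum_constant card_lessThan)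
    also have "of_nat d * (of_nat d powr (- s) * of_nat e powr (- s)) = (of_nat d powr 1 * of_nat d powr (- s)) * of_nat e powr (- s)"
      by (simp add: mult.assoc)
    also have "of_nat d powr 1 * of_nat d powr (- s) = (of_nat d :: complex) powr (- (s - 1))"
      by (simp only: powr_add[symmetric]) simp
    finally show "of_nat d powr (- (s - 1)) * of_nat e powr (- s) = (\<Sum>r<d. ?F ((d, e), r))" by simp
  qed simp
  have outer: "((\<lambda>(d, e). of_nat d powr (- (s - 1)) * of_nat e powr (- s)) has_sum
      ((1 - 2 powr (- (s - 1))) * zeta (s - 1) * ((1 - 2 powr (- s)) * zeta s))) (Od \<times> Od)"
    unfolding Od_def using assms by (intro has_sum_mult_Times has_sum_zeta_odd) auto
  have "(?F has_sum ((1 - 2 powr (- (s - 1))) * zeta (s - 1) * ((1 - 2 powr (- s)) * zeta s))) T"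
    unfolding T_def
  proof (rule has_sum_SigmaI[OF _ outer])
    show "((\<lambda>y. ?F (x, y)) has_sum (case x of (d, e) \<Rightarrow> of_nat d powr (- (s - 1)) * of_nat e powr (- s))) (case x of (d, e) \<Rightarrow> {..<d})"
      if "x \<in> Od \<times> Od" for x
      using that inner by (cases x) auto
    have "(\<lambda>(d, e). norm ((of_nat d :: complex) powr (- (s - 1)) * of_nat e powr (- s))) summable_on Od \<times> Od"
      using has_sum_imp_summable[OF outer]
      by (simp add: summable_on_iff_abs_summable_on_complex case_prod_unfold)
    then have "(\<lambda>z. norm (?F z)) summable_on Sigma (Od \<times> Od) (\<lambda>(d, e). {..<d})"
    proof (rule summable_on_SigmaI[rotated])
      fix x :: "nat \<times> nat" assume "x \<in> Od \<times> Od"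
      then obtain d e where x: "x = (d, e)" "d \<in> Od" by auto
      have d0: "d \<noteq> 0" using x(2) by (auto simp: Od_def intro: Nat.gr0I)
      have "(\<Sum>r<d. norm (?F ((d, e), r))) = real d * real (d * e) powr (- Re s)"
        by (simp only: prod.case norm_powr_of_nat sum_constant card_lessThan)
      also have "\<dots> = (real d powr 1 * real d powr (- Re s)) * real e powr (- Re s)"
        by (simp add: powr_mult)
      also have "real d powr 1 * real d powr (- Re s) = real d powr (- Re (s - 1))"
        by (simp only: powr_add[symmetric]) simp
      also have "\<dots> * real e powr (- Re s) = norm ((of_nat d :: complex) powr (- (s - 1)) * of_nat e powr (- s))"
        by (simp only: norm_mult norm_powr_of_nat)
      finally show "((\<lambda>y. norm (?F (x, y))) has_sum (case x of (d, e) \<Rightarrow> norm ((of_nat d :: complex) powr (- (s - 1)) * of_nat e powr (- s)))) (case x of (d, e) \<Rightarrow> {..<d})"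
        unfolding x(1) prod.case by (intro has_sum_finiteI) (auto simp: case_prod_unfold)
    qed auto
    then show "?F summable_on Sigma (Od \<times> Od) (\<lambda>(d, e). {..<d})"
      by (rule abs_summable_summable)
  qed
  moreover have "\<exists>h. bij_betw h T odd_right_ideals \<and> (\<forall>d e r. ((d, e), r) \<in> T \<longrightarrow> ideal_norm (h ((d, e), r)) = d * e)"
  proof -
    have "\<forall>m. \<exists>f. odd m \<longrightarrow> bij_betw f (hnf_triples m) {I \<in> nonzero_right_ideals. ideal_norm I = m}"
      using ideals_of_odd_norm_bij by blast
    then obtain f where f: "\<And>m. odd m \<Longrightarrow> bij_betw (f m) (hnf_triples m) {I \<in> nonzero_right_ideals. ideal_norm I = m}"
      by metis
    define h where "h = (\<lambda>((d, e), r). f (d * e) (d, e, r))"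
    have T: "((d, e), r) \<in> T \<longleftrightarrow> odd (d * e) \<and> (d, e, r) \<in> hnf_triples (d * e)" for d e r
      by (auto simp: T_def Od_def hnf_triples_def)
    have norm: "h ((d, e), r) \<in> nonzero_right_ideals \<and> ideal_norm (h ((d, e), r)) = d * e" if "((d, e), r) \<in> T" for d e r
      using bij_betwE[OF f[of "d * e"]] that[unfolded T] by (auto simp: h_def)
    have "bij_betw h T odd_right_ideals"
      unfolding bij_betw_def
    proof
      show "inj_on h T"
      proof (rule inj_onI)
        fix x y assume xy: "x \<in> T" "y \<in> T" "h x = h y"
        obtain d e r where x: "x = ((d, e), r)" by (metis surj_pair)
        obtain d' e' r' where y: "y = ((d', e'), r')" by (metis surj_pair)
        have de: "d * e = d' * e'" using norm[of d e r] norm[of d' e' r'] xy x y by simp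
        have od: "odd (d * e)" using xy(1) x T by blast
        have "f (d * e) (d, e, r) = f (d * e) (d', e', r')" using xy(3) by (simp add: x y h_def de)
        moreover have "(d, e, r) \<in> hnf_triples (d * e)" "(d', e', r') \<in> hnf_triples (d * e)"
          using xy(1,2) unfolding x y T de by auto
        ultimately have "(d, e, r) = (d', e', r')"
          using bij_betw_imp_inj_on[OF f[OF od]] by (meson inj_onD)
        then show "x = y" by (simp add: x y)
      qed
      show "h ` T = odd_right_ideals"
      proof
        show "h ` T \<subseteq> odd_right_ideals"
        proof clarify
          fix d e r assume t: "((d, e), r) \<in> T"
          then show "h ((d, e), r) \<in> odd_right_ideals"
            using norm[OF t] T by (simp add: odd_right_ideals_def)
        qed
        show "odd_right_ideals \<subseteq> h ` T"
        proof
          fix I assume I: "I \<in> odd_right_ideals"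
          define m where "m = ideal_norm I"
          have "odd m" using I by (simp add: odd_right_ideals_def m_def)
          then have "I \<in> f m ` hnf_triples m"
            using I bij_betw_imp_surj_on[OF f[of m]] by (auto simp: odd_right_ideals_def m_def)
          then obtain d e r where t: "(d, e, r) \<in> hnf_triples m" "I = f m (d, e, r)" by auto
          then have "m = d * e" by (simp add: hnf_triples_def)
          then have "((d, e), r) \<in> T" "I = h ((d, e), r)" using t \<open>odd m\<close> unfolding T by (simp_all add: h_def)
          then show "I \<in> h ` T" by blast
        qed
      qed
    qed
    then show ?thesis using norm by blast
  qed
  then obtain h where h: "bij_betw h T odd_right_ideals" "\<And>d e r. ((d, e), r) \<in> T \<Longrightarrow> ideal_norm (h ((d, e), r)) = d * e"
    by blast
  have "((\<lambda>x. of_nat (ideal_norm (h x)) powr (- s)) has_sum a) T \<longleftrightarrow> (?F has_sum a) T" for a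
    by (rule has_sum_cong) (use h(2) in auto)
  ultimately show ?thesis
    using has_sum_reindex_bij_betw[OF h(1)] by blast
qed

lemma ideal_norm_twist:
  assumes "P \<in> reduced_ideals" "n > 0"
  shows "ideal_norm ((\<lambda>x. x * twist n e) ` P) = ideal_norm P * ((nat n)\<^sup>2 * (if e then 2 else 1))"
proof -
  obtain p where p: "reduced p" "P = rspan p" using assms(1) by (auto simp: reduced_ideals_def)
  note pH = reduced_hurwitz[OF p(1)] and p0 = reduced_nonzero[OF p(1)]
  have "ideal_norm (rspan (p * twist n e)) = hnorm (p * twist n e)"
    using p0 twist_nonzero[of n e] assms(2) by (intro ideal_norm_rspan hurwitz_mult pH twist_hurwitz) auto
  then show ?thesis
    using assms(2) by (simp add: p(2) rspan_mult_twist[symmetric] hnorm_mult pH twist_hurwitz hnorm_twist ideal_norm_rspan p0 nat_power_eq)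
qed

lemma reduced_ideals_norm_odd: "P \<in> reduced_ideals \<Longrightarrow> odd (ideal_norm P)"
  using ideal_norm_rspan reduced_hurwitz reduced_nonzero reduced_odd by (auto simp: reduced_ideals_def)

lemma reduced_ideals_subset: "reduced_ideals \<subseteq> odd_right_ideals"
proof
  fix P assume P: "P \<in> reduced_ideals"
  then show "P \<in> odd_right_ideals"
    using reduced_ideals_norm_odd[OF P] reduced_hurwitz reduced_nonzero
    by (auto simp: odd_right_ideals_def nonzero_right_ideals_eq reduced_ideals_def)
qed

lemma bij_betw_odd_right_ideals:
  "bij_betw (\<lambda>(P, n). (\<lambda>x. x * twist (int n) False) ` P) (reduced_ideals \<times> {n. odd n}) odd_right_ideals"
proof -
  let ?f = "\<lambda>(P, n, e). (\<lambda>x. x * twist n e) ` P"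
  let ?g = "\<lambda>(P, n). (P, int n, False)"
  have odd_iff: "odd (ideal_norm (?f (P, n, e))) \<longleftrightarrow> odd n \<and> \<not> e" if "P \<in> reduced_ideals" "n > 0" for P n e
    using that ideal_norm_twist[OF that] reduced_ideals_norm_odd[OF that(1)] by (auto simp: even_nat_iff)
  have inj: "inj_on ?f (reduced_ideals \<times> {0<..} \<times> UNIV)" and surj: "?f ` (reduced_ideals \<times> {0<..} \<times> UNIV) = nonzero_right_ideals"
    using bij_betw_right_ideals by (auto simp: bij_betw_def)
  have pos: "odd n \<Longrightarrow> 0 < int n" for n :: nat using odd_pos by auto
  have sub: "?g ` (reduced_ideals \<times> {n. odd n}) \<subseteq> reduced_ideals \<times> {0<..} \<times> UNIV"
    using pos by auto
  have "inj_on (?f \<circ> ?g) (reduced_ideals \<times> {n. odd n})"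
    by (rule comp_inj_on[OF _ inj_on_subset[OF inj sub]]) (auto simp: inj_on_def)
  moreover have "(?f \<circ> ?g) ` (reduced_ideals \<times> {n. odd n}) = odd_right_ideals"
  proof
    show "(?f \<circ> ?g) ` (reduced_ideals \<times> {n. odd n}) \<subseteq> odd_right_ideals"
    proof clarify
      fix P and n :: nat assume *: "P \<in> reduced_ideals" "odd n"
      have "?f (P, int n, False) \<in> nonzero_right_ideals"
        unfolding surj[symmetric] using * pos by (intro imageI) auto
      then show "(?f \<circ> ?g) (P, n) \<in> odd_right_ideals"
        using odd_iff[OF *(1) pos[OF *(2)], of False] *(2) by (simp add: odd_right_ideals_def)
    qed
    show "odd_right_ideals \<subseteq> (?f \<circ> ?g) ` (reduced_ideals \<times> {n. odd n})"
    proof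
      fix I assume "I \<in> odd_right_ideals"
      then have I: "I \<in> nonzero_right_ideals" "odd (ideal_norm I)" by (auto simp: odd_right_ideals_def)
      then obtain P n e where P: "P \<in> reduced_ideals" "n > 0" "I = ?f (P, n, e)"
        unfolding surj[symmetric] by auto
      then have "odd n" "\<not> e" using odd_iff[OF P(1,2), of e] I(2) by auto
      then have "I = (?f \<circ> ?g) (P, nat n)" "odd (nat n)" using P by (auto simp: even_nat_iff)
      then show "I \<in> (?f \<circ> ?g) ` (reduced_ideals \<times> {n. odd n})" using P(1) by blast
    qed
  qed
  moreover have "(?f \<circ> ?g) = (\<lambda>(P, n). (\<lambda>x. x * twist (int n) False) ` P)"
    by (simp add: fun_eq_iff)
  ultimately show ?thesis by (simp add: bij_betw_def)
qed

text \<open>The right ideals of odd norm are the products of the reduced ones with odd integers, so their series is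
the wanted one times the odd part of \<open>zeta (2 * s)\<close>. Dividing requires that \<open>zeta (2 * s)\<close> does not vanish.\<close>

lemma has_sum_reduced_ideals:
  assumes s: "Re s > 2"
  shows "((\<lambda>P. of_nat (ideal_norm P) powr (- s)) has_sum
     ((1 - 2 powr (1 - s)) / (1 + 2 powr (- s)) * (zeta s * zeta (s - 1) / zeta (2 * s)))) reduced_ideals"
proof -
  let ?N = "\<lambda>P. (of_nat (ideal_norm P) :: complex) powr (- s)"
  define \<Phi> where "\<Phi> = infsum ?N reduced_ideals"
  have "?N summable_on odd_right_ideals" using has_sum_odd_right_ideals[OF s] by (rule has_sum_imp_summable)
  then have "?N summable_on reduced_ideals" by (rule summable_on_subset_banach[OF _ reduced_ideals_subset])
  then have \<Phi>: "(?N has_sum \<Phi>) reduced_ideals" unfolding \<Phi>_def by (rule has_sum_infsum)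
  have "((\<lambda>(P, n). ?N P * of_nat n powr (- (2 * s))) has_sum (\<Phi> * ((1 - 2 powr (- (2 * s))) * zeta (2 * s)))) (reduced_ideals \<times> {n. odd n})"
    using s by (intro has_sum_mult_Times \<Phi> has_sum_zeta_odd) auto
  also have "?this \<longleftrightarrow> ((\<lambda>x. ?N (case x of (P, n) \<Rightarrow> (\<lambda>x. x * twist (int n) False) ` P)) has_sum (\<Phi> * ((1 - 2 powr (- (2 * s))) * zeta (2 * s)))) (reduced_ideals \<times> {n. odd n})"
  proof (rule has_sum_cong, clarify)
    fix P and n :: nat assume *: "P \<in> reduced_ideals" "odd n"
    then have "n > 0" by (intro odd_pos)
    have "?N ((\<lambda>x. x * twist (int n) False) ` P) = of_nat (ideal_norm P * n\<^sup>2) powr (- s)"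
      using ideal_norm_twist[OF *(1), of "int n" False] \<open>n > 0\<close> by simp
    also have "\<dots> = ?N P * of_nat (n\<^sup>2) powr (- (2 * s / 2))" by (subst powr_of_nat_mult) simp
    finally show "?N P * of_nat n powr (- (2 * s)) = ?N ((\<lambda>x. x * twist (int n) False) ` P)"
      by (simp only: powr_of_nat_square)
  qed
  also have "\<dots> \<longleftrightarrow> (?N has_sum (\<Phi> * ((1 - 2 powr (- (2 * s))) * zeta (2 * s)))) odd_right_ideals"
    by (rule has_sum_reindex_bij_betw[OF bij_betw_odd_right_ideals])
  finally have eq: "\<Phi> * ((1 - 2 powr (- (2 * s))) * zeta (2 * s))
      = (1 - 2 powr (- (s - 1))) * zeta (s - 1) * ((1 - 2 powr (- s)) * zeta s)"
    using has_sum_odd_right_ideals[OF s] has_sum_unique by blast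
  have sq: "2 powr (- (2 * s)) = (2 powr (- s)) * (2 powr (- s) :: complex)"
    by (simp flip: powr_add)
  have lt: "norm ((2::complex) powr (- s)) < 1"
    using s norm_powr_of_nat[of 2 s] powr_less_mono[of "- Re s" 0 2] by simp
  then have ne: "1 - 2 powr (- s) \<noteq> (0 :: complex)" "1 + 2 powr (- s) \<noteq> (0 :: complex)"
    by (auto simp: add_eq_0_iff)
  have z: "zeta (2 * s) \<noteq> 0" using s by (intro zeta_nonzero) auto
  have "(1 - 2 powr (- s)) * (\<Phi> * (1 + 2 powr (- s)) * zeta (2 * s))
      = (1 - 2 powr (- s)) * ((1 - 2 powr (1 - s)) * (zeta s * zeta (s - 1)))"
    using eq unfolding sq by (simp add: algebra_simps)
  then have "\<Phi> * (1 + 2 powr (- s)) * zeta (2 * s) = (1 - 2 powr (1 - s)) * (zeta s * zeta (s - 1))"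
    using mult_left_cancel[OF ne(1)] by blast
  then have quot: "\<Phi> * ((1 + 2 powr (- s)) * zeta (2 * s)) = (1 - 2 powr (1 - s)) * (zeta s * zeta (s - 1))"
    by (simp only: mult.assoc)
  have nz: "(1 + 2 powr (- s)) * zeta (2 * s) \<noteq> 0" using ne(2) z by simp
  have "\<Phi> = (1 - 2 powr (1 - s)) * (zeta s * zeta (s - 1)) / ((1 + 2 powr (- s)) * zeta (2 * s))"
    by (rule nonzero_eq_divide_eq[OF nz, THEN iffD2, OF quot])
  then have "\<Phi> = (1 - 2 powr (1 - s)) / (1 + 2 powr (- s)) * (zeta s * zeta (s - 1) / zeta (2 * s))"
    by simp
  then show ?thesis using \<Phi> by simp
qed

lemma has_sum_nonzero_ideals:
  assumes s: "Re s > 2"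
  shows "((\<lambda>I. of_nat (ideal_norm I) powr (- s)) has_sum ((1 + 2 powr (- s)) * zeta (2 * s))) nonzero_ideals"
    and "((\<lambda>(n, e). (of_nat (n\<^sup>2 * (if e then 2 else 1)) :: complex) powr (- s)) has_sum ((1 + 2 powr (- s)) * zeta (2 * s))) ({1..} \<times> UNIV)"
proof -
  have "((\<lambda>e. (of_nat (if e then 2 else 1) :: complex) powr (- s)) has_sum (1 + 2 powr (- s))) UNIV"
    by (rule has_sum_finiteI) (auto simp: UNIV_bool)
  then have "((\<lambda>(n, e). (of_nat n :: complex) powr (- (2 * s)) * of_nat (if e then 2 else 1) powr (- s)) has_sum
      (zeta (2 * s) * (1 + 2 powr (- s)))) ({1..} \<times> UNIV)"
    using s by (intro has_sum_mult_Times has_sum_zeta) auto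
  moreover have "(of_nat n :: complex) powr (- (2 * s)) * of_nat (if e then 2 else 1) powr (- s)
      = of_nat (n\<^sup>2 * (if e then 2 else 1)) powr (- s)" for n e
    using powr_of_nat_square[of n "2 * s"] by (simp only: powr_of_nat_mult) simp
  ultimately show sum: "((\<lambda>(n, e). (of_nat (n\<^sup>2 * (if e then 2 else 1)) :: complex) powr (- s)) has_sum ((1 + 2 powr (- s)) * zeta (2 * s))) ({1..} \<times> UNIV)"
    by (simp only: mult.commute[of "zeta (2 * s)"])
  have "bij_betw (\<lambda>(n, e). (int n, e)) ({1..} \<times> (UNIV :: bool set)) ({0<..} \<times> UNIV)"
    by (rule bij_betw_byWitness[where f' = "\<lambda>(n, e). (nat n, e)"]) auto
  from bij_betw_trans[OF this bij_betw_ideals]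
  have bij: "bij_betw ((\<lambda>(n, e). rspan (twist n e)) \<circ> (\<lambda>(n, e). (int n, e))) ({1..} \<times> UNIV) nonzero_ideals" .
  have "((\<lambda>x. (of_nat (ideal_norm (((\<lambda>(n, e). rspan (twist n e)) \<circ> (\<lambda>(n, e). (int n, e))) x)) :: complex) powr (- s)) has_sum
      ((1 + 2 powr (- s)) * zeta (2 * s))) ({1..} \<times> UNIV)
     \<longleftrightarrow> ((\<lambda>(n, e). (of_nat (n\<^sup>2 * (if e then 2 else 1)) :: complex) powr (- s)) has_sum ((1 + 2 powr (- s)) * zeta (2 * s))) ({1..} \<times> UNIV)"
  proof (rule has_sum_cong)
    fix x assume "x \<in> {1 :: nat..} \<times> (UNIV :: bool set)"
    then obtain n e where x: "x = (n, e)" "n \<in> {1..}" by blast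
    then have "ideal_norm (rspan (twist (int n) e)) = n\<^sup>2 * (if e then 2 else 1)"
      by (subst ideal_norm_rspan) (auto simp: twist_hurwitz twist_nonzero hnorm_twist nat_power_eq)
    then show "(of_nat (ideal_norm (((\<lambda>(n, e). rspan (twist n e)) \<circ> (\<lambda>(n, e). (int n, e))) x)) :: complex) powr (- s)
        = (case x of (n, e) \<Rightarrow> of_nat (n\<^sup>2 * (if e then 2 else 1)) powr (- s))"
      by (simp only: x(1) o_apply prod.case)
  qed
  then show "((\<lambda>I. of_nat (ideal_norm I) powr (- s)) has_sum ((1 + 2 powr (- s)) * zeta (2 * s))) nonzero_ideals"
    using sum has_sum_reindex_bij_betw[OF bij] by blast
qed

lemma has_sum_nonzero_right_ideals:
  assumes s: "Re s > 2" and \<Phi>: "((\<lambda>P. of_nat (ideal_norm P) powr (- s)) has_sum \<Phi>) reduced_ideals"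
  shows "((\<lambda>I. of_nat (ideal_norm I) powr (- s)) has_sum (\<Phi> * ((1 + 2 powr (- s)) * zeta (2 * s)))) nonzero_right_ideals"
proof -
  have "bij_betw (\<lambda>(P, n, e). (P, int n, e)) (reduced_ideals \<times> {1..} \<times> (UNIV :: bool set)) (reduced_ideals \<times> {0<..} \<times> UNIV)"
    by (rule bij_betw_byWitness[where f' = "\<lambda>(P, n, e). (P, nat n, e)"]) auto
  from bij_betw_trans[OF this bij_betw_right_ideals]
  have bij: "bij_betw ((\<lambda>(P, n, e). (\<lambda>x. x * twist n e) ` P) \<circ> (\<lambda>(P, n, e). (P, int n, e))) (reduced_ideals \<times> {1..} \<times> UNIV) nonzero_right_ideals" .
  have sum: "((\<lambda>(P, x). of_nat (ideal_norm P) powr (- s) * (case x of (n, e) \<Rightarrow> (of_nat (n\<^sup>2 * (if e then 2 else 1)) :: complex) powr (- s))) has_sum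
      (\<Phi> * ((1 + 2 powr (- s)) * zeta (2 * s)))) (reduced_ideals \<times> {1..} \<times> UNIV)"
    by (rule has_sum_mult_Times[OF \<Phi> has_sum_nonzero_ideals(2)[OF s]])
  have "((\<lambda>x. (of_nat (ideal_norm (((\<lambda>(P, n, e). (\<lambda>x. x * twist n e) ` P) \<circ> (\<lambda>(P, n, e). (P, int n, e))) x)) :: complex) powr (- s)) has_sum
      (\<Phi> * ((1 + 2 powr (- s)) * zeta (2 * s)))) (reduced_ideals \<times> {1..} \<times> UNIV)
     \<longleftrightarrow> ((\<lambda>(P, x). of_nat (ideal_norm P) powr (- s) * (case x of (n, e) \<Rightarrow> (of_nat (n\<^sup>2 * (if e then 2 else 1)) :: complex) powr (- s))) has_sum
      (\<Phi> * ((1 + 2 powr (- s)) * zeta (2 * s)))) (reduced_ideals \<times> {1..} \<times> UNIV)"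
  proof (rule has_sum_cong)
    fix x assume "x \<in> reduced_ideals \<times> {1 :: nat..} \<times> (UNIV :: bool set)"
    then obtain P n e where x: "x = (P, n, e)" "P \<in> reduced_ideals" "n \<in> {1..}" by blast
    then have "ideal_norm ((\<lambda>x. x * twist (int n) e) ` P) = ideal_norm P * (n\<^sup>2 * (if e then 2 else 1))"
      using ideal_norm_twist[of P "int n" e] by simp
    then show "(of_nat (ideal_norm (((\<lambda>(P, n, e). (\<lambda>x. x * twist n e) ` P) \<circ> (\<lambda>(P, n, e). (P, int n, e))) x)) :: complex) powr (- s)
      = (case x of (P, x) \<Rightarrow> of_nat (ideal_norm P) powr (- s) * (case x of (n, e) \<Rightarrow> of_nat (n\<^sup>2 * (if e then 2 else 1)) powr (- s)))"
      by (simp only: x(1) o_apply prod.case powr_of_nat_mult)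
  qed
  then show ?thesis using sum has_sum_reindex_bij_betw[OF bij] by blast
qed

lemma nonzero_ideals_subset: "nonzero_ideals \<subseteq> nonzero_right_ideals"
  by (auto simp: nonzero_ideals_def nonzero_right_ideals_def ideal_hurwitz_iff)

lemma ideal_index_powr:
  "I \<in> nonzero_right_ideals \<Longrightarrow> (of_nat (ideal_index I) :: complex) powr (- (s / 2)) = of_nat (ideal_norm I) powr (- s)"
  by (simp only: ideal_index_eq_norm_square powr_of_nat_square)

lemma has_sum_ideal_indices:
  assumes s: "Re s > 2"
  defines "\<Phi> \<equiv> (1 - 2 powr (1 - s)) / (1 + 2 powr (- s)) * (zeta s * zeta (s - 1) / zeta (2 * s))"
  shows "((\<lambda>I. of_nat (ideal_index I) powr (- (s / 2))) has_sum (\<Phi> * ((1 + 2 powr (- s)) * zeta (2 * s)))) nonzero_right_ideals"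
    and "((\<lambda>I. of_nat (ideal_index I) powr (- (s / 2))) has_sum ((1 + 2 powr (- s)) * zeta (2 * s))) nonzero_ideals"
proof -
  show "((\<lambda>I. of_nat (ideal_index I) powr (- (s / 2))) has_sum (\<Phi> * ((1 + 2 powr (- s)) * zeta (2 * s)))) nonzero_right_ideals"
    using has_sum_nonzero_right_ideals[OF s has_sum_reduced_ideals[OF s]] unfolding \<Phi>_def
    by (subst has_sum_cong[OF ideal_index_powr]) auto
  show "((\<lambda>I. of_nat (ideal_index I) powr (- (s / 2))) has_sum ((1 + 2 powr (- s)) * zeta (2 * s))) nonzero_ideals"
    using has_sum_nonzero_ideals(1)[OF s] nonzero_ideals_subset
    by (subst has_sum_cong[OF ideal_index_powr]) auto
qed

section \<open>The three cubic lattices\<close>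

lemma finite_reduced_ideals_of_norm: "finite {P \<in> reduced_ideals. ideal_norm P = m}"
proof (cases "odd m")
  case True
  then obtain f where "bij_betw f (hnf_triples m) {I \<in> nonzero_right_ideals. ideal_norm I = m}"
    using ideals_of_odd_norm_bij by blast
  then have "finite {I \<in> nonzero_right_ideals. ideal_norm I = m}"
    using finite_hnf_triples[of m] True odd_pos bij_betw_finite by blast
  then show ?thesis
    by (rule rev_finite_subset) (use reduced_ideals_subset in \<open>auto simp: odd_right_ideals_def\<close>)
next
  case False
  then have "{P \<in> reduced_ideals. ideal_norm P = m} = {}" using reduced_ideals_norm_odd by auto
  then show ?thesis by (simp only: finite.emptyI)
qed

text \<open>Both sides sum over the same ideals, on the left grouped by their norm.\<close>

lemma has_sum_csl_count:
  fixes s :: complex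
  assumes L: "(\<Gamma>, G) \<in> lattice_pairs"
    and \<Phi>: "((\<lambda>P. of_nat (ideal_norm P) powr (- s)) has_sum \<Phi>) reduced_ideals"
  shows "((\<lambda>m. of_nat (csl_count \<Gamma> m) * of_nat m powr (- s)) has_sum \<Phi>) {1..}"
proof -
  define B where "B m = {P \<in> reduced_ideals. ideal_norm P = m}" for m
  have card: "csl_count \<Gamma> m = card (B m)" for m
    unfolding csl_count_def B_def using csls_of_index_bij[OF L, of m] bij_betw_same_card by metis
  have bij: "bij_betw snd (Sigma {1..} B) reduced_ideals"
  proof (rule bij_betw_byWitness[where f' = "\<lambda>P. (ideal_norm P, P)"])
    have "ideal_norm P \<ge> 1" if "P \<in> reduced_ideals" for P
      using reduced_ideals_norm_odd[OF that] odd_pos[of "ideal_norm P"] by simp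
    then show "(\<lambda>P. (ideal_norm P, P)) ` reduced_ideals \<subseteq> Sigma {1..} B" by (auto simp: B_def)
  qed (auto simp: B_def)
  have "((\<lambda>x. of_nat (ideal_norm (snd x)) powr (- s)) has_sum \<Phi>) (Sigma {1..} B)"
    by (rule has_sum_reindex_bij_betw[OF bij, THEN iffD2, OF \<Phi>])
  then show ?thesis
  proof (rule has_sum_SigmaD)
    fix m :: nat
    have "(\<Sum>P\<in>B m. (of_nat (ideal_norm (snd (m, P))) :: complex) powr (- s)) = (\<Sum>P\<in>B m. of_nat m powr (- s))"
      by (rule sum.cong) (auto simp: B_def)
    then show "((\<lambda>P. of_nat (ideal_norm (snd (m, P))) powr (- s)) has_sum of_nat (csl_count \<Gamma> m) * of_nat m powr (- s)) (B m)"
      using finite_reduced_ideals_of_norm[of m] by (intro has_sum_finiteI) (auto simp: card B_def)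
  qed
qed

lemma cubic_lattice_summary:
  assumes L: "(\<Gamma>, G) \<in> lattice_pairs"
  shows "coincidence_spectrum \<Gamma> = {n. odd n}" "finite (csls_of_index \<Gamma> m)"
    "Re s > 2 \<Longrightarrow> ((\<lambda>m. of_nat (csl_count \<Gamma> m) * of_nat m powr (- s)) has_sum
            ((1 - 2 powr (1 - s)) / (1 + 2 powr (- s)) * (zeta s * zeta (s - 1) / zeta (2 * s)))) {1..}"
proof -
  show "coincidence_spectrum \<Gamma> = {n. odd n}"
    unfolding coincidence_spectrum_eq[OF L]
    using reduced_odd ex_reduced_of_odd_norm by (auto simp: image_iff)
  show "finite (csls_of_index \<Gamma> m)"
    using csls_of_index_bij[OF L, of m] finite_reduced_ideals_of_norm[of m] bij_betw_finite by metis
  show "((\<lambda>m. of_nat (csl_count \<Gamma> m) * of_nat m powr (- s)) has_sum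
            ((1 - 2 powr (1 - s)) / (1 + 2 powr (- s)) * (zeta s * zeta (s - 1) / zeta (2 * s)))) {1..}"
    if "Re s > 2"
    by (rule has_sum_csl_count[OF L has_sum_reduced_ideals[OF that]])
qed

theorem theorem3:
  "(\<forall>R\<in>SO3Q. coincidence_index lat_bcc R = coincidence_index lat_p R \<and>
             coincidence_index lat_p R = coincidence_index lat_fcc R) \<and>
   (\<forall>\<Gamma>\<in>{lat_p, lat_bcc, lat_fcc}.
      coincidence_spectrum \<Gamma> = {n. odd n} \<and>
      (\<forall>m\<ge>1. finite (csls_of_index \<Gamma> m)) \<and>
      (\<forall>s. Re s > 2 \<longrightarrow>
         ((\<lambda>m. of_nat (csl_count \<Gamma> m) * of_nat m powr (- s)) has_sum
            ((1 - 2 powr (1 - s)) / (1 + 2 powr (- s)) * (zeta s * zeta (s - 1) / zeta (2 * s))))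
         {1..})) \<and>
   (\<forall>s. Re s > 2 \<longrightarrow>
      (\<lambda>I. of_nat (ideal_index I) powr (- (s / 2)) :: complex) summable_on nonzero_right_ideals \<and>
      (\<lambda>I. of_nat (ideal_index I) powr (- (s / 2)) :: complex) summable_on nonzero_ideals \<and>
      (1 - 2 powr (1 - s)) / (1 + 2 powr (- s)) * (zeta s * zeta (s - 1) / zeta (2 * s)) =
        1 / (1 + 2 powr (- s)) * (zeta_J (s / 2) / zeta (2 * s)) \<and>
      1 / (1 + 2 powr (- s)) * (zeta_J (s / 2) / zeta (2 * s)) =
        zeta_J (s / 2) / zeta_JJ (s / 2))"
proof (intro conjI ballI allI impI)
  show "coincidence_index lat_bcc R = coincidence_index lat_p R"
    "coincidence_index lat_p R = coincidence_index lat_fcc R" if "R \<in> SO3Q" for R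
    using coincidence_index_eq_hnorm[OF that] by auto
next
  fix \<Gamma> assume "\<Gamma> \<in> {lat_p, lat_bcc, lat_fcc}"
  then obtain G where L: "(\<Gamma>, G) \<in> lattice_pairs" by (auto simp: lattice_pairs_def)
  show "coincidence_spectrum \<Gamma> = {n. odd n}" "\<And>m. finite (csls_of_index \<Gamma> m)"
    "\<And>s. Re s > 2 \<Longrightarrow> ((\<lambda>m. of_nat (csl_count \<Gamma> m) * of_nat m powr (- s)) has_sum
            ((1 - 2 powr (1 - s)) / (1 + 2 powr (- s)) * (zeta s * zeta (s - 1) / zeta (2 * s)))) {1..}"
    using cubic_lattice_summary[OF L] by blast+
next
  fix s :: complex assume s: "Re s > 2"
  define \<Phi> where "\<Phi> = (1 - 2 powr (1 - s)) / (1 + 2 powr (- s)) * (zeta s * zeta (s - 1) / zeta (2 * s))"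
  note sums = has_sum_ideal_indices[OF s, folded \<Phi>_def]
  show "(\<lambda>I. of_nat (ideal_index I) powr (- (s / 2)) :: complex) summable_on nonzero_right_ideals"
    using sums(1) by (rule has_sum_imp_summable)
  show "(\<lambda>I. of_nat (ideal_index I) powr (- (s / 2)) :: complex) summable_on nonzero_ideals"
    using sums(2) by (rule has_sum_imp_summable)
  have J: "zeta_J (s / 2) = \<Phi> * ((1 + 2 powr (- s)) * zeta (2 * s))"
    unfolding zeta_J_def using sums(1) by (rule infsumI)
  have JJ: "zeta_JJ (s / 2) = (1 + 2 powr (- s)) * zeta (2 * s)"
    unfolding zeta_JJ_def using sums(2) by (rule infsumI)
  have z: "zeta (2 * s) \<noteq> 0" using s by (intro zeta_nonzero) auto
  have "norm ((2::complex) powr (- s)) < 1"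
    using s norm_powr_of_nat[of 2 s] powr_less_mono[of "- Re s" 0 2] by simp
  then have ne: "1 + 2 powr (- s) \<noteq> (0 :: complex)" by (auto simp: add_eq_0_iff)
  have "\<Phi> = 1 / (1 + 2 powr (- s)) * (zeta_J (s / 2) / zeta (2 * s))"
    unfolding J using z ne by simp
  then show "(1 - 2 powr (1 - s)) / (1 + 2 powr (- s)) * (zeta s * zeta (s - 1) / zeta (2 * s)) =
        1 / (1 + 2 powr (- s)) * (zeta_J (s / 2) / zeta (2 * s))"
    unfolding \<Phi>_def .
  show "1 / (1 + 2 powr (- s)) * (zeta_J (s / 2) / zeta (2 * s)) = zeta_J (s / 2) / zeta_JJ (s / 2)"
    unfolding JJ by simp
qed

end
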